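(* Let $G$ be a finite group and $\pi:G\to U(V)$ a finite-dimensional unitary representation. For every $t\ge1$, an optimal $t$-query algorithm for symmetric oracle discrimination (identify the hidden $a\in G$ given oracle access to $\pi(a)$, $a$ uniform) succeeds with probability $$P_{\rm opt}=\frac{1}{|G|}\sum_{\chi\in I(V^{\otimes t})}\chi(e)^2.$$
   Context: $I(W)$ is the set of irreducible characters of $G$ appearing in the representation $W$. Symmetric oracle discrimination is the coset identification problem with $f=\mathrm{id}:G\to G$. A $t$-query algorithm consists of $N\ge1$, unit vector $\psi\in V\otimes\mathbb{C}^N$, unitaries $U_1,\dots,U_t$ and a POVM $\{E_x\}_{x\in G}$; on hidden $a$ it produces $\psi_a=U_t(\pi(a)\otimes I)\cdots U_1(\pi(a)\otimes I)\psi$; success probability is $\frac1{|G|}\sum_a\langle\psi_a|E_a|\psi_a\rangle$. *)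

theory Defs
  imports "Jordan_Normal_Form.Matrix" "HOL-Algebra.Group"
begin

definition adj :: "complex mat \<Rightarrow> complex mat" where
  "adj A = mat (dim_col A) (dim_row A) (\<lambda>(i,j). cnj (A $$ (j,i)))"

definition unitary_mat :: "nat \<Rightarrow> complex mat \<Rightarrow> bool" where
  "unitary_mat n U \<longleftrightarrow> U \<in> carrier_mat n n \<and> adj U * U = 1\<^sub>m n"

definition mtrace :: "complex mat \<Rightarrow> complex" where
  "mtrace A = (\<Sum>i<dim_row A. A $$ (i,i))"

definition kron :: "complex mat \<Rightarrow> complex mat \<Rightarrow> complex mat" where
  "kron A B = mat (dim_row A * dim_row B) (dim_col A * dim_col B)
     (\<lambda>(i,j). A $$ (i div dim_row B, j div dim_col B) * B $$ (i mod dim_row B, j mod dim_col B))"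

fun tpow :: "nat \<Rightarrow> complex mat \<Rightarrow> complex mat" where
  "tpow 0 A = 1\<^sub>m 1"
| "tpow (Suc t) A = kron (tpow t A) A"

definition psd_mat :: "nat \<Rightarrow> complex mat \<Rightarrow> bool" where
  "psd_mat n E \<longleftrightarrow> E \<in> carrier_mat n n \<and> adj E = E \<and>
     (\<forall>v \<in> carrier_vec n. Im ((E *\<^sub>v v) \<bullet>c v) = 0 \<and> Re ((E *\<^sub>v v) \<bullet>c v) \<ge> 0)"

definition representation :: "('a, 'b) monoid_scheme \<Rightarrow> nat \<Rightarrow> ('a \<Rightarrow> complex mat) \<Rightarrow> bool" where
  "representation G n \<rho> \<longleftrightarrow>
     (\<forall>g \<in> carrier G. \<rho> g \<in> carrier_mat n n) \<and>
     (\<forall>g \<in> carrier G. \<forall>h \<in> carrier G. \<rho> (g \<otimes>\<^bsub>G\<^esub> h) = \<rho> g * \<rho> h) \<and>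
     \<rho> \<one>\<^bsub>G\<^esub> = 1\<^sub>m n"

definition unitary_rep :: "('a, 'b) monoid_scheme \<Rightarrow> nat \<Rightarrow> ('a \<Rightarrow> complex mat) \<Rightarrow> bool" where
  "unitary_rep G n \<rho> \<longleftrightarrow> representation G n \<rho> \<and> (\<forall>g \<in> carrier G. unitary_mat n (\<rho> g))"

definition invariant_subspace :: "('a, 'b) monoid_scheme \<Rightarrow> nat \<Rightarrow> ('a \<Rightarrow> complex mat) \<Rightarrow> complex vec set \<Rightarrow> bool" where
  "invariant_subspace G n \<rho> S \<longleftrightarrow>
     S \<subseteq> carrier_vec n \<and> 0\<^sub>v n \<in> S \<and>
     (\<forall>v \<in> S. \<forall>w \<in> S. v + w \<in> S) \<and>
     (\<forall>c. \<forall>v \<in> S. c \<cdot>\<^sub>v v \<in> S) \<and>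
     (\<forall>g \<in> carrier G. \<forall>v \<in> S. \<rho> g *\<^sub>v v \<in> S)"

definition irreducible_rep :: "('a, 'b) monoid_scheme \<Rightarrow> nat \<Rightarrow> ('a \<Rightarrow> complex mat) \<Rightarrow> bool" where
  "irreducible_rep G n \<rho> \<longleftrightarrow> representation G n \<rho> \<and> n > 0 \<and>
     (\<forall>S. invariant_subspace G n \<rho> S \<longrightarrow> S = {0\<^sub>v n} \<or> S = carrier_vec n)"

text \<open>Character, restricted to the carrier (0 outside) so that it is a well-defined object.\<close>
definition character :: "('a, 'b) monoid_scheme \<Rightarrow> ('a \<Rightarrow> complex mat) \<Rightarrow> 'a \<Rightarrow> complex" where
  "character G \<rho> = (\<lambda>g. if g \<in> carrier G then mtrace (\<rho> g) else 0)"

definition appears_in :: "('a, 'b) monoid_scheme \<Rightarrow> nat \<Rightarrow> ('a \<Rightarrow> complex mat) \<Rightarrow> nat \<Rightarrow> ('a \<Rightarrow> complex mat) \<Rightarrow> bool" where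
  "appears_in G n \<rho> m W \<longleftrightarrow>
     (\<exists>A \<in> carrier_mat m n. A \<noteq> 0\<^sub>m m n \<and> (\<forall>g \<in> carrier G. W g * A = A * \<rho> g))"

definition irr_chars :: "('a, 'b) monoid_scheme \<Rightarrow> nat \<Rightarrow> ('a \<Rightarrow> complex mat) \<Rightarrow> ('a \<Rightarrow> complex) set" where
  "irr_chars G m W = {character G \<rho> | \<rho> n. irreducible_rep G n \<rho> \<and> appears_in G n \<rho> m W}"

definition alg_state :: "('a \<Rightarrow> complex mat) \<Rightarrow> nat \<Rightarrow> complex vec \<Rightarrow> complex mat list \<Rightarrow> 'a \<Rightarrow> complex vec" where
  "alg_state \<pi> N \<psi> Us a = foldl (\<lambda>\<phi> U. U *\<^sub>v (kron (\<pi> a) (1\<^sub>m N) *\<^sub>v \<phi>)) \<psi> Us"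

definition valid_alg :: "('a, 'b) monoid_scheme \<Rightarrow> nat \<Rightarrow> nat \<Rightarrow> nat \<Rightarrow> complex vec \<Rightarrow> complex mat list \<Rightarrow> ('a \<Rightarrow> complex mat) \<Rightarrow> bool" where
  "valid_alg G d t N \<psi> Us E \<longleftrightarrow>
     N \<ge> 1 \<and> \<psi> \<in> carrier_vec (d * N) \<and> \<psi> \<bullet>c \<psi> = 1 \<and>
     length Us = t \<and> (\<forall>U \<in> set Us. unitary_mat (d * N) U) \<and>
     (\<forall>x \<in> carrier G. psd_mat (d * N) (E x)) \<and>
     (\<forall>i < d * N. \<forall>j < d * N. (\<Sum>x \<in> carrier G. E x $$ (i,j)) = (1\<^sub>m (d * N)) $$ (i,j))"

definition success_prob :: "('a, 'b) monoid_scheme \<Rightarrow> ('a \<Rightarrow> complex mat) \<Rightarrow> nat \<Rightarrow> complex vec \<Rightarrow> complex mat list \<Rightarrow> ('a \<Rightarrow> complex mat) \<Rightarrow> real" where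
  "success_prob G \<pi> N \<psi> Us E =
     (1 / real (card (carrier G))) *
     (\<Sum>a \<in> carrier G. Re ((E a *\<^sub>v alg_state \<pi> N \<psi> Us a) \<bullet>c alg_state \<pi> N \<psi> Us a))"

definition success_probs :: "('a, 'b) monoid_scheme \<Rightarrow> ('a \<Rightarrow> complex mat) \<Rightarrow> nat \<Rightarrow> nat \<Rightarrow> real set" where
  "success_probs G \<pi> d t =
     {success_prob G \<pi> N \<psi> Us E | N \<psi> Us E. valid_alg G d t N \<psi> Us E}"

end

(*
  A t-query algorithm produces states whose amplitudes are linear in the entries of W = pi^(x)t.
  With k = sum_chi (chi(e)/|G|) chi over the irreducible characters chi appearing in W, Schur
  orthogonality makes k an idempotent for convolution acting as the identity on W, so every such
  entry f satisfies f(h) = sum_g k(h^-1 g) f(g). The kernel k(h^-1 g) is a sum of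
  D = sum_chi chi(e)^2 products, hence the final states span at most D dimensions and
  sum_a <psi_a|E_a|psi_a> is at most D.

  Conversely, weight the isotypic projections of W so that each chi contributes chi(e)^2/D to the
  squared norm. The translates of the resulting matrix have Gram matrix (|G|/D) k(a^-1 b), i.e. they
  form a tight frame, and measuring them in that frame succeeds with probability D/|G|. Rotating
  t registers between the queries applies W.
*)
theory Submission
  imports Defs "Jordan_Normal_Form.Spectral_Radius"
begin

text \<open>Membership in \<open>irr_chars\<close> asks only for a nonzero intertwiner from some
  irreducible representation, which need not be unitary. Three facts must therefore be earned. The
  relation \<open>\<chi> (inv g) = cnj (\<chi> g)\<close> comes from pulling the inner product of
  \<open>W\<close> back along the intertwiner. Finiteness of the set of characters matters because a
  sum over an infinite set is 0 by convention; it follows from bounding sums of squared degrees by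
  |G|. That the idempotent acts as the identity on \<open>W\<close> is shown without decomposing
  \<open>W\<close>: its kernel is invariant, and an irreducible inside that kernel would have a
  character in the set, where the idempotent acts as 1. The span bounds the success because a POVM
  compressed to it consists of positive matrices whose traces add up to its dimension, and each unit
  vector sees at most the trace. The multiplicity of a character in \<open>W\<close> would distort
  the Gram matrix; dividing by the trace of its isotypic projection cancels it.\<close>

section \<open>Matrix entries, adjoints and traces\<close>

lemma mult_index:
  assumes "A \<in> carrier_mat m n" "B \<in> carrier_mat n k" "i < m" "j < k"
  shows "(A * B) $$ (i,j) = (\<Sum>l<n. A $$ (i,l) * B $$ (l,j))"
  using assms by (auto simp: scalar_prod_def lessThan_atLeast0 intro!: sum.cong)

lemma mult_vec_index:
  assumes "A \<in> carrier_mat m n" "v \<in> carrier_vec n" "i < m"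
  shows "(A *\<^sub>v v) $ i = (\<Sum>l<n. A $$ (i,l) * v $ l)"
  using assms by (auto simp: scalar_prod_def lessThan_atLeast0 intro!: sum.cong)

lemma smult_index: "A \<in> carrier_mat m n \<Longrightarrow> i < m \<Longrightarrow> j < n \<Longrightarrow> (c \<cdot>\<^sub>m A) $$ (i,j) = c * A $$ (i,j)"
  by auto

lemma mult3_carrier:
  "A \<in> carrier_mat m n \<Longrightarrow> B \<in> carrier_mat n k \<Longrightarrow> C \<in> carrier_mat k l \<Longrightarrow> A * B * C \<in> carrier_mat m l"
  by (meson mult_carrier_mat)

lemma cscalar_sum:
  assumes "v \<in> carrier_vec n" "w \<in> carrier_vec n"
  shows "v \<bullet>c w = (\<Sum>i<n. v $ i * cnj (w $ i))"
  using assms by (auto simp: scalar_prod_def lessThan_atLeast0 intro!: sum.cong)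

lemma cscalar_self:
  assumes "v \<in> carrier_vec n"
  shows "v \<bullet>c v = complex_of_real (\<Sum>i<n. (cmod (v $ i))\<^sup>2)"
  unfolding cscalar_sum[OF assms assms] of_real_sum
  by (intro sum.cong refl) (simp only: complex_norm_square)

lemma adj_carrier [simp]: "A \<in> carrier_mat m n \<Longrightarrow> adj A \<in> carrier_mat n m"
  by (auto simp: adj_def)

lemma adj_dims [simp]: "dim_row (adj A) = dim_col A" "dim_col (adj A) = dim_row A"
  by (auto simp: adj_def)

lemma adj_index [simp]: "A \<in> carrier_mat m n \<Longrightarrow> i < n \<Longrightarrow> j < m \<Longrightarrow> adj A $$ (i,j) = cnj (A $$ (j,i))"
  by (auto simp: adj_def)

lemma adj_adj [simp]: "adj (adj A) = A"
  by (auto simp: adj_def)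

lemma adj_one [simp]: "adj (1\<^sub>m n) = 1\<^sub>m n"
  by (auto simp: adj_def)

lemma adj_mult:
  assumes "A \<in> carrier_mat m n" "B \<in> carrier_mat n k"
  shows "adj (A * B) = adj B * adj A"
proof (rule eq_matI)
  fix i j assume "i < dim_row (adj B * adj A)" "j < dim_col (adj B * adj A)"
  then have ij: "i < k" "j < m" using assms by auto
  have "adj (A * B) $$ (i,j) = cnj ((A * B) $$ (j,i))"
    using adj_index[of "A * B" m k] assms ij by auto
  then show "adj (A * B) $$ (i,j) = (adj B * adj A) $$ (i,j)"
    using assms ij
    by (simp add: mult_index[OF assms ij(2) ij(1)] mult_index[OF adj_carrier adj_carrier, OF assms(2) assms(1)]
        mult.commute del: index_mult_mat)
qed (use assms in \<open>auto simp: adj_def\<close>)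

lemma intertwine_mult:
  assumes c: "W \<in> carrier_mat m m" "B \<in> carrier_mat m k" "V \<in> carrier_mat k k" "A \<in> carrier_mat k n" "S \<in> carrier_mat n n"
    and "W * B = B * V" "V * A = A * S"
  shows "W * (B * A) = (B * A) * S"
  using assms(6,7) assoc_mult_mat[OF c(1,2,4)] assoc_mult_mat[OF c(2,3,4)] assoc_mult_mat[OF c(2,4,5)] by simp

lemma mtrace_carrier: "A \<in> carrier_mat n n \<Longrightarrow> mtrace A = (\<Sum>i<n. A $$ (i,i))"
  by (auto simp: mtrace_def)

lemma mtrace_one [simp]: "mtrace (1\<^sub>m n) = of_nat n"
  by (simp add: mtrace_def)

lemma mtrace_smult: "A \<in> carrier_mat n n \<Longrightarrow> mtrace (c \<cdot>\<^sub>m A) = c * mtrace A"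
  by (auto simp: mtrace_def sum_distrib_left)

lemma mtrace_comm:
  assumes "A \<in> carrier_mat m n" "B \<in> carrier_mat n m"
  shows "mtrace (A * B) = mtrace (B * A)"
proof -
  have "mtrace (A * B) = (\<Sum>i<m. \<Sum>l<n. A $$ (i,l) * B $$ (l,i))"
    using assms by (simp add: mtrace_def mult_index[OF assms] del: index_mult_mat(1))
  also have "\<dots> = (\<Sum>l<n. \<Sum>i<m. B $$ (l,i) * A $$ (i,l))"
    by (subst sum.swap) (simp add: mult.commute)
  also have "\<dots> = mtrace (B * A)"
    using assms by (simp add: mtrace_def mult_index[OF assms(2,1)] del: index_mult_mat(1))
  finally show ?thesis .
qed

lemma mtrace_adj: "A \<in> carrier_mat n n \<Longrightarrow> mtrace (adj A) = cnj (mtrace A)"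
  by (auto simp: mtrace_def adj_def)

lemma mtrace_mult_adj:
  assumes "A \<in> carrier_mat m n" "B \<in> carrier_mat m n"
  shows "mtrace (A * adj B) = (\<Sum>i<m. \<Sum>j<n. A $$ (i,j) * cnj (B $$ (i,j)))"
  using assms by (simp add: mtrace_carrier[of _ m] mult_index[of A m n _ m] del: index_mult_mat(1))

lemma cscalar_adj:
  assumes "A \<in> carrier_mat m n" "v \<in> carrier_vec n" "w \<in> carrier_vec m"
  shows "(A *\<^sub>v v) \<bullet>c w = v \<bullet>c (adj A *\<^sub>v w)"
proof -
  have "(A *\<^sub>v v) \<bullet>c w = (\<Sum>i<m. \<Sum>l<n. A $$ (i,l) * v $ l * cnj (w $ i))"
    using assms by (simp add: cscalar_sum[of _ m] mult_vec_index[OF assms(1,2)] sum_distrib_right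
        del: index_mult_mat_vec)
  also have "\<dots> = (\<Sum>l<n. v $ l * cnj (\<Sum>i<m. cnj (A $$ (i,l)) * w $ i))"
    by (subst sum.swap) (simp add: sum_distrib_left mult_ac)
  also have "\<dots> = v \<bullet>c (adj A *\<^sub>v w)"
    using assms adj_carrier[OF assms(1)] mult_mat_vec_carrier[OF adj_carrier[OF assms(1)] assms(3)]
    by (simp add: cscalar_sum[of _ n] mult_vec_index[OF adj_carrier[OF assms(1)] assms(3)]
        del: index_mult_mat_vec)
  finally show ?thesis .
qed

lemma isometry_cscalar:
  assumes "B \<in> carrier_mat m k" "adj B * B = 1\<^sub>m k" "v \<in> carrier_vec k"
  shows "(B *\<^sub>v v) \<bullet>c (B *\<^sub>v v) = v \<bullet>c v"
proof -
  have "(B *\<^sub>v v) \<bullet>c (B *\<^sub>v v) = v \<bullet>c (adj B *\<^sub>v (B *\<^sub>v v))"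
    using assms by (intro cscalar_adj) auto
  also have "adj B *\<^sub>v (B *\<^sub>v v) = v"
    using assms assoc_mult_mat_vec[of "adj B" k m B k v] by simp
  finally show ?thesis .
qed

lemma isometry_zero_iff:
  assumes "B \<in> carrier_mat m k" "adj B * B = 1\<^sub>m k" "v \<in> carrier_vec k"
  shows "B *\<^sub>v v = 0\<^sub>v m \<longleftrightarrow> v = 0\<^sub>v k"
  using isometry_cscalar[OF assms] assms
  by (metis conjugate_square_eq_0_vec mult_mat_vec_carrier)

lemma mult_unit_vec:
  fixes A :: "complex mat"
  assumes "A \<in> carrier_mat m n" "j < n"
  shows "A *\<^sub>v unit_vec n j = col A j"
proof (rule eq_vecI)
  fix i assume "i < dim_vec (col A j)"
  then have "i < m" using assms by simp
  then have "(A *\<^sub>v unit_vec n j) $ i = (\<Sum>l<n. A $$ (i,l) * (if l = j then 1 else 0))"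
    using assms by (simp add: mult_vec_index[OF assms(1)] del: index_mult_mat_vec)
  then show "(A *\<^sub>v unit_vec n j) $ i = col A j $ i"
    using assms \<open>i < m\<close> by (simp add: if_distrib cong: if_cong)
qed (use assms in simp)

lemma mat_eq_zero_iff:
  fixes A :: "complex mat"
  assumes "A \<in> carrier_mat m n"
  shows "A = 0\<^sub>m m n \<longleftrightarrow> (\<forall>v \<in> carrier_vec n. A *\<^sub>v v = 0\<^sub>v m)"
proof
  assume "\<forall>v \<in> carrier_vec n. A *\<^sub>v v = 0\<^sub>v m"
  then have "col A j = 0\<^sub>v m" if "j < n" for j
    using assms that mult_unit_vec[OF assms that] by (metis unit_vec_carrier)
  then show "A = 0\<^sub>m m n"
    using assms by (intro mat_col_eqI) auto
qed (use assms in auto)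

lemma mat_eqI_vec:
  fixes A B :: "complex mat"
  assumes "A \<in> carrier_mat m n" "B \<in> carrier_mat m n"
    "\<And>v. v \<in> carrier_vec n \<Longrightarrow> A *\<^sub>v v = B *\<^sub>v v"
  shows "A = B"
proof (rule mat_col_eqI)
  fix j assume "j < dim_col B"
  then have j: "j < n" using assms by auto
  show "col A j = col B j"
    using mult_unit_vec[OF assms(1) j] mult_unit_vec[OF assms(2) j] assms(3)[of "unit_vec n j"] by simp
qed (use assms in auto)

section \<open>Inverses, dimension and orthonormal bases of subspaces\<close>

lemma injective_imp_inverse:
  fixes H :: "complex mat"
  assumes H: "H \<in> carrier_mat n n" and inj: "\<And>v. v \<in> carrier_vec n \<Longrightarrow> H *\<^sub>v v = 0\<^sub>v n \<Longrightarrow> v = 0\<^sub>v n"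
  obtains H' where "H' \<in> carrier_mat n n" "H * H' = 1\<^sub>m n" "H' * H = 1\<^sub>m n"
proof -
  have "det H \<noteq> 0" using inj unfolding det_0_iff_vec_prod_zero[OF H] by blast
  then have "H \<in> Units (ring_mat TYPE(complex) n ())" by (rule det_non_zero_imp_unit[OF H])
  then show ?thesis using that by (auto simp: Units_def ring_mat_simps)
qed

lemma unitary_adj_right: "unitary_mat n U \<Longrightarrow> U * adj U = 1\<^sub>m n"
  unfolding unitary_mat_def by (auto intro: mat_mult_left_right_inverse[OF adj_carrier])

text \<open>Padding with zeros to square shape, a dimension drop would give an invertible matrix a zero row.\<close>
lemma left_inverse_dim_le:
  fixes X :: "'a :: field mat"
  assumes X: "X \<in> carrier_mat k n" and Y: "Y \<in> carrier_mat n k" and XY: "X * Y = 1\<^sub>m k"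
  shows "k \<le> n"
proof (rule ccontr)
  assume "\<not> k \<le> n"
  then have nk: "n < k" by simp
  define X' where "X' = mat k k (\<lambda>(i,j). if j < n then X $$ (i,j) else 0)"
  define Y' where "Y' = mat k k (\<lambda>(i,j). if i < n then Y $$ (i,j) else 0)"
  have c: "X' \<in> carrier_mat k k" "Y' \<in> carrier_mat k k" by (auto simp: X'_def Y'_def)
  have "X' * Y' = X * Y"
  proof (rule eq_matI)
    fix i j assume "i < dim_row (X * Y)" "j < dim_col (X * Y)"
    then have ij: "i < k" "j < k" using X Y by auto
    have "(X' * Y') $$ (i,j) = (\<Sum>l<k. X' $$ (i,l) * Y' $$ (l,j))"
      using c ij by (simp add: mult_index del: index_mult_mat)
    also have "\<dots> = (\<Sum>l<n. X $$ (i,l) * Y $$ (l,j))"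
      using nk ij by (intro sum.mono_neutral_cong_right) (auto simp: X'_def Y'_def)
    also have "\<dots> = (X * Y) $$ (i,j)"
      using mult_index[OF X Y ij] by simp
    finally show "(X' * Y') $$ (i,j) = (X * Y) $$ (i,j)" .
  qed (use X Y c in auto)
  then have "Y' * X' = 1\<^sub>m k"
    using mat_mult_left_right_inverse[OF c] XY by simp
  then have "(Y' * X') $$ (k - 1, k - 1) = 1" using nk by simp
  moreover have "(Y' * X') $$ (k - 1, k - 1) = (\<Sum>l<k. Y' $$ (k-1,l) * X' $$ (l,k-1))"
    using c nk by (intro mult_index) auto
  moreover have "\<dots> = 0" using nk by (intro sum.neutral) (auto simp: Y'_def)
  ultimately show False by simp
qed

definition subspace_of :: "nat \<Rightarrow> complex vec set \<Rightarrow> bool" where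
  "subspace_of m S \<longleftrightarrow> S \<subseteq> carrier_vec m \<and> 0\<^sub>v m \<in> S \<and>
     (\<forall>v \<in> S. \<forall>w \<in> S. v + w \<in> S) \<and> (\<forall>c. \<forall>v \<in> S. c \<cdot>\<^sub>v v \<in> S)"

lemma subspace_ofD:
  assumes "subspace_of m S"
  shows "S \<subseteq> carrier_vec m" "0\<^sub>v m \<in> S"
    "v \<in> S \<Longrightarrow> w \<in> S \<Longrightarrow> v + w \<in> S" "v \<in> S \<Longrightarrow> c \<cdot>\<^sub>v v \<in> S"
  using assms unfolding subspace_of_def by blast+

lemma subspace_of_range:
  assumes "A \<in> carrier_mat m n"
  shows "subspace_of m ((\<lambda>v. A *\<^sub>v v) ` carrier_vec n)"
  unfolding subspace_of_def
proof (intro conjI ballI allI)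
  show "0\<^sub>v m \<in> (\<lambda>v. A *\<^sub>v v) ` carrier_vec n"
    using assms by (intro image_eqI[of _ _ "0\<^sub>v n"]) auto
next
  fix v w assume "v \<in> (\<lambda>v. A *\<^sub>v v) ` carrier_vec n" "w \<in> (\<lambda>v. A *\<^sub>v v) ` carrier_vec n"
  then obtain x y where "x \<in> carrier_vec n" "y \<in> carrier_vec n" "v = A *\<^sub>v x" "w = A *\<^sub>v y" by auto
  then show "v + w \<in> (\<lambda>v. A *\<^sub>v v) ` carrier_vec n"
    using assms by (intro image_eqI[of _ _ "x + y"]) (auto simp: mult_add_distrib_mat_vec[of A m n])
next
  fix c v assume "v \<in> (\<lambda>v. A *\<^sub>v v) ` carrier_vec n"
  then obtain x where "x \<in> carrier_vec n" "v = A *\<^sub>v x" by auto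
  then show "c \<cdot>\<^sub>v v \<in> (\<lambda>v. A *\<^sub>v v) ` carrier_vec n"
    using assms by (intro image_eqI[of _ _ "c \<cdot>\<^sub>v x"]) (auto simp: mult_mat_vec[of A m n])
qed (use assms in auto)

lemma add_minus_one_smult:
  fixes x :: "complex vec"
  shows "x \<in> carrier_vec k \<Longrightarrow> x + (-1) \<cdot>\<^sub>v x = 0\<^sub>v k"
  by (intro eq_vecI) auto

text \<open>Extending a system of orthonormal columns by the normalised defect of a vector outside its span.\<close>
lemma isometry_extend:
  assumes S: "subspace_of m S" and B: "B \<in> carrier_mat m k" and iso: "adj B * B = 1\<^sub>m k"
    and BS: "\<forall>w \<in> carrier_vec k. B *\<^sub>v w \<in> S"
    and v: "v \<in> S" and nv: "B *\<^sub>v (adj B *\<^sub>v v) \<noteq> v"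
  shows "\<exists>B' \<in> carrier_mat m (Suc k). adj B' * B' = 1\<^sub>m (Suc k) \<and> (\<forall>w \<in> carrier_vec (Suc k). B' *\<^sub>v w \<in> S)"
proof -
  have vc: "v \<in> carrier_vec m" using subspace_ofD(1)[OF S] v by blast
  define r where "r = v + (-1) \<cdot>\<^sub>v (B *\<^sub>v (adj B *\<^sub>v v))"
  have av: "adj B *\<^sub>v v \<in> carrier_vec k" by (rule mult_mat_vec_carrier[OF adj_carrier[OF B] vc])
  have rS: "r \<in> S" unfolding r_def
    by (rule subspace_ofD(3)[OF S v subspace_ofD(4)[OF S BS[rule_format, OF av]]])
  have rc: "r \<in> carrier_vec m" using subspace_ofD(1)[OF S] rS by blast
  have "r \<noteq> 0\<^sub>v m"
  proof
    assume r0: "r = 0\<^sub>v m"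
    have "B *\<^sub>v (adj B *\<^sub>v v) = v"
    proof (rule eq_vecI)
      fix i assume i: "i < dim_vec v"
      then have "r $ i = 0" using r0 vc by simp
      then show "(B *\<^sub>v (adj B *\<^sub>v v)) $ i = v $ i"
        using i vc B unfolding r_def by (simp del: index_mult_mat_vec)
    qed (use B vc in auto)
    then show False using nv by simp
  qed
  then have r2: "r \<bullet>c r \<noteq> 0" using rc by simp
  have Br: "adj B *\<^sub>v r = 0\<^sub>v k"
  proof -
    have "adj B *\<^sub>v (B *\<^sub>v (adj B *\<^sub>v v)) = adj B *\<^sub>v v"
      using B iso av assoc_mult_mat_vec[of "adj B" k m B k "adj B *\<^sub>v v"] by simp
    moreover have "adj B *\<^sub>v r = adj B *\<^sub>v v + (-1) \<cdot>\<^sub>v (adj B *\<^sub>v (B *\<^sub>v (adj B *\<^sub>v v)))"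
      unfolding r_def using adj_carrier[OF B] vc mult_mat_vec_carrier[OF B av]
      by (simp add: mult_add_distrib_mat_vec[OF adj_carrier[OF B]] mult_mat_vec[OF adj_carrier[OF B]]
          del: assoc_mult_mat_vec)
    ultimately have "adj B *\<^sub>v r = adj B *\<^sub>v v + (-1) \<cdot>\<^sub>v (adj B *\<^sub>v v)" by simp
    also have "\<dots> = 0\<^sub>v k"
      by (rule add_minus_one_smult[OF av])
    finally show ?thesis .
  qed
  define s where "s = sqrt (\<Sum>i<m. (cmod (r $ i))\<^sup>2)"
  have rr: "r \<bullet>c r = complex_of_real (s\<^sup>2)"
    unfolding cscalar_self[OF rc] s_def by (simp add: sum_nonneg)
  then have s0: "s \<noteq> 0" using r2 by auto
  define u where "u = complex_of_real (1/s) \<cdot>\<^sub>v r"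
  have uc: "u \<in> carrier_vec m" using rc by (simp add: u_def)
  have uS: "u \<in> S" unfolding u_def by (rule subspace_ofD(4)[OF S rS])
  have uu: "(\<Sum>i<m. cnj (u $ i) * u $ i) = 1"
  proof -
    have "(\<Sum>i<m. cnj (u $ i) * u $ i) = (\<Sum>i<m. r $ i * cnj (r $ i)) / complex_of_real (s\<^sup>2)"
      using rc by (auto simp: u_def sum_divide_distrib power2_eq_square intro!: sum.cong)
    then show ?thesis using rr s0 cscalar_sum[OF rc rc] by simp
  qed
  have Bu: "(\<Sum>i<m. cnj (B $$ (i,j)) * u $ i) = 0" if j: "j < k" for j
  proof -
    have "(adj B *\<^sub>v r) $ j = (\<Sum>i<m. cnj (B $$ (i,j)) * r $ i)"
      using B rc j by (simp add: mult_vec_index[of _ k m] del: index_mult_mat_vec)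
    then have "(\<Sum>i<m. cnj (B $$ (i,j)) * r $ i) = 0" using Br j by simp
    moreover have "(\<Sum>i<m. cnj (B $$ (i,j)) * u $ i) = complex_of_real (1/s) * (\<Sum>i<m. cnj (B $$ (i,j)) * r $ i)"
      using rc by (auto simp: u_def sum_distrib_left intro!: sum.cong)
    ultimately show ?thesis by simp
  qed
  have uB: "(\<Sum>i<m. cnj (u $ i) * B $$ (i,j)) = 0" if j: "j < k" for j
  proof -
    have "(\<Sum>i<m. cnj (u $ i) * B $$ (i,j)) = cnj (\<Sum>i<m. cnj (B $$ (i,j)) * u $ i)"
      by (simp add: mult.commute)
    then show ?thesis using Bu[OF j] by simp
  qed
  have BB: "(\<Sum>i<m. cnj (B $$ (i,j)) * B $$ (i,l)) = (if j = l then 1 else 0)" if "j < k" "l < k" for j l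
  proof -
    have "(adj B * B) $$ (j,l) = (\<Sum>i<m. cnj (B $$ (i,j)) * B $$ (i,l))"
      using B that by (simp add: mult_index[of _ k m _ k] del: index_mult_mat)
    then show ?thesis using that iso by simp
  qed
  define B' where "B' = mat m (Suc k) (\<lambda>(i,j). if j < k then B $$ (i,j) else u $ i)"
  have B'c: "B' \<in> carrier_mat m (Suc k)" by (simp add: B'_def)
  have "adj B' * B' = 1\<^sub>m (Suc k)"
  proof (rule eq_matI)
    fix j l assume "j < dim_row (1\<^sub>m (Suc k))" "l < dim_col (1\<^sub>m (Suc k))"
    then have jl: "j < Suc k" "l < Suc k" by auto
    have "(adj B' * B') $$ (j,l) = (\<Sum>i<m. cnj (B' $$ (i,j)) * B' $$ (i,l))"
      using B'c jl by (simp add: mult_index[of _ "Suc k" m _ "Suc k"] del: index_mult_mat)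
    also have "\<dots> = (if j = l then 1 else 0)"
      using jl uu Bu uB BB by (auto simp: B'_def less_Suc_eq)
    finally show "(adj B' * B') $$ (j,l) = 1\<^sub>m (Suc k) $$ (j,l)" using jl by simp
  qed (use B'c in auto)
  moreover have "B' *\<^sub>v w \<in> S" if w: "w \<in> carrier_vec (Suc k)" for w
  proof -
    have wc: "vec_first w k \<in> carrier_vec k" by simp
    have "B' *\<^sub>v w = B *\<^sub>v (vec_first w k) + w $ k \<cdot>\<^sub>v u"
    proof (rule eq_vecI)
      fix i assume "i < dim_vec (B *\<^sub>v (vec_first w k) + w $ k \<cdot>\<^sub>v u)"
      then have i: "i < m" using uc by simp
      have "(B' *\<^sub>v w) $ i = (\<Sum>l<k. B $$ (i,l) * w $ l) + u $ i * w $ k"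
        unfolding mult_vec_index[OF B'c w i] using i by (simp add: B'_def)
      moreover have "(B *\<^sub>v (vec_first w k)) $ i = (\<Sum>l<k. B $$ (i,l) * w $ l)"
        unfolding mult_vec_index[OF B wc i] using w by (simp add: vec_first_def)
      ultimately show "(B' *\<^sub>v w) $ i = (B *\<^sub>v (vec_first w k) + w $ k \<cdot>\<^sub>v u) $ i"
        using i uc B by (simp del: index_mult_mat_vec)
    qed (use B'c uc B in auto)
    then show ?thesis by (simp add: subspace_ofD[OF S] BS[rule_format, OF wc] uS)
  qed
  ultimately show ?thesis using B'c by blast
qed

text \<open>Gram-Schmidt by maximality: among the systems of orthonormal columns lying in
  \<open>S\<close>, one of greatest size cannot be extended, so it spans \<open>S\<close>. This
  \<open>B\<close> serves as both basis and dimension of \<open>S\<close>, with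
  \<open>B * adj B\<close> the orthogonal projection onto it.\<close>

lemma subspace_isometry:
  assumes S: "subspace_of m S"
  obtains k B where "B \<in> carrier_mat m k" "adj B * B = 1\<^sub>m k" "k \<le> m"
    "\<And>w. w \<in> carrier_vec k \<Longrightarrow> B *\<^sub>v w \<in> S" "\<And>v. v \<in> S \<Longrightarrow> B *\<^sub>v (adj B *\<^sub>v v) = v"
proof -
  define P where "P k \<longleftrightarrow> (\<exists>B \<in> carrier_mat m k. adj B * B = 1\<^sub>m k \<and> (\<forall>w \<in> carrier_vec k. B *\<^sub>v w \<in> S))" for k
  \<comment> \<open>Orthonormal columns have \<open>adj B\<close> as a left inverse, so their number
    cannot exceed \<open>m\<close>; this makes \<open>GREATEST\<close> meaningful.\<close>
  have bound: "k \<le> m" if "P k" for k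
    using that left_inverse_dim_le[of "adj _" k m] unfolding P_def by (meson adj_carrier)
  have "P 0"
    unfolding P_def
  proof (intro bexI conjI ballI)
    fix w :: "complex vec" assume "w \<in> carrier_vec 0"
    have "0\<^sub>m m 0 *\<^sub>v w = 0\<^sub>v m" by (intro eq_vecI) (use \<open>w \<in> carrier_vec 0\<close> in \<open>auto simp: scalar_prod_def\<close>)
    then show "0\<^sub>m m 0 *\<^sub>v w \<in> S" using S by (simp add: subspace_of_def)
  qed auto
  define k where "k = (GREATEST k. P k)"
  have Pk: "P k" unfolding k_def using \<open>P 0\<close> bound by (rule GreatestI_nat)
  have nP: "\<not> P (Suc k)"
    using Greatest_le_nat[of P "Suc k" m] bound unfolding k_def by fastforce
  obtain B where B: "B \<in> carrier_mat m k" "adj B * B = 1\<^sub>m k" "\<forall>w \<in> carrier_vec k. B *\<^sub>v w \<in> S"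
    using Pk unfolding P_def by auto
  have "B *\<^sub>v (adj B *\<^sub>v v) = v" if "v \<in> S" for v
    using isometry_extend[OF S B that] nP unfolding P_def by blast
  then show ?thesis using that[OF B(1,2) bound[OF Pk]] B(3) by blast
qed

section \<open>Sums over the group and the Fourier transform\<close>

locale finite_group = group G for G :: "('a, 'b) monoid_scheme" (structure) +
  assumes fin: "finite (carrier G)"
begin

lemma card_pos: "card (carrier G) > 0"
  using fin one_closed by (auto simp: card_gt_0_iff)

lemma sum_translate_left: "h \<in> carrier G \<Longrightarrow> (\<Sum>g\<in>carrier G. f (h \<otimes> g)) = (\<Sum>g\<in>carrier G. f g)"
  by (rule sum.reindex_bij_witness[of _ "\<lambda>g. inv h \<otimes> g" "\<lambda>g. h \<otimes> g"]) (auto simp flip: m_assoc)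

lemma sum_translate_right: "h \<in> carrier G \<Longrightarrow> (\<Sum>g\<in>carrier G. f (g \<otimes> h)) = (\<Sum>g\<in>carrier G. f g)"
  by (rule sum.reindex_bij_witness[of _ "\<lambda>g. g \<otimes> inv h" "\<lambda>g. g \<otimes> h"]) (auto simp: m_assoc)

lemma sum_inverse: "(\<Sum>g\<in>carrier G. f (inv g)) = (\<Sum>g\<in>carrier G. f g)"
  by (rule sum.reindex_bij_witness[of _ "\<lambda>g. inv g" "\<lambda>g. inv g"]) auto

text \<open>A matrix carries its dimensions as part of its value, so there is no single zero to
  start a sum from; hence the explicit shape and the entrywise sum.\<close>

definition msum :: "nat \<Rightarrow> nat \<Rightarrow> ('a \<Rightarrow> complex mat) \<Rightarrow> complex mat" where
  "msum m n F = mat m n (\<lambda>(i,j). \<Sum>g\<in>carrier G. F g $$ (i,j))"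

lemma msum_carrier [simp]: "msum m n F \<in> carrier_mat m n"
  by (simp add: msum_def)

lemma msum_dims [simp]: "dim_row (msum m n F) = m" "dim_col (msum m n F) = n"
  by (simp_all add: msum_def)

lemma msum_index [simp]: "i < m \<Longrightarrow> j < n \<Longrightarrow> msum m n F $$ (i,j) = (\<Sum>g\<in>carrier G. F g $$ (i,j))"
  by (simp add: msum_def)

lemma msum_cong: "(\<And>g. g \<in> carrier G \<Longrightarrow> F g = F' g) \<Longrightarrow> msum m n F = msum m n F'"
  by (auto simp: msum_def intro!: eq_matI sum.cong)

lemma msum_translate_left: "h \<in> carrier G \<Longrightarrow> msum m n (\<lambda>g. F (h \<otimes> g)) = msum m n F"
  unfolding msum_def by (intro cong_mat refl) (auto simp: sum_translate_left[of h "\<lambda>g. F g $$ _"])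

lemma msum_translate_right: "h \<in> carrier G \<Longrightarrow> msum m n (\<lambda>g. F (g \<otimes> h)) = msum m n F"
  unfolding msum_def by (intro cong_mat refl) (auto simp: sum_translate_right[of h "\<lambda>g. F g $$ _"])

lemma msum_inverse: "msum m n (\<lambda>g. F (inv g)) = msum m n F"
  unfolding msum_def by (intro cong_mat refl) (auto simp: sum_inverse[of "\<lambda>g. F g $$ _"])

lemma mult_msum:
  assumes "A \<in> carrier_mat l m" "\<And>g. g \<in> carrier G \<Longrightarrow> F g \<in> carrier_mat m n"
  shows "A * msum m n F = msum l n (\<lambda>g. A * F g)"
proof (rule eq_matI)
  fix i j assume "i < dim_row (msum l n (\<lambda>g. A * F g))" "j < dim_col (msum l n (\<lambda>g. A * F g))"
  then have ij: "i < l" "j < n" by auto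
  have "(A * msum m n F) $$ (i,j) = (\<Sum>k<m. \<Sum>g\<in>carrier G. A $$ (i,k) * F g $$ (k,j))"
    using ij by (simp add: mult_index[OF assms(1) msum_carrier ij] sum_distrib_left del: index_mult_mat)
  also have "\<dots> = (\<Sum>g\<in>carrier G. (A * F g) $$ (i,j))"
    by (subst sum.swap) (auto simp: mult_index[OF assms(1) assms(2) ij] simp del: index_mult_mat(1))
  finally show "(A * msum m n F) $$ (i,j) = msum l n (\<lambda>g. A * F g) $$ (i,j)"
    using ij by simp
qed (use assms in auto)

lemma msum_mult:
  assumes "A \<in> carrier_mat n l" "\<And>g. g \<in> carrier G \<Longrightarrow> F g \<in> carrier_mat m n"
  shows "msum m n F * A = msum m l (\<lambda>g. F g * A)"
proof (rule eq_matI)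
  fix i j assume "i < dim_row (msum m l (\<lambda>g. F g * A))" "j < dim_col (msum m l (\<lambda>g. F g * A))"
  then have ij: "i < m" "j < l" by auto
  have "(msum m n F * A) $$ (i,j) = (\<Sum>k<n. \<Sum>g\<in>carrier G. F g $$ (i,k) * A $$ (k,j))"
    using ij by (simp add: mult_index[OF msum_carrier assms(1) ij] sum_distrib_right del: index_mult_mat)
  also have "\<dots> = (\<Sum>g\<in>carrier G. (F g * A) $$ (i,j))"
    by (subst sum.swap) (auto simp: mult_index[OF assms(2) assms(1) ij] simp del: index_mult_mat(1))
  finally show "(msum m n F * A) $$ (i,j) = msum m l (\<lambda>g. F g * A) $$ (i,j)"
    using ij by simp
qed (use assms in auto)

lemma mtrace_msum:
  assumes "\<And>g. g \<in> carrier G \<Longrightarrow> F g \<in> carrier_mat m m"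
  shows "mtrace (msum m m F) = (\<Sum>g\<in>carrier G. mtrace (F g))"
proof -
  have "mtrace (msum m m F) = (\<Sum>i<m. \<Sum>g\<in>carrier G. F g $$ (i,i))"
    by (simp add: mtrace_def)
  also have "\<dots> = (\<Sum>g\<in>carrier G. mtrace (F g))"
    by (subst sum.swap) (intro sum.cong refl mtrace_carrier[symmetric] assms)
  finally show ?thesis .
qed

lemma adj_msum:
  assumes "\<And>g. g \<in> carrier G \<Longrightarrow> F g \<in> carrier_mat m n"
  shows "adj (msum m n F) = msum n m (\<lambda>g. adj (F g))"
  by (intro eq_matI) (auto intro!: sum.cong simp: adj_index[OF assms] adj_index[OF msum_carrier])

text \<open>The extension of \<open>W\<close> to the group algebra, or the Fourier transform of
  \<open>f\<close> at \<open>W\<close>. Identities between functions on the group become identities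
  between matrices through it.\<close>

definition ft :: "nat \<Rightarrow> ('a \<Rightarrow> complex mat) \<Rightarrow> ('a \<Rightarrow> complex) \<Rightarrow> complex mat" where
  "ft m W f = msum m m (\<lambda>g. f g \<cdot>\<^sub>m W g)"

lemma ft_carrier [simp]: "ft m W f \<in> carrier_mat m m"
  by (simp add: ft_def)

lemma ft_dims [simp]: "dim_row (ft m W f) = m" "dim_col (ft m W f) = m"
  by (simp_all add: ft_def)

lemma ft_cong: "(\<And>g. g \<in> carrier G \<Longrightarrow> f g = f' g) \<Longrightarrow> ft m W f = ft m W f'"
  unfolding ft_def by (intro msum_cong) simp

lemma rep_carrier: "representation G m W \<Longrightarrow> g \<in> carrier G \<Longrightarrow> W g \<in> carrier_mat m m"
  by (simp add: representation_def)

lemma rep_mult: "representation G m W \<Longrightarrow> g \<in> carrier G \<Longrightarrow> h \<in> carrier G \<Longrightarrow> W (g \<otimes> h) = W g * W h"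
  by (simp add: representation_def)

lemma rep_one: "representation G m W \<Longrightarrow> W \<one> = 1\<^sub>m m"
  by (simp add: representation_def)

lemma ft_index:
  assumes "representation G m W" "i < m" "j < m"
  shows "ft m W f $$ (i,j) = (\<Sum>g\<in>carrier G. f g * W g $$ (i,j))"
proof -
  have "W g \<in> carrier_mat m m" if "g \<in> carrier G" for g using assms(1) that by (rule rep_carrier)
  then show ?thesis using assms(2,3) unfolding ft_def by (auto intro!: sum.cong smult_index)
qed

lemma mult_ft:
  assumes "representation G m W" "A \<in> carrier_mat l m"
  shows "A * ft m W f = msum l m (\<lambda>g. f g \<cdot>\<^sub>m (A * W g))"
  unfolding ft_def using assms
  by (subst mult_msum[of _ l]) (auto intro!: msum_cong simp: rep_carrier mult_smult_distrib[of _ l m _ m])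

lemma ft_mult:
  assumes "representation G m W" "A \<in> carrier_mat m l"
  shows "ft m W f * A = msum m l (\<lambda>g. f g \<cdot>\<^sub>m (W g * A))"
  unfolding ft_def using assms
  by (subst msum_mult[of _ _ l]) (auto intro!: msum_cong simp: rep_carrier mult_smult_assoc_mat[of _ m m _ l])

lemma ft_intertwine:
  assumes "representation G m W" "representation G n \<sigma>" "A \<in> carrier_mat m n"
    "\<And>g. g \<in> carrier G \<Longrightarrow> W g * A = A * \<sigma> g"
  shows "ft m W f * A = A * ft n \<sigma> f"
  unfolding ft_mult[OF assms(1,3)] mult_ft[OF assms(2,3)] by (intro msum_cong) (simp add: assms)

text \<open>Convolution becomes matrix multiplication: substitute \<open>x = g \<otimes> h\<close>
  in the double sum. Convolution idempotents thereby become idempotent matrices.\<close>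

lemma ft_conv:
  assumes "representation G m W"
  shows "ft m W f * ft m W f' = ft m W (\<lambda>x. \<Sum>g\<in>carrier G. f g * f' (inv g \<otimes> x))"
proof (rule eq_matI)
  fix i j assume "i < dim_row (ft m W (\<lambda>x. \<Sum>g\<in>carrier G. f g * f' (inv g \<otimes> x)))"
    "j < dim_col (ft m W (\<lambda>x. \<Sum>g\<in>carrier G. f g * f' (inv g \<otimes> x)))"
  then have ij: "i < m" "j < m" by (auto simp: ft_def)
  have *: "(W g * ft m W f') $$ (i,j) = (\<Sum>x\<in>carrier G. f' (inv g \<otimes> x) * W x $$ (i,j))"
    if g: "g \<in> carrier G" for g
  proof -
    have "(W g * ft m W f') $$ (i,j) = (\<Sum>h\<in>carrier G. (f' h \<cdot>\<^sub>m (W g * W h)) $$ (i,j))"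
      using ij by (simp add: mult_ft[OF assms rep_carrier[OF assms g]] del: index_mult_mat)
    also have "\<dots> = (\<Sum>h\<in>carrier G. f' (inv g \<otimes> (g \<otimes> h)) * W (g \<otimes> h) $$ (i,j))"
      using ij g rep_carrier[OF assms]
      by (intro sum.cong refl, subst smult_index[of _ m m]) (auto simp: rep_mult[OF assms] m_assoc[symmetric] simp del: index_mult_mat(1)
          intro: mult_carrier_mat)
    also have "\<dots> = (\<Sum>x\<in>carrier G. f' (inv g \<otimes> x) * W x $$ (i,j))"
      by (rule sum_translate_left[OF g])
    finally show ?thesis .
  qed
  have "(ft m W f * ft m W f') $$ (i,j) = (\<Sum>g\<in>carrier G. f g * (W g * ft m W f') $$ (i,j))"
    using ij mult_carrier_mat[OF rep_carrier[OF assms] ft_carrier[of m W f']]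
    by (simp add: ft_mult[OF assms ft_carrier] smult_index[of _ m m] del: index_mult_mat(1) index_smult_mat)
  also have "\<dots> = (\<Sum>g\<in>carrier G. \<Sum>x\<in>carrier G. f g * f' (inv g \<otimes> x) * W x $$ (i,j))"
    by (intro sum.cong refl) (simp add: * sum_distrib_left mult.assoc)
  also have "\<dots> = ft m W (\<lambda>x. \<Sum>g\<in>carrier G. f g * f' (inv g \<otimes> x)) $$ (i,j)"
    using ij by (subst sum.swap) (simp add: ft_index[OF assms] sum_distrib_right)
  finally show "(ft m W f * ft m W f') $$ (i,j) = ft m W (\<lambda>x. \<Sum>g\<in>carrier G. f g * f' (inv g \<otimes> x)) $$ (i,j)" .
qed (auto simp: ft_def)

lemma unitary_rep_inv:
  assumes "unitary_rep G m W" "g \<in> carrier G"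
  shows "W (inv g) = adj (W g)"
proof -
  have r: "representation G m W" and u: "unitary_mat m (W g)"
    using assms by (auto simp: unitary_rep_def)
  have c: "W g \<in> carrier_mat m m" "W (inv g) \<in> carrier_mat m m" "adj (W g) \<in> carrier_mat m m"
    using rep_carrier[OF r] assms by auto
  have "W (inv g) = W (inv g) * (W g * adj (W g))"
    using unitary_adj_right[OF u] c by simp
  also have "\<dots> = (W (inv g) * W g) * adj (W g)"
    using c by (simp add: assoc_mult_mat[of _ m m _ m _ m])
  also have "W (inv g) * W g = 1\<^sub>m m"
    using rep_mult[OF r, of "inv g" g] assms rep_one[OF r] by simp
  finally show ?thesis using c by simp
qed

text \<open>The involution of the group algebra corresponds to the adjoint, since
  \<open>W (inv g) = adj (W g)\<close> and inversion permutes the group.\<close>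

lemma adj_ft:
  assumes "unitary_rep G m W"
  shows "adj (ft m W f) = ft m W (\<lambda>g. cnj (f (inv g)))"
proof -
  have r: "representation G m W" using assms by (auto simp: unitary_rep_def)
  have "adj (ft m W f) = msum m m (\<lambda>g. adj (f g \<cdot>\<^sub>m W g))"
    unfolding ft_def by (intro adj_msum) (use rep_carrier[OF r] in auto)
  also have "\<dots> = msum m m (\<lambda>g. cnj (f (inv (inv g))) \<cdot>\<^sub>m W (inv g))"
    using rep_carrier[OF r]
    by (intro msum_cong) (auto simp: unitary_rep_inv[OF assms] adj_def intro!: eq_matI)
  also have "\<dots> = ft m W (\<lambda>g. cnj (f (inv g)))"
    unfolding ft_def by (rule msum_inverse[of m m "\<lambda>g. cnj (f (inv g)) \<cdot>\<^sub>m W g"])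
  finally show ?thesis .
qed

subsection \<open>Schur's lemma and orthogonality\<close>

lemma irr_rep: "irreducible_rep G n \<sigma> \<Longrightarrow> representation G n \<sigma>"
  by (simp add: irreducible_rep_def)

lemma irr_pos: "irreducible_rep G n \<sigma> \<Longrightarrow> n > 0"
  by (simp add: irreducible_rep_def)

lemma character_carrier: "g \<in> carrier G \<Longrightarrow> character G \<sigma> g = mtrace (\<sigma> g)"
  by (simp add: character_def)

lemma character_one: "representation G n \<sigma> \<Longrightarrow> character G \<sigma> \<one> = of_nat n"
  by (simp add: character_def rep_one)

lemma character_comm:
  assumes "representation G n \<sigma>" "g \<in> carrier G" "h \<in> carrier G"
  shows "character G \<sigma> (g \<otimes> h) = character G \<sigma> (h \<otimes> g)"
  using assms mtrace_comm[OF rep_carrier rep_carrier, OF assms(1,2,1,3)]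
  by (simp add: character_def rep_mult)

text \<open>The kernel of an intertwiner is an invariant subspace, and it is not everything because
  \<open>T\<close> is nonzero; irreducibility leaves only 0.\<close>

lemma kernel_trivial:
  assumes irr: "irreducible_rep G n \<tau>"
    and T: "T \<in> carrier_mat m n" and T0: "T \<noteq> 0\<^sub>m m n"
    and W: "\<And>g. g \<in> carrier G \<Longrightarrow> W g \<in> carrier_mat m m"
    and inter: "\<And>g. g \<in> carrier G \<Longrightarrow> W g * T = T * \<tau> g"
    and v: "v \<in> carrier_vec n" "T *\<^sub>v v = 0\<^sub>v m"
  shows "v = 0\<^sub>v n"
proof -
  let ?S = "{v \<in> carrier_vec n. T *\<^sub>v v = 0\<^sub>v m}"
  have r: "representation G n \<tau>" using irr by (rule irr_rep)
  have "invariant_subspace G n \<tau> ?S"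
    unfolding invariant_subspace_def
  proof (intro conjI ballI allI)
    fix g v assume g: "g \<in> carrier G" and "v \<in> ?S"
    then have v: "v \<in> carrier_vec n" "T *\<^sub>v v = 0\<^sub>v m" by auto
    have "T *\<^sub>v (\<tau> g *\<^sub>v v) = W g *\<^sub>v (T *\<^sub>v v)"
      using T v W[OF g] rep_carrier[OF r g] inter[OF g]
        assoc_mult_mat_vec[of T m n "\<tau> g" n v] assoc_mult_mat_vec[of "W g" m m T n v] by simp
    then show "\<tau> g *\<^sub>v v \<in> ?S" using v W[OF g] rep_carrier[OF r g] by auto
  qed (use T in \<open>auto simp: mult_add_distrib_mat_vec[of T m n] mult_mat_vec[of T m n]\<close>)
  moreover have "?S \<noteq> carrier_vec n" using T0 mat_eq_zero_iff[OF T] by auto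
  ultimately have "?S = {0\<^sub>v n}" using irr by (auto simp: irreducible_rep_def)
  then show ?thesis using v by auto
qed

lemma character_eq_of_inverse:
  assumes "representation G n \<sigma>" "representation G n' \<tau>"
    and T: "T \<in> carrier_mat n n'" "T' \<in> carrier_mat n' n" "T * T' = 1\<^sub>m n" "T' * T = 1\<^sub>m n'"
    and inter: "\<And>g. g \<in> carrier G \<Longrightarrow> \<sigma> g * T = T * \<tau> g"
  shows "character G \<sigma> = character G \<tau>"
proof
  fix g show "character G \<sigma> g = character G \<tau> g"
  proof (cases "g \<in> carrier G")
    case True
    then have c: "\<sigma> g \<in> carrier_mat n n" "\<tau> g \<in> carrier_mat n' n'"
      using assms rep_carrier by blast+
    have "mtrace (\<sigma> g) = mtrace (\<sigma> g * T * T')"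
      using c T by (simp add: assoc_mult_mat[of _ n n _ n' _ n])
    also have "\<dots> = mtrace (T * (\<tau> g * T'))"
      using c T inter[OF True] by (simp add: assoc_mult_mat[of _ n n' _ n' _ n])
    also have "\<dots> = mtrace (\<tau> g * T' * T)"
      using c T by (intro mtrace_comm) auto
    also have "\<dots> = mtrace (\<tau> g)"
      using c T by (simp add: assoc_mult_mat[of _ n' n' _ n _ n'])
    finally show ?thesis using True by (simp add: character_def)
  qed (simp add: character_def)
qed

text \<open>Kernel and range of \<open>T\<close> are invariant, so \<open>T\<close> is bijective and
  makes the two representations similar. Only the equality of characters is kept, since characters
  are what \<open>irr_chars\<close> collects.\<close>

lemma schur_character:
  assumes irr: "irreducible_rep G n \<sigma>" "irreducible_rep G n' \<tau>"
    and T: "T \<in> carrier_mat n n'" "T \<noteq> 0\<^sub>m n n'"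
    and inter: "\<And>g. g \<in> carrier G \<Longrightarrow> \<sigma> g * T = T * \<tau> g"
  shows "character G \<sigma> = character G \<tau>"
proof -
  have r: "representation G n \<sigma>" "representation G n' \<tau>" using irr by (auto intro: irr_rep)
  note ker = kernel_trivial[OF irr(2) T rep_carrier[OF r(1)] inter]
  let ?S = "(\<lambda>v. T *\<^sub>v v) ` carrier_vec n'"
  have "invariant_subspace G n \<sigma> ?S"
  proof -
    have "\<sigma> g *\<^sub>v (T *\<^sub>v x) \<in> ?S" if "g \<in> carrier G" "x \<in> carrier_vec n'" for g x
      using that T inter[OF that(1)] rep_carrier[OF r(1) that(1)] rep_carrier[OF r(2) that(1)]
        assoc_mult_mat_vec[of T n n' "\<tau> g" n' x] assoc_mult_mat_vec[of "\<sigma> g" n n T n' x]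
      by (intro image_eqI[of _ _ "\<tau> g *\<^sub>v x"]) auto
    then show ?thesis
      using subspace_of_range[OF T(1)] by (auto simp: invariant_subspace_def subspace_of_def)
  qed
  moreover have "?S \<noteq> {0\<^sub>v n}" using T mat_eq_zero_iff[OF T(1)] by blast
  ultimately have S: "?S = carrier_vec n" using irr by (auto simp: irreducible_rep_def)
  then have "\<forall>j. \<exists>x \<in> carrier_vec n'. T *\<^sub>v x = unit_vec n j"
    by (metis (no_types, lifting) image_iff unit_vec_carrier)
  then obtain x where x: "\<And>j. x j \<in> carrier_vec n'" "\<And>j. T *\<^sub>v x j = unit_vec n j" by metis
  \<comment> \<open>The right inverse is assembled column by column from preimages of the unit
    vectors.\<close>
  define T' where "T' = mat n' n (\<lambda>(i,j). x j $ i)"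
  have T'c: "T' \<in> carrier_mat n' n" by (simp add: T'_def)
  have colT': "col T' j = x j" if "j < n" for j
    using that x(1)[of j] by (intro eq_vecI) (auto simp: T'_def)
  have TT': "T * T' = 1\<^sub>m n"
    by (rule mat_col_eqI) (use T T'c x(2) colT' in \<open>auto simp: col_mult2[of _ n n'] simp del: col_mult\<close>)
  \<comment> \<open>Nothing yet says \<open>n = n'\<close>, so the one-sided inverse of a square
    matrix cannot be invoked. Instead \<open>T\<close> annihilates \<open>T' * T - 1\<close> and is
    injective.\<close>
  have T'T: "T' * T = 1\<^sub>m n'"
  proof -
    have "T' * T + (-1) \<cdot>\<^sub>m 1\<^sub>m n' = 0\<^sub>m n' n'"
    proof (subst mat_eq_zero_iff, safe)
      fix v :: "complex vec" assume v: "v \<in> carrier_vec n'"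
      let ?u = "T' *\<^sub>v (T *\<^sub>v v) + (-1) \<cdot>\<^sub>v v"
      have e: "(T' * T + (-1) \<cdot>\<^sub>m 1\<^sub>m n') *\<^sub>v v = ?u"
        using v T T'c by (auto simp: add_mult_distrib_mat_vec[of _ n' n'] assoc_mult_mat_vec[of T' n' n T n' v]
          intro!: eq_vecI)
      have "T *\<^sub>v (T' *\<^sub>v (T *\<^sub>v v)) = T *\<^sub>v v"
        using T T'c TT' v assoc_mult_mat_vec[of T n n' T' n "T *\<^sub>v v"] by simp
      then have "T *\<^sub>v ?u = T *\<^sub>v v + (-1) \<cdot>\<^sub>v (T *\<^sub>v v)"
        using v T T'c by (subst mult_add_distrib_mat_vec[of _ n n']) (auto simp: mult_mat_vec[of T n n'])
      then have "T *\<^sub>v ?u = 0\<^sub>v n" using v T by auto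
      then have "?u = 0\<^sub>v n'"
        using ker[of ?u] v T T'c by auto
      then show "(T' * T + (-1) \<cdot>\<^sub>m 1\<^sub>m n') *\<^sub>v v = 0\<^sub>v n'" using e by simp
    qed (use T T'c in auto)
    then have *: "(T' * T + (-1) \<cdot>\<^sub>m 1\<^sub>m n') $$ (i,j) = 0" if "i < n'" "j < n'" for i j
      using that by simp
    show ?thesis
      using * T T'c by (intro eq_matI) (auto simp del: index_mult_mat(1))
  qed
  show ?thesis
    using character_eq_of_inverse[OF r T(1) T'c TT' T'T inter] .
qed

text \<open>Over the complex numbers \<open>T\<close> has an eigenvector. Its eigenspace is
  invariant and nonzero, hence everything.\<close>

lemma schur_scalar:
  assumes irr: "irreducible_rep G n \<sigma>" and T: "T \<in> carrier_mat n n"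
    and inter: "\<And>g. g \<in> carrier G \<Longrightarrow> \<sigma> g * T = T * \<sigma> g"
  shows "\<exists>c. T = c \<cdot>\<^sub>m 1\<^sub>m n"
proof -
  have r: "representation G n \<sigma>" using irr by (rule irr_rep)
  obtain c v where v: "v \<in> carrier_vec n" "v \<noteq> 0\<^sub>v n" "T *\<^sub>v v = c \<cdot>\<^sub>v v"
    using spectrum_non_empty[OF T irr_pos[OF irr]] T
    by (auto simp: spectrum_def eigenvalue_def eigenvector_def)
  let ?S = "{v \<in> carrier_vec n. T *\<^sub>v v = c \<cdot>\<^sub>v v}"
  have "invariant_subspace G n \<sigma> ?S"
    unfolding invariant_subspace_def
  proof (intro conjI ballI allI)
    fix g v assume g: "g \<in> carrier G" and "v \<in> ?S"
    then have v: "v \<in> carrier_vec n" "T *\<^sub>v v = c \<cdot>\<^sub>v v" by auto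
    have gc: "\<sigma> g \<in> carrier_mat n n" using rep_carrier[OF r g] .
    have "T *\<^sub>v (\<sigma> g *\<^sub>v v) = \<sigma> g *\<^sub>v (T *\<^sub>v v)"
      using T v gc inter[OF g]
        assoc_mult_mat_vec[of T n n "\<sigma> g" n v] assoc_mult_mat_vec[of "\<sigma> g" n n T n v] by simp
    then have "T *\<^sub>v (\<sigma> g *\<^sub>v v) = c \<cdot>\<^sub>v (\<sigma> g *\<^sub>v v)"
      using v gc by (simp add: mult_mat_vec[of _ n n])
    then show "\<sigma> g *\<^sub>v v \<in> ?S" using v gc by auto
  next
    fix a v assume "v \<in> ?S"
    then show "a \<cdot>\<^sub>v v \<in> ?S"
      using T by (auto simp: mult_mat_vec[of T n n] smult_smult_assoc mult.commute)
  qed (use T in \<open>auto simp: mult_add_distrib_mat_vec[of T n n] smult_add_distrib_vec[of _ n]\<close>)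
  moreover have "?S \<noteq> {0\<^sub>v n}" using v by auto
  ultimately have S: "?S = carrier_vec n" using irr by (auto simp: irreducible_rep_def)
  have "T = c \<cdot>\<^sub>m 1\<^sub>m n"
  proof (rule mat_col_eqI)
    fix j assume "j < dim_col (c \<cdot>\<^sub>m 1\<^sub>m n :: complex mat)"
    then have j: "j < n" by simp
    have "unit_vec n j \<in> ?S" unfolding S by simp
    then have "col T j = c \<cdot>\<^sub>v unit_vec n j" using mult_unit_vec[OF T j] by simp
    then show "col T j = col (c \<cdot>\<^sub>m 1\<^sub>m n) j" using j by simp
  qed (use T in auto)
  then show ?thesis by blast
qed

text \<open>Unnormalised averaging over the group: it turns an arbitrary matrix into an intertwiner
  from \<open>V\<close> to \<open>W\<close>, to which Schur's lemma then applies.\<close>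

definition avg :: "nat \<Rightarrow> nat \<Rightarrow> ('a \<Rightarrow> complex mat) \<Rightarrow> ('a \<Rightarrow> complex mat) \<Rightarrow> complex mat \<Rightarrow> complex mat" where
  "avg m n W V C = msum m n (\<lambda>g. W g * C * V (inv g))"

lemma avg_carrier [simp]: "avg m n W V C \<in> carrier_mat m n"
  by (simp add: avg_def)

lemma avg_intertwine:
  assumes W: "representation G m W" and V: "representation G n V" and C: "C \<in> carrier_mat m n"
    and h: "h \<in> carrier G"
  shows "W h * avg m n W V C = avg m n W V C * V h"
proof -
  have c: "W g \<in> carrier_mat m m" "V g \<in> carrier_mat n n" if "g \<in> carrier G" for g
    using rep_carrier W V that by blast+
  have "W h * avg m n W V C = msum m n (\<lambda>g. W h * (W g * C * V (inv g)))"
    unfolding avg_def using c h C by (intro mult_msum[of _ m]) (auto intro: mult3_carrier[of _ m m _ n _ n])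
  \<comment> \<open>Writing \<open>inv g\<close> as \<open>inv (h \<otimes> g) \<otimes> h\<close>
    makes the summand a function of \<open>h \<otimes> g\<close> alone, so that translation
    invariance applies.\<close>
  also have "\<dots> = msum m n (\<lambda>g. W (h \<otimes> g) * C * V (inv (h \<otimes> g) \<otimes> h))"
  proof (rule msum_cong)
    fix g assume g: "g \<in> carrier G"
    have "inv (h \<otimes> g) \<otimes> h = inv g" using g h by (simp add: inv_mult_group m_assoc)
    then show "W h * (W g * C * V (inv g)) = W (h \<otimes> g) * C * V (inv (h \<otimes> g) \<otimes> h)"
      using g h C c[OF g] c[OF h] c[of "inv g"]
      by (simp add: rep_mult[OF W] assoc_mult_mat[of _ m m _ m _ n] assoc_mult_mat[of _ m m _ n _ n])
  qed
  also have "\<dots> = msum m n (\<lambda>g. W g * C * V (inv g \<otimes> h))"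
    by (rule msum_translate_left[OF h, of m n "\<lambda>g. W g * C * V (inv g \<otimes> h)"])
  also have "\<dots> = msum m n (\<lambda>g. W g * C * V (inv g) * V h)"
    using C c h
    by (intro msum_cong)
      (simp add: rep_mult[OF V] assoc_mult_mat[OF mult_carrier_mat[of _ m m C n], of _ "V (inv _)" n "V h" n])
  also have "\<dots> = avg m n W V C * V h"
    unfolding avg_def using c h C by (intro msum_mult[of _ n _ _ m, symmetric]) (auto intro: mult3_carrier[of _ m m _ n _ n])
  finally show ?thesis .
qed

text \<open>Schur gives a scalar matrix. Its scalar is read off from the trace, since each conjugate
  of \<open>C\<close> has the trace of \<open>C\<close> and the identity has trace
  \<open>n\<close>.\<close>

lemma avg_same:
  assumes irr: "irreducible_rep G n \<sigma>" and C: "C \<in> carrier_mat n n"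
  shows "avg n n \<sigma> \<sigma> C = (of_nat (card (carrier G)) * mtrace C / of_nat n) \<cdot>\<^sub>m 1\<^sub>m n"
proof -
  have r: "representation G n \<sigma>" using irr by (rule irr_rep)
  have c: "\<sigma> g \<in> carrier_mat n n" if "g \<in> carrier G" for g
    using rep_carrier r that by blast
  obtain z where z: "avg n n \<sigma> \<sigma> C = z \<cdot>\<^sub>m 1\<^sub>m n"
    using schur_scalar[OF irr avg_carrier avg_intertwine[OF r r C]] by blast
  have "mtrace (avg n n \<sigma> \<sigma> C) = (\<Sum>g\<in>carrier G. mtrace (\<sigma> g * C * \<sigma> (inv g)))"
    unfolding avg_def using c C by (intro mtrace_msum) (auto intro: mult3_carrier)
  also have "\<dots> = (\<Sum>g\<in>carrier G. mtrace C)"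
  proof (rule sum.cong[OF refl])
    fix g assume g: "g \<in> carrier G"
    have "mtrace (\<sigma> g * C * \<sigma> (inv g)) = mtrace (\<sigma> (inv g) * (\<sigma> g * C))"
      using c[OF g] c[of "inv g"] C g by (intro mtrace_comm) auto
    also have "\<sigma> (inv g) * (\<sigma> g * C) = \<sigma> (inv g \<otimes> g) * C"
      using c[OF g] c[of "inv g"] C g by (subst rep_mult[OF r]) (auto simp: assoc_mult_mat[of _ n n _ n _ n])
    finally show "mtrace (\<sigma> g * C * \<sigma> (inv g)) = mtrace C"
      using g C by (simp add: rep_one[OF r])
  qed
  finally have "of_nat (card (carrier G)) * mtrace C = z * of_nat n"
    using z by (simp add: mtrace_smult[of _ n])
  then have "z = of_nat (card (carrier G)) * mtrace C / of_nat n"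
    using irr_pos[OF irr] by simp
  then show ?thesis using z by simp
qed

lemma avg_different:
  assumes "irreducible_rep G n \<sigma>" "irreducible_rep G n' \<tau>" "C \<in> carrier_mat n n'"
    and "character G \<sigma> \<noteq> character G \<tau>"
  shows "avg n n' \<sigma> \<tau> C = 0\<^sub>m n n'"
  using schur_character[OF assms(1,2) avg_carrier _ avg_intertwine[OF irr_rep irr_rep assms(3)]] assms
  by blast

text \<open>Schur orthogonality in matrix form: expand the character into diagonal entries and
  recognise each product of entries of \<tau> and \<sigma> as an entry of an averaged matrix
  unit.\<close>

lemma ft_character:
  assumes \<sigma>: "irreducible_rep G n \<sigma>" and \<tau>: "irreducible_rep G n' \<tau>"
  shows "ft n' \<tau> (\<lambda>g. character G \<sigma> (inv g)) =
    (if character G \<sigma> = character G \<tau> then (of_nat (card (carrier G)) / of_nat n') \<cdot>\<^sub>m 1\<^sub>m n' else 0\<^sub>m n' n')"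
proof -
  \<comment> \<open>The matrix unit at \<open>(l,i)\<close>: sandwiched between
    \<open>\<tau> g\<close> and \<open>\<sigma> (inv g)\<close> it isolates one entry of
    each.\<close>
  define E :: "nat \<Rightarrow> nat \<Rightarrow> nat \<Rightarrow> complex mat" where
    "E n l i = mat n' n (\<lambda>(a,b). if a = l \<and> b = i then 1 else 0)" for n l i
  \<comment> \<open>Stated for an arbitrary irreducible in the second role: \<sigma> enters only
    through its character, so when the characters agree the formula is used with \<tau> in its place
    and \<open>avg_same\<close> applies literally.\<close>
  have entry: "ft n' \<tau> (\<lambda>g. character G \<sigma> (inv g)) $$ (k,l) = (\<Sum>i<n. avg n' n \<tau> \<sigma> (E n l i) $$ (k,i))"
    if kl: "k < n'" "l < n'" and \<sigma>: "irreducible_rep G n \<sigma>" for k l n \<sigma>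
  proof -
    have r: "representation G n \<sigma>" "representation G n' \<tau>" using \<sigma> \<tau> by (auto intro: irr_rep)
    have c: "\<sigma> g \<in> carrier_mat n n" "\<tau> g \<in> carrier_mat n' n'" if "g \<in> carrier G" for g
      using rep_carrier r that by blast+
    have *: "(\<tau> g * E n l i * \<sigma> (inv g)) $$ (k,i) = \<tau> g $$ (k,l) * \<sigma> (inv g) $$ (i,i)"
      if g: "g \<in> carrier G" and i: "i < n" for g i
    proof -
      have cE: "E n l i \<in> carrier_mat n' n" by (simp add: E_def)
      have "(\<tau> g * E n l i) $$ (k,b) = (if b = i then \<tau> g $$ (k,l) else 0)" if "b < n" for b
      proof -
        have "(\<tau> g * E n l i) $$ (k,b) = (\<Sum>a<n'. if a = l then (if b = i then \<tau> g $$ (k,l) else 0) else 0)"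
          unfolding mult_index[OF c(2)[OF g] cE kl(1) that]
          using that by (intro sum.cong refl) (simp add: E_def)
        then show ?thesis using kl by simp
      qed
      then have "(\<tau> g * E n l i * \<sigma> (inv g)) $$ (k,i) =
          (\<Sum>b<n. if b = i then \<tau> g $$ (k,l) * \<sigma> (inv g) $$ (i,i) else 0)"
        using c[OF g] cE c(1)[of "inv g"] g kl i
        by (subst mult_index[of _ n' n _ n]) (auto simp del: index_mult_mat(1) simp: if_distrib[of "\<lambda>x. x * _"] cong: if_cong)
      then show ?thesis using i by simp
    qed
    have "(\<Sum>i<n. avg n' n \<tau> \<sigma> (E n l i) $$ (k,i)) = (\<Sum>i<n. \<Sum>g\<in>carrier G. \<tau> g $$ (k,l) * \<sigma> (inv g) $$ (i,i))"
      using kl * by (simp add: avg_def del: index_mult_mat(1))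
    also have "\<dots> = (\<Sum>g\<in>carrier G. character G \<sigma> (inv g) * \<tau> g $$ (k,l))"
      using c(1) by (subst sum.swap)
        (auto intro!: sum.cong simp: character_def mtrace_carrier[of _ n] sum_distrib_left mult.commute)
    finally show ?thesis using kl by (simp add: ft_index[OF r(2)])
  qed
  show ?thesis
  proof (cases "character G \<sigma> = character G \<tau>")
    case True
    have "ft n' \<tau> (\<lambda>g. character G \<tau> (inv g)) $$ (k,l) =
        ((of_nat (card (carrier G)) / of_nat n') \<cdot>\<^sub>m 1\<^sub>m n') $$ (k,l)" if kl: "k < n'" "l < n'" for k l
    proof -
      have tr: "mtrace (E n' l i) = (if l = i then 1 else 0)" if "i < n'" for i
        using that kl by (auto simp: E_def mtrace_def)
      have "(\<Sum>i<n'. avg n' n' \<tau> \<tau> (E n' l i) $$ (k,i)) =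
          (\<Sum>i<n'. if i = k then (if l = k then of_nat (card (carrier G)) / of_nat n' else 0) else 0)"
        using kl by (intro sum.cong refl) (subst avg_same[OF \<tau>], auto simp: E_def[of n'] tr[unfolded E_def])
      then show ?thesis using kl entry[OF kl \<tau>] by auto
    qed
    then show ?thesis using True by (auto intro!: eq_matI simp: ft_def)
  next
    case False
    have "ft n' \<tau> (\<lambda>g. character G \<sigma> (inv g)) $$ (k,l) = 0" if kl: "k < n'" "l < n'" for k l
      unfolding entry[OF kl \<sigma>]
      using avg_different[OF \<tau> \<sigma>, of "E n l _"] False kl by (intro sum.neutral) (auto simp: E_def)
    then show ?thesis using False by (auto intro!: eq_matI simp: ft_def)
  qed
qed

lemma mtrace_ft_mult:
  assumes "representation G m W" "h \<in> carrier G"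
  shows "mtrace (ft m W f * W h) = (\<Sum>g\<in>carrier G. f g * character G W (g \<otimes> h))"
proof -
  have "mtrace (ft m W f * W h) = (\<Sum>g\<in>carrier G. mtrace (f g \<cdot>\<^sub>m (W g * W h)))"
    unfolding ft_mult[OF assms(1) rep_carrier[OF assms]]
    using rep_carrier[OF assms(1)] assms by (intro mtrace_msum smult_carrier_mat mult_carrier_mat) auto
  also have "\<dots> = (\<Sum>g\<in>carrier G. f g * character G W (g \<otimes> h))"
    using rep_carrier[OF assms(1)] assms
    by (intro sum.cong refl) (simp add: mtrace_smult[OF mult_carrier_mat[of _ m m _ m]] character_def rep_mult[OF assms(1)])
  finally show ?thesis .
qed

text \<open>Multiply \<open>ft_character\<close> by \<open>\<tau> h\<close> and take traces.\<close>

lemma character_conv: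
  assumes \<sigma>: "irreducible_rep G n \<sigma>" and \<tau>: "irreducible_rep G n' \<tau>" and h: "h \<in> carrier G"
  shows "(\<Sum>g\<in>carrier G. character G \<sigma> (inv g) * character G \<tau> (g \<otimes> h)) =
    (if character G \<sigma> = character G \<tau> then of_nat (card (carrier G)) / of_nat n' * character G \<tau> h else 0)"
proof -
  have r: "representation G n' \<tau>" using \<tau> by (rule irr_rep)
  have "(\<Sum>g\<in>carrier G. character G \<sigma> (inv g) * character G \<tau> (g \<otimes> h)) =
      mtrace (ft n' \<tau> (\<lambda>g. character G \<sigma> (inv g)) * \<tau> h)"
    by (rule mtrace_ft_mult[OF r h, symmetric])
  then show ?thesis
    using rep_carrier[OF r h] h
    by (simp add: ft_character[OF \<sigma> \<tau>] mult_smult_assoc_mat[of _ n' n' _ n'] mtrace_smult[of _ n']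
        character_carrier) (simp add: mtrace_def)
qed

text \<open>The conjugates of \<open>\<sigma> h\<close> add up to a scalar matrix by
  \<open>avg_same\<close>; the trace of its product with \<open>\<sigma> k\<close> is then a
  multiple of the character at \<open>k\<close>.\<close>

lemma character_average:
  assumes \<sigma>: "irreducible_rep G n \<sigma>" and h: "h \<in> carrier G" and k: "k \<in> carrier G"
  shows "(\<Sum>x\<in>carrier G. character G \<sigma> (x \<otimes> h \<otimes> inv x \<otimes> k)) =
    of_nat (card (carrier G)) * character G \<sigma> h / of_nat n * character G \<sigma> k"
proof -
  have r: "representation G n \<sigma>" using \<sigma> by (rule irr_rep)
  have c: "\<sigma> g \<in> carrier_mat n n" if "g \<in> carrier G" for g
    using rep_carrier r that by blast
  have "(\<Sum>x\<in>carrier G. character G \<sigma> (x \<otimes> h \<otimes> inv x \<otimes> k)) =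
      (\<Sum>x\<in>carrier G. mtrace (\<sigma> x * \<sigma> h * \<sigma> (inv x) * \<sigma> k))"
    using h k by (intro sum.cong refl) (simp add: character_def rep_mult[OF r])
  also have "\<dots> = mtrace (avg n n \<sigma> \<sigma> (\<sigma> h) * \<sigma> k)"
    unfolding avg_def using c h k
    by (subst msum_mult[of _ n n])
      (auto intro!: mtrace_msum[symmetric] intro: mult3_carrier mult_carrier_mat[OF mult3_carrier])
  finally show ?thesis
    using c[OF k] c[OF h] h k
    by (simp add: avg_same[OF \<sigma> c[OF h]] mult_smult_assoc_mat[of _ n n _ n] mtrace_smult[of _ n] character_def)
qed

section \<open>Irreducible constituents of unitary representations\<close>

text \<open>The restriction of \<open>W\<close> to \<open>S\<close>, written in an orthonormal basis
  \<open>B\<close> of \<open>S\<close>. The two bounds on \<open>k\<close> drive the induction for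
  irreducible constituents: \<open>k < m\<close> lets it descend, \<open>0 < k\<close> keeps it from
  reaching the zero space.\<close>

lemma unitary_subrep:
  assumes W: "unitary_rep G m W" and S: "subspace_of m S"
    and inv: "\<And>g v. g \<in> carrier G \<Longrightarrow> v \<in> S \<Longrightarrow> W g *\<^sub>v v \<in> S"
  shows "\<exists>k B. B \<in> carrier_mat m k \<and> adj B * B = 1\<^sub>m k \<and> (\<forall>w \<in> carrier_vec k. B *\<^sub>v w \<in> S) \<and>
    unitary_rep G k (\<lambda>g. adj B * W g * B) \<and> (\<forall>g \<in> carrier G. W g * B = B * (adj B * W g * B)) \<and>
    (S \<noteq> {0\<^sub>v m} \<longrightarrow> 0 < k) \<and> (S \<noteq> carrier_vec m \<longrightarrow> k < m)"
proof -
  obtain k B where B: "B \<in> carrier_mat m k" and iso: "adj B * B = 1\<^sub>m k" and km: "k \<le> m"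
    and BS: "\<And>w. w \<in> carrier_vec k \<Longrightarrow> B *\<^sub>v w \<in> S" and SB: "\<And>v. v \<in> S \<Longrightarrow> B *\<^sub>v (adj B *\<^sub>v v) = v"
    using subspace_isometry[OF S] by metis
  have r: "representation G m W" and u: "\<And>g. g \<in> carrier G \<Longrightarrow> unitary_mat m (W g)"
    using W by (auto simp: unitary_rep_def)
  note c = rep_carrier[OF r] B adj_carrier[OF B]
  define \<sigma> where "\<sigma> g = adj B * W g * B" for g
  have \<sigma>c: "\<sigma> g \<in> carrier_mat k k" if "g \<in> carrier G" for g
    unfolding \<sigma>_def using c that by (auto intro: mult3_carrier[of _ k m _ m])
  \<comment> \<open>By invariance \<open>W g\<close> keeps the columns of \<open>B\<close> inside
    \<open>S\<close>, where the projection \<open>B * adj B\<close> does nothing.\<close>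
  have inter: "W g * B = B * \<sigma> g" if g: "g \<in> carrier G" for g
  proof (rule mat_eqI_vec)
    fix v :: "complex vec" assume v: "v \<in> carrier_vec k"
    have WB: "(W g * B) *\<^sub>v v = W g *\<^sub>v (B *\<^sub>v v)"
      using c g v by (intro assoc_mult_mat_vec[of _ m m _ k]) auto
    have c3: "adj B * W g \<in> carrier_mat k m" by (rule mult_carrier_mat[OF c(3) c(1)[OF g]])
    have "(B * \<sigma> g) *\<^sub>v v = B *\<^sub>v (\<sigma> g *\<^sub>v v)"
      using \<sigma>c[OF g] B v by (intro assoc_mult_mat_vec[of _ m k _ k]) auto
    also have "\<sigma> g *\<^sub>v v = adj B *\<^sub>v (W g *\<^sub>v (B *\<^sub>v v))"
      unfolding \<sigma>_def using c g v assoc_mult_mat_vec[OF c3 B v]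
        assoc_mult_mat_vec[of "adj B" k m "W g" m "B *\<^sub>v v"] by simp
    also have "B *\<^sub>v \<dots> = W g *\<^sub>v (B *\<^sub>v v)"
      by (intro SB inv BS g v)
    finally show "(W g * B) *\<^sub>v v = (B * \<sigma> g) *\<^sub>v v" using WB by simp
  qed (use mult_carrier_mat[OF c(1)[OF g] B] mult_carrier_mat[OF B \<sigma>c[OF g]] in auto)
  have \<sigma>rep: "representation G k \<sigma>"
    unfolding representation_def
  proof (intro conjI ballI)
    fix g h assume g: "g \<in> carrier G" and h: "h \<in> carrier G"
    have "\<sigma> (g \<otimes> h) = adj B * (W g * (W h * B))"
      unfolding \<sigma>_def rep_mult[OF r g h] using c(1)[OF g] c(1)[OF h] c(2,3)
      by (simp add: assoc_mult_mat[of _ k m _ m _ k] assoc_mult_mat[of _ m m _ m _ k])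
    also have "W h * B = B * \<sigma> h" by (rule inter[OF h])
    also have "W g * (B * \<sigma> h) = B * (\<sigma> g * \<sigma> h)"
      using assoc_mult_mat[OF c(1)[OF g] B \<sigma>c[OF h]] assoc_mult_mat[OF B \<sigma>c[OF g] \<sigma>c[OF h]] inter[OF g] by simp
    also have "adj B * \<dots> = \<sigma> g * \<sigma> h"
      using assoc_mult_mat[OF c(3) B mult_carrier_mat[OF \<sigma>c[OF g] \<sigma>c[OF h]]] iso \<sigma>c[OF g] \<sigma>c[OF h] by simp
    finally show "\<sigma> (g \<otimes> h) = \<sigma> g * \<sigma> h" .
  next
    show "\<sigma> \<one> = 1\<^sub>m k" unfolding \<sigma>_def rep_one[OF r] using c iso by simp
  qed (rule \<sigma>c)
  have \<sigma>adj: "adj (\<sigma> g) = \<sigma> (inv g)" if g: "g \<in> carrier G" for g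
    unfolding \<sigma>_def adj_mult[OF mult_carrier_mat[OF c(3) c(1)[OF g]] B] adj_mult[OF c(3) c(1)[OF g]]
    using assoc_mult_mat[OF c(3) adj_carrier[OF c(1)[OF g]] B] g by (simp add: unitary_rep_inv[OF W])
  have "unitary_mat k (\<sigma> g)" if g: "g \<in> carrier G" for g
    unfolding unitary_mat_def using g \<sigma>c[OF g] rep_mult[OF \<sigma>rep, of "inv g" g] rep_one[OF \<sigma>rep]
    by (simp add: \<sigma>adj)
  then have \<sigma>u: "unitary_rep G k \<sigma>" using \<sigma>rep by (simp add: unitary_rep_def)
  have kpos: "0 < k" if "S \<noteq> {0\<^sub>v m}"
  proof (rule ccontr)
    assume "\<not> 0 < k"
    then have k0: "k = 0" by simp
    have "v = 0\<^sub>v m" if v: "v \<in> S" for v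
    proof -
      have "v \<in> carrier_vec m" using v subspace_ofD(1)[OF S] by blast
      then have a: "adj B *\<^sub>v v \<in> carrier_vec k" by (rule mult_mat_vec_carrier[OF c(3)])
      have "B *\<^sub>v (adj B *\<^sub>v v) = 0\<^sub>v m"
      proof (rule eq_vecI)
        fix i assume "i < dim_vec (0\<^sub>v m :: complex vec)"
        then show "(B *\<^sub>v (adj B *\<^sub>v v)) $ i = 0\<^sub>v m $ i"
          using k0 by (subst mult_vec_index[OF B a]) auto
      qed (use B in auto)
      then show ?thesis using SB[OF v] by simp
    qed
    then have "S = {0\<^sub>v m}" using subspace_ofD(2)[OF S] by blast
    with that show False by contradiction
  qed
  have kless: "k < m" if nS: "S \<noteq> carrier_vec m"
  proof (rule ccontr)
    assume "\<not> k < m"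
    then have "k = m" using km by simp
    then have "B * adj B = 1\<^sub>m m"
      using mat_mult_left_right_inverse[of "adj B" m B] B adj_carrier[OF B] iso by auto
    then have "v \<in> S" if v: "v \<in> carrier_vec m" for v
      using BS[OF mult_mat_vec_carrier[OF c(3) v]] assoc_mult_mat_vec[OF B c(3) v] v by simp
    then show False using nS subspace_ofD(1)[OF S] by blast
  qed
  show ?thesis
    by (intro exI[of _ k] exI[of _ B] conjI ballI impI)
      (assumption | rule B iso BS \<sigma>u[unfolded \<sigma>_def] inter[unfolded \<sigma>_def] kpos kless)+
qed

text \<open>Descent on the dimension: a reducible \<open>W\<close> is replaced by its restriction to
  a proper nonzero invariant subspace, and the isometries are composed. A single constituent
  suffices for all later uses.\<close>

lemma exists_irreducible_subrep:
  "unitary_rep G m W \<Longrightarrow> 0 < m \<Longrightarrow> \<exists>n \<sigma> A. irreducible_rep G n \<sigma> \<and> A \<in> carrier_mat m n \<and>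
     adj A * A = 1\<^sub>m n \<and> (\<forall>g \<in> carrier G. W g * A = A * \<sigma> g)"
proof (induction m arbitrary: W rule: less_induct)
  case (less m)
  have r: "representation G m W" using less.prems by (simp add: unitary_rep_def)
  note c = rep_carrier[OF r]
  show ?case
  proof (cases "irreducible_rep G m W")
    case True
    have "W g * 1\<^sub>m m = 1\<^sub>m m * W g" if "g \<in> carrier G" for g using c[OF that] by simp
    then show ?thesis using True by (intro exI[of _ m] exI[of _ W] exI[of _ "1\<^sub>m m"]) auto
  next
    case False
    then obtain S where S: "invariant_subspace G m W S" "S \<noteq> {0\<^sub>v m}" "S \<noteq> carrier_vec m"
      using r less.prems by (auto simp: irreducible_rep_def)
    have sub: "subspace_of m S" and inv: "\<And>g v. g \<in> carrier G \<Longrightarrow> v \<in> S \<Longrightarrow> W g *\<^sub>v v \<in> S"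
      using S(1) unfolding invariant_subspace_def subspace_of_def by blast+
    obtain k B where
      B: "B \<in> carrier_mat m k" "adj B * B = 1\<^sub>m k" "unitary_rep G k (\<lambda>g. adj B * W g * B)"
         "\<And>g. g \<in> carrier G \<Longrightarrow> W g * B = B * (adj B * W g * B)" "0 < k" "k < m"
      using unitary_subrep[OF less.prems(1) sub inv] S(2,3) by blast
    obtain n \<sigma> A where A: "irreducible_rep G n \<sigma>" "A \<in> carrier_mat k n" "adj A * A = 1\<^sub>m n"
      "\<And>g. g \<in> carrier G \<Longrightarrow> (adj B * W g * B) * A = A * \<sigma> g"
      using less.IH[OF B(6,3,5)] by blast
    have \<sigma>c: "\<sigma> g \<in> carrier_mat n n" if "g \<in> carrier G" for g
      using rep_carrier[OF irr_rep[OF A(1)] that] .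
    note Ba = adj_carrier[OF B(1)] and Aa = adj_carrier[OF A(2)]
    have "adj (B * A) * (B * A) = adj A * (adj B * (B * A))"
      unfolding adj_mult[OF B(1) A(2)] by (rule assoc_mult_mat[OF Aa Ba mult_carrier_mat[OF B(1) A(2)]])
    also have "adj B * (B * A) = A"
      unfolding assoc_mult_mat[OF Ba B(1) A(2), symmetric] B(2) using A(2) by simp
    finally have 1: "adj (B * A) * (B * A) = 1\<^sub>m n" using A(3) by simp
    have 2: "W g * (B * A) = (B * A) * \<sigma> g" if g: "g \<in> carrier G" for g
      using mult3_carrier[OF Ba c[OF g] B(1)] B(4)[OF g] A(4)[OF g]
      by (rule intertwine_mult[OF c[OF g] B(1) _ A(2) \<sigma>c[OF g]])
    show ?thesis
      using A(1) 1 2 mult_carrier_mat[OF B(1) A(2)]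
      by (intro exI[of _ n] exI[of _ \<sigma>] exI[of _ "B * A"]) auto
  qed
qed

text \<open>\<sigma> itself need not be unitary, but \<open>adj A * A\<close> is the inner product
  of \<open>W\<close> pulled back to it. It intertwines \<sigma> with its conjugate dual and is
  invertible because \<open>A\<close> is injective, so the two have equal characters.\<close>

lemma irreducible_char_inv:
  assumes W: "unitary_rep G m W" and irr: "irreducible_rep G n \<sigma>"
    and A: "A \<in> carrier_mat m n" "A \<noteq> 0\<^sub>m m n" "\<And>g. g \<in> carrier G \<Longrightarrow> W g * A = A * \<sigma> g"
    and g: "g \<in> carrier G"
  shows "character G \<sigma> (inv g) = cnj (character G \<sigma> g)"
proof -
  have r: "representation G m W" using W by (simp add: unitary_rep_def)
  have s: "representation G n \<sigma>" using irr by (rule irr_rep)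
  note c = rep_carrier[OF r] and sc = rep_carrier[OF s]
  define H where "H = adj A * A"
  have Ac: "adj A \<in> carrier_mat n m" using A by simp
  have Hc: "H \<in> carrier_mat n n" using A Ac by (auto simp: H_def)
  \<comment> \<open>The conjugate dual of \<sigma>, whose character at \<open>h\<close> is the
    conjugate of that of \<sigma> at \<open>inv h\<close>.\<close>
  define \<tau> where "\<tau> h = adj (\<sigma> (inv h))" for h
  have \<tau>rep: "representation G n \<tau>"
    unfolding representation_def
  proof (intro conjI ballI)
    fix x y assume "x \<in> carrier G" "y \<in> carrier G"
    then show "\<tau> (x \<otimes> y) = \<tau> x * \<tau> y"
      unfolding \<tau>_def using sc by (simp add: inv_mult_group rep_mult[OF s] adj_mult[of _ n n _ n])
  qed (use sc rep_one[OF s] in \<open>auto simp: \<tau>_def\<close>)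
  have inter: "\<tau> h * H = H * \<sigma> h" if h: "h \<in> carrier G" for h
  proof -
    have "\<tau> h * H = adj (A * \<sigma> (inv h)) * A"
      unfolding \<tau>_def H_def using A Ac sc[of "inv h"] h
        assoc_mult_mat[of "adj (\<sigma> (inv h))" n n "adj A" m A n]
      by (simp add: adj_mult[of A m n "\<sigma> (inv h)" n])
    also have "A * \<sigma> (inv h) = adj (W h) * A"
      using A(3)[of "inv h"] h by (simp add: unitary_rep_inv[OF W])
    also have "adj (adj (W h) * A) = adj A * W h"
      using adj_mult[OF adj_carrier[OF c[OF h]] A(1)] by simp
    also have "adj A * W h * A = adj A * (A * \<sigma> h)"
      using assoc_mult_mat[OF Ac c[OF h] A(1)] A(3)[OF h] by simp
    also have "\<dots> = H * \<sigma> h"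
      unfolding H_def using assoc_mult_mat[OF Ac A(1) sc[OF h]] by simp
    finally show ?thesis .
  qed
  have "v = 0\<^sub>v n" if v: "v \<in> carrier_vec n" and Hv: "H *\<^sub>v v = 0\<^sub>v n" for v
  proof -
    have Av: "A *\<^sub>v v \<in> carrier_vec m" using A v by auto
    have "(A *\<^sub>v v) \<bullet>c (A *\<^sub>v v) = v \<bullet>c (adj A *\<^sub>v (A *\<^sub>v v))"
      by (rule cscalar_adj[OF A(1) v Av])
    also have "adj A *\<^sub>v (A *\<^sub>v v) = 0\<^sub>v n"
      using Hv assoc_mult_mat_vec[OF Ac A(1) v] by (simp add: H_def)
    finally have "A *\<^sub>v v = 0\<^sub>v m" using Av v by simp
    then show ?thesis using kernel_trivial[OF irr A(1,2) c A(3) v] by simp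
  qed
  from injective_imp_inverse[OF Hc this] obtain H' where
    "H' \<in> carrier_mat n n" "H * H' = 1\<^sub>m n" "H' * H = 1\<^sub>m n" by metis
  from character_eq_of_inverse[OF \<tau>rep s Hc this inter]
  have "character G \<tau> g = character G \<sigma> g" by simp
  then show ?thesis
    using g sc[of "inv g"] by (auto simp: character_def \<tau>_def mtrace_adj[of _ n] dest: arg_cong[of _ _ cnj])
qed

end

section \<open>Characters and isotypic projections of a fixed unitary representation\<close>

locale unitary_representation = finite_group G for G :: "('a, 'b) monoid_scheme" (structure) +
  fixes m :: nat and W :: "'a \<Rightarrow> complex mat"
  assumes W: "unitary_rep G m W" and m_pos: "0 < m"
begin

abbreviation "I \<equiv> irr_chars G m W"
abbreviation "N \<equiv> card (carrier G)"

text \<open>Read off from the character value at the identity, so that the degree belongs to the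
  function \<chi> and not to a chosen representation affording it.\<close>

definition deg :: "('a \<Rightarrow> complex) \<Rightarrow> nat" where
  "deg \<chi> = nat \<lfloor>Re (\<chi> \<one>)\<rfloor>"

lemma rep: "representation G m W"
  using W by (simp add: unitary_rep_def)

lemma irr_charsE:
  assumes "\<chi> \<in> I"
  obtains \<sigma> A where "irreducible_rep G (deg \<chi>) \<sigma>" "character G \<sigma> = \<chi>" "A \<in> carrier_mat m (deg \<chi>)"
    "A \<noteq> 0\<^sub>m m (deg \<chi>)" "\<And>g. g \<in> carrier G \<Longrightarrow> W g * A = A * \<sigma> g"
proof -
  obtain \<sigma> n where s: "irreducible_rep G n \<sigma>" "appears_in G n \<sigma> m W" "\<chi> = character G \<sigma>"
    using assms by (auto simp: irr_chars_def)
  then have "deg \<chi> = n" by (simp add: deg_def character_one[OF irr_rep])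
  then show ?thesis using s that by (auto simp: appears_in_def)
qed

lemma irr_chars_one: "\<chi> \<in> I \<Longrightarrow> \<chi> \<one> = of_nat (deg \<chi>)"
  using character_one[OF irr_rep] by (metis irr_charsE)

lemma deg_pos: "\<chi> \<in> I \<Longrightarrow> 0 < deg \<chi>"
  using irr_pos by (metis irr_charsE)

lemma irr_chars_inv: "\<chi> \<in> I \<Longrightarrow> g \<in> carrier G \<Longrightarrow> \<chi> (inv g) = cnj (\<chi> g)"
  by (metis irr_charsE irreducible_char_inv[OF W])

lemma irr_chars_comm: "\<chi> \<in> I \<Longrightarrow> g \<in> carrier G \<Longrightarrow> h \<in> carrier G \<Longrightarrow> \<chi> (g \<otimes> h) = \<chi> (h \<otimes> g)"
  by (metis irr_charsE character_comm irr_rep)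

lemma irr_chars_conv:
  assumes "\<chi> \<in> I" "\<chi>' \<in> I" "h \<in> carrier G"
  shows "(\<Sum>g\<in>carrier G. \<chi> (inv g) * \<chi>' (g \<otimes> h)) = (if \<chi> = \<chi>' then of_nat N / of_nat (deg \<chi>) * \<chi> h else 0)"
proof -
  obtain \<sigma> where s: "irreducible_rep G (deg \<chi>) \<sigma>" "character G \<sigma> = \<chi>" using irr_charsE[OF assms(1)] by metis
  obtain \<tau> where t: "irreducible_rep G (deg \<chi>') \<tau>" "character G \<tau> = \<chi>'" using irr_charsE[OF assms(2)] by metis
  show ?thesis using character_conv[OF s(1) t(1) assms(3)] s t by auto
qed

text \<open>The central idempotent of the group algebra that belongs to \<chi>; its image under
  \<open>W\<close> is the projection onto the isotypic component.\<close>

definition eps :: "('a \<Rightarrow> complex) \<Rightarrow> 'a \<Rightarrow> complex" where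
  "eps \<chi> g = of_nat (deg \<chi>) / of_nat N * \<chi> (inv g)"

text \<open>The prefactor of \<open>eps\<close> is the reciprocal of the constant in
  \<open>irr_chars_conv\<close>, which is what makes these functions idempotent; distinct characters
  are orthogonal.\<close>

lemma eps_conv:
  assumes "\<chi> \<in> I" "\<chi>' \<in> I" "x \<in> carrier G"
  shows "(\<Sum>g\<in>carrier G. eps \<chi> g * eps \<chi>' (inv g \<otimes> x)) = (if \<chi> = \<chi>' then eps \<chi> x else 0)"
proof -
  have "(\<Sum>g\<in>carrier G. eps \<chi> g * eps \<chi>' (inv g \<otimes> x)) =
      of_nat (deg \<chi>) / of_nat N * (of_nat (deg \<chi>') / of_nat N) * (\<Sum>g\<in>carrier G. \<chi> (inv g) * \<chi>' (g \<otimes> inv x))"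
    unfolding sum_distrib_left
  proof (rule sum.cong[OF refl])
    fix g assume g: "g \<in> carrier G"
    have "\<chi>' (inv (inv g \<otimes> x)) = \<chi>' (g \<otimes> inv x)"
      using g assms irr_chars_comm[OF assms(2), of "inv x" g] by (simp add: inv_mult_group)
    then show "eps \<chi> g * eps \<chi>' (inv g \<otimes> x) =
        of_nat (deg \<chi>) / of_nat N * (of_nat (deg \<chi>') / of_nat N) * (\<chi> (inv g) * \<chi>' (g \<otimes> inv x))"
      by (simp add: eps_def)
  qed
  then show ?thesis
    using assms deg_pos[OF assms(1)] card_pos by (simp add: irr_chars_conv eps_def)
qed

lemma eps_inv: "\<chi> \<in> I \<Longrightarrow> g \<in> carrier G \<Longrightarrow> eps \<chi> (inv g) = cnj (eps \<chi> g)"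
  by (simp add: eps_def irr_chars_inv)

text \<open>On combinations of the orthogonal idempotents, convolution multiplies coefficients. Unit
  coefficients give the idempotency of \<open>kern\<close>; real weights give the square of the
  frame generator.\<close>

lemma eps_sum_conv:
  assumes "finite J" "J \<subseteq> I" "x \<in> carrier G"
  shows "(\<Sum>g\<in>carrier G. (\<Sum>\<chi>\<in>J. a \<chi> * eps \<chi> g) * (\<Sum>\<chi>\<in>J. b \<chi> * eps \<chi> (inv g \<otimes> x))) =
    (\<Sum>\<chi>\<in>J. a \<chi> * b \<chi> * eps \<chi> x)"
proof -
  have "(\<Sum>g\<in>carrier G. (\<Sum>\<chi>\<in>J. a \<chi> * eps \<chi> g) * (\<Sum>\<chi>\<in>J. b \<chi> * eps \<chi> (inv g \<otimes> x))) =
      (\<Sum>g\<in>carrier G. \<Sum>\<chi>\<in>J. \<Sum>\<chi>'\<in>J. a \<chi> * b \<chi>' * (eps \<chi> g * eps \<chi>' (inv g \<otimes> x)))"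
    unfolding sum_product by (intro sum.cong refl) (simp add: mult_ac)
  also have "\<dots> = (\<Sum>\<chi>\<in>J. \<Sum>\<chi>'\<in>J. a \<chi> * b \<chi>' * (\<Sum>g\<in>carrier G. eps \<chi> g * eps \<chi>' (inv g \<otimes> x)))"
    unfolding sum_distrib_left
    by (subst sum.swap, rule sum.cong[OF refl], subst sum.swap) simp
  also have "\<dots> = (\<Sum>\<chi>\<in>J. \<Sum>\<chi>'\<in>J. if \<chi>' = \<chi> then a \<chi> * b \<chi>' * eps \<chi> x else 0)"
    using assms by (intro sum.cong refl) (auto simp: eps_conv subset_iff)
  also have "\<dots> = (\<Sum>\<chi>\<in>J. a \<chi> * b \<chi> * eps \<chi> x)"
    using assms by (intro sum.cong refl) simp
  finally show ?thesis .
qed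

text \<open>The idempotent \<open>k = (\<Sum>\<chi>\<in>J. eps \<chi>)\<close> satisfies \<open>k 1 = (\<Sum>g. (cmod (k g))\<^sup>2) \<ge> (k 1)\<^sup>2\<close>.\<close>
lemma sum_deg_squares_le:
  assumes J: "finite J" "J \<subseteq> I"
  shows "(\<Sum>\<chi>\<in>J. (deg \<chi>)\<^sup>2) \<le> N"
proof -
  define k where "k g = (\<Sum>\<chi>\<in>J. eps \<chi> g)" for g
  define r where "r = real (\<Sum>\<chi>\<in>J. (deg \<chi>)\<^sup>2) / real N"
  have k1: "k \<one> = complex_of_real r"
    unfolding k_def r_def using J
    by (auto simp: eps_def irr_chars_one subset_iff sum_divide_distrib power2_eq_square intro!: sum.cong)
  have "k (inv g) = cnj (k g)" if "g \<in> carrier G" for g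
    unfolding k_def using J that by (auto simp: eps_inv subset_iff intro!: sum.cong)
  then have "k \<one> = (\<Sum>g\<in>carrier G. k g * cnj (k g))"
    using eps_sum_conv[OF J one_closed, of "\<lambda>_. 1" "\<lambda>_. 1"] by (simp add: k_def)
  also have "\<dots> = complex_of_real (\<Sum>g\<in>carrier G. (cmod (k g))\<^sup>2)"
    unfolding of_real_sum by (intro sum.cong refl) (simp only: complex_norm_square)
  finally have "r = (\<Sum>g\<in>carrier G. (cmod (k g))\<^sup>2)"
    unfolding k1 of_real_eq_iff .
  moreover have "r\<^sup>2 = (cmod (k \<one>))\<^sup>2" by (simp add: k1)
  moreover have "(cmod (k \<one>))\<^sup>2 \<le> (\<Sum>g\<in>carrier G. (cmod (k g))\<^sup>2)"
    using fin by (intro member_le_sum) auto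
  ultimately have "r\<^sup>2 \<le> r" by linarith
  moreover have "r \<ge> 0" by (simp add: r_def del: of_nat_sum)
  ultimately have "r \<le> 1"
    by (metis mult_le_cancel_left_pos mult.right_neutral order_le_less power2_eq_square zero_less_one_class.zero_le_one)
  then show ?thesis
    using card_pos unfolding r_def by (simp add: field_simps del: of_nat_sum)
qed

text \<open>Every degree is at least 1, so \<open>sum_deg_squares_le\<close> bounds the cardinality
  of all finite subsets uniformly. Only after this do sums over \<open>I\<close> carry their
  intended meaning.\<close>

lemma finite_irr_chars: "finite I"
proof -
  have "card J \<le> N" if "finite J" "J \<subseteq> I" for J
  proof -
    have "card J = (\<Sum>\<chi>\<in>J. 1)" by simp
    also have "\<dots> \<le> (\<Sum>\<chi>\<in>J. (deg \<chi>)\<^sup>2)"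
      using that deg_pos by (intro sum_mono) (auto simp: Suc_le_eq subset_iff)
    finally show ?thesis using sum_deg_squares_le[OF that] by simp
  qed
  then show ?thesis using finite_if_finite_subsets_card_bdd[of I N] by blast
qed

definition proj :: "('a \<Rightarrow> complex) \<Rightarrow> complex mat" where
  "proj \<chi> = ft m W (eps \<chi>)"

text \<open>The reproducing kernel of the space spanned by the matrix entries of \<open>W\<close>,
  in the sense of \<open>rep_expand\<close>. Through \<open>eps\<close> the characters are evaluated
  at inverses.\<close>

definition kern :: "'a \<Rightarrow> complex" where
  "kern g = (\<Sum>\<chi>\<in>I. eps \<chi> g)"

text \<open>At \<sigma> the transform of the sum is 1 or 0 by \<open>ft_character\<close>, and the
  intertwiner carries this over to \<open>W\<close>. The case of all of \<open>I\<close> yields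
  \<open>kern_ft\<close>; a singleton shows that an isotypic projection is nonzero.\<close>

lemma sum_eps_ft_intertwiner:
  assumes irr: "irreducible_rep G n \<sigma>" and A: "A \<in> carrier_mat m n" "A \<noteq> 0\<^sub>m m n"
    and inter: "\<And>g. g \<in> carrier G \<Longrightarrow> W g * A = A * \<sigma> g" and J: "finite J" "J \<subseteq> I"
  shows "ft m W (\<lambda>g. \<Sum>\<chi>\<in>J. eps \<chi> g) * A = (if character G \<sigma> \<in> J then 1 else 0) \<cdot>\<^sub>m A"
proof -
  have s: "representation G n \<sigma>" using irr by (rule irr_rep)
  have ft: "ft n \<sigma> (\<lambda>g. \<Sum>\<chi>\<in>J. eps \<chi> g) = (if character G \<sigma> \<in> J then 1 else 0) \<cdot>\<^sub>m 1\<^sub>m n"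
  proof (rule eq_matI)
    fix i j assume "i < dim_row ((if character G \<sigma> \<in> J then 1 else 0) \<cdot>\<^sub>m 1\<^sub>m n :: complex mat)"
      "j < dim_col ((if character G \<sigma> \<in> J then 1 else 0) \<cdot>\<^sub>m 1\<^sub>m n :: complex mat)"
    then have ij: "i < n" "j < n" by auto
    have *: "(\<Sum>g\<in>carrier G. \<chi> (inv g) * \<sigma> g $$ (i,j)) =
        (if \<chi> = character G \<sigma> then of_nat N / of_nat n * (if i = j then 1 else 0) else 0)" if "\<chi> \<in> J" for \<chi>
    proof -
      obtain \<tau> where t: "irreducible_rep G (deg \<chi>) \<tau>" "character G \<tau> = \<chi>"
        using irr_charsE[of \<chi>] \<open>\<chi> \<in> J\<close> J by (metis subsetD)
      show ?thesis
        using ft_index[OF s ij, of "\<lambda>g. \<chi> (inv g)"] ft_character[OF t(1) irr] ij t(2) by auto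
    qed
    have dn: "deg (character G \<sigma>) = n" by (simp add: deg_def character_one[OF s])
    have "ft n \<sigma> (\<lambda>g. \<Sum>\<chi>\<in>J. eps \<chi> g) $$ (i,j) =
        (\<Sum>\<chi>\<in>J. of_nat (deg \<chi>) / of_nat N * (\<Sum>g\<in>carrier G. \<chi> (inv g) * \<sigma> g $$ (i,j)))"
      unfolding ft_index[OF s ij] sum_distrib_right eps_def sum_distrib_left
      by (subst sum.swap) (simp add: mult_ac)
    also have "\<dots> = (\<Sum>\<chi>\<in>J. if \<chi> = character G \<sigma> then (if i = j then 1 else 0) else 0)"
      using irr_pos[OF irr] card_pos dn by (intro sum.cong refl) (simp add: *)
    also have "\<dots> = ((if character G \<sigma> \<in> J then 1 else 0) \<cdot>\<^sub>m 1\<^sub>m n) $$ (i,j)"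
      using ij J by auto
    finally show "ft n \<sigma> (\<lambda>g. \<Sum>\<chi>\<in>J. eps \<chi> g) $$ (i,j) =
      ((if character G \<sigma> \<in> J then 1 else 0) \<cdot>\<^sub>m 1\<^sub>m n) $$ (i,j)" .
  qed (auto simp: ft_def)
  have "ft m W (\<lambda>g. \<Sum>\<chi>\<in>J. eps \<chi> g) * A = A * ft n \<sigma> (\<lambda>g. \<Sum>\<chi>\<in>J. eps \<chi> g)"
    by (rule ft_intertwine[OF rep s A(1) inter])
  then show ?thesis
    unfolding ft using A by (simp add: mult_smult_distrib[of _ m n _ n])
qed

lemma kern_class: "g \<in> carrier G \<Longrightarrow> h \<in> carrier G \<Longrightarrow> kern (g \<otimes> h) = kern (h \<otimes> g)"
  unfolding kern_def eps_def by (intro sum.cong refl) (simp add: inv_mult_group irr_chars_comm)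

lemma mult_kern_ft:
  assumes h: "h \<in> carrier G"
  shows "W h * ft m W kern = msum m m (\<lambda>g. kern (inv h \<otimes> g) \<cdot>\<^sub>m W g)"
proof -
  have "W h * ft m W kern = msum m m (\<lambda>g. kern g \<cdot>\<^sub>m (W h * W g))"
    by (rule mult_ft[OF rep rep_carrier[OF rep h]])
  also have "\<dots> = msum m m (\<lambda>g. kern (inv h \<otimes> (h \<otimes> g)) \<cdot>\<^sub>m W (h \<otimes> g))"
    using h by (intro msum_cong) (simp add: rep_mult[OF rep] flip: m_assoc)
  also have "\<dots> = msum m m (\<lambda>g. kern (inv h \<otimes> g) \<cdot>\<^sub>m W g)"
    by (rule msum_translate_left[OF h])
  finally show ?thesis .
qed

text \<open>\<open>kern\<close> is a class function, hence central in the group algebra. This is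
  what makes the kernel of its transform an invariant subspace.\<close>

lemma kern_ft_comm:
  assumes h: "h \<in> carrier G"
  shows "W h * ft m W kern = ft m W kern * W h"
proof -
  have "W h * ft m W kern = msum m m (\<lambda>g. kern (inv h \<otimes> (g \<otimes> h)) \<cdot>\<^sub>m W (g \<otimes> h))"
    unfolding mult_kern_ft[OF h] by (rule msum_translate_right[OF h, symmetric])
  also have "\<dots> = msum m m (\<lambda>g. kern g \<cdot>\<^sub>m (W g * W h))"
    using h kern_class by (intro msum_cong) (simp add: rep_mult[OF rep] m_assoc kern_class[of "inv h"])
  also have "\<dots> = ft m W kern * W h"
    by (rule ft_mult[OF rep rep_carrier[OF rep h], symmetric])
  finally show ?thesis .
qed

text \<open>If the idempotent \<open>?K\<close> were not the identity, its kernel would be a nonzero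
  invariant subspace. An irreducible constituent of that kernel has its character in
  \<open>I\<close>, so \<open>?K\<close> would have to fix what it annihilates.\<close>

lemma kern_ft: "ft m W kern = 1\<^sub>m m"
proof (rule ccontr)
  let ?K = "ft m W kern"
  let ?S = "{v \<in> carrier_vec m. ?K *\<^sub>v v = 0\<^sub>v m}"
  assume ne: "?K \<noteq> 1\<^sub>m m"
  note c = rep_carrier[OF rep]
  have KK: "?K * ?K = ?K"
    unfolding ft_conv[OF rep] kern_def
    by (rule ft_cong) (use eps_sum_conv[OF finite_irr_chars subset_refl, of _ "\<lambda>_. 1" "\<lambda>_. 1"] in simp)
  have sub: "subspace_of m ?S"
    unfolding subspace_of_def
    by (auto simp: mult_add_distrib_mat_vec[of ?K m m] mult_mat_vec[of ?K m m])
  have inv: "W g *\<^sub>v v \<in> ?S" if "g \<in> carrier G" "v \<in> ?S" for g v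
    using that c[OF that(1)] kern_ft_comm[OF that(1)]
      assoc_mult_mat_vec[of "W g" m m ?K m v] assoc_mult_mat_vec[of ?K m m "W g" m v] by auto
  \<comment> \<open>An idempotent annihilates \<open>?K v - v\<close> for every \<open>v\<close>, so
    a trivial kernel forces \<open>?K\<close> to be the identity.\<close>
  have "?S \<noteq> {0\<^sub>v m}"
  proof
    assume S0: "?S = {0\<^sub>v m}"
    have "?K *\<^sub>v v = 1\<^sub>m m *\<^sub>v v" if v: "v \<in> carrier_vec m" for v
    proof -
      let ?w = "?K *\<^sub>v v"
      have w: "?w \<in> carrier_vec m" using v by (auto intro: mult_mat_vec_carrier[OF ft_carrier])
      have Kw: "?K *\<^sub>v ?w = ?w"
        using assoc_mult_mat_vec[OF ft_carrier ft_carrier v] KK by metis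
      have "?K *\<^sub>v (?w + (-1) \<cdot>\<^sub>v v) = ?w + (-1) \<cdot>\<^sub>v ?w"
        using v w by (simp add: mult_add_distrib_mat_vec[OF ft_carrier] mult_mat_vec[OF ft_carrier] Kw)
      then have "?w + (-1) \<cdot>\<^sub>v v \<in> ?S" using v w add_minus_one_smult[OF w] by simp
      then have z: "?w + (-1) \<cdot>\<^sub>v v = 0\<^sub>v m" using S0 by blast
      have "?w $ i = v $ i" if i: "i < m" for i
      proof -
        have "(?w + (-1) \<cdot>\<^sub>v v) $ i = 0" using z i by simp
        then show ?thesis using i v w by (simp del: index_mult_mat_vec)
      qed
      then have "?w = v" using v w by (intro eq_vecI) (auto simp del: index_mult_mat_vec)
      then show ?thesis using v by simp
    qed
    then have "?K = 1\<^sub>m m" by (intro mat_eqI_vec[of _ m m]) auto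
    then show False using ne by simp
  qed
  then obtain k B where
    B: "B \<in> carrier_mat m k" "adj B * B = 1\<^sub>m k" "\<And>w. w \<in> carrier_vec k \<Longrightarrow> B *\<^sub>v w \<in> ?S"
       "unitary_rep G k (\<lambda>g. adj B * W g * B)"
       "\<And>g. g \<in> carrier G \<Longrightarrow> W g * B = B * (adj B * W g * B)" "0 < k"
    using unitary_subrep[OF W sub inv] by blast
  obtain n \<sigma> A where A: "irreducible_rep G n \<sigma>" "A \<in> carrier_mat k n" "adj A * A = 1\<^sub>m n"
      "\<And>g. g \<in> carrier G \<Longrightarrow> (adj B * W g * B) * A = A * \<sigma> g"
    using exists_irreducible_subrep[OF B(4,6)] by blast
  have \<sigma>c: "\<sigma> g \<in> carrier_mat n n" if "g \<in> carrier G" for g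
    using rep_carrier[OF irr_rep[OF A(1)] that] .
  \<comment> \<open>The embedding of the irreducible \<sigma> into the kernel of \<open>?K\<close>,
    regarded as an intertwiner into \<open>W\<close>; it witnesses that the character of \<sigma>
    lies in \<open>I\<close>.\<close>
  define C where "C = B * A"
  have Cc: "C \<in> carrier_mat m n" using B A by (auto simp: C_def)
  have inter: "W g * C = C * \<sigma> g" if g: "g \<in> carrier G" for g
    unfolding C_def using mult3_carrier[OF adj_carrier[OF B(1)] c[OF g] B(1)] B(5)[OF g] A(4)[OF g]
    by (rule intertwine_mult[OF c[OF g] B(1) _ A(2) \<sigma>c[OF g]])
  have "unit_vec n 0 \<noteq> (0\<^sub>v n :: complex vec)" using irr_pos[OF A(1)] by simp
  then have u: "B *\<^sub>v (A *\<^sub>v unit_vec n 0) \<noteq> 0\<^sub>v m"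
    using isometry_zero_iff[OF B(1,2)] isometry_zero_iff[OF A(2,3)] A(2)
    by (metis mult_mat_vec_carrier unit_vec_carrier)
  then have C0: "C \<noteq> 0\<^sub>m m n"
    using assoc_mult_mat_vec[OF B(1) A(2) unit_vec_carrier] unfolding C_def
    by (metis C_def Cc mat_eq_zero_iff unit_vec_carrier)
  have "character G \<sigma> \<in> I"
    using A(1) Cc C0 inter unfolding irr_chars_def appears_in_def by blast
  then have "?K * C = C"
    using sum_eps_ft_intertwiner[OF A(1) Cc C0 inter finite_irr_chars subset_refl] Cc
    by (auto simp: kern_def[abs_def] intro!: eq_matI)
  moreover have "?K * C = 0\<^sub>m m n"
  proof (subst mat_eq_zero_iff, safe)
    fix v :: "complex vec" assume v: "v \<in> carrier_vec n"
    have "(?K * C) *\<^sub>v v = ?K *\<^sub>v (C *\<^sub>v v)"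
      by (rule assoc_mult_mat_vec[OF ft_carrier Cc v])
    also have "C *\<^sub>v v = B *\<^sub>v (A *\<^sub>v v)"
      unfolding C_def by (rule assoc_mult_mat_vec[OF B(1) A(2) v])
    also have "?K *\<^sub>v \<dots> = 0\<^sub>v m" using B(3)[of "A *\<^sub>v v"] A(2) v by simp
    finally show "(?K * C) *\<^sub>v v = 0\<^sub>v m" .
  qed (use Cc in auto)
  ultimately show False using C0 by simp
qed

definition D :: nat where
  "D = (\<Sum>\<chi>\<in>I. (deg \<chi>)\<^sup>2)"

text \<open>This is \<open>kern_ft\<close> multiplied by \<open>W h\<close>: the linear relations
  between the translates that both the upper bound and the frame identity use.\<close>

lemma rep_expand: "h \<in> carrier G \<Longrightarrow> W h = msum m m (\<lambda>g. kern (inv h \<otimes> g) \<cdot>\<^sub>m W g)"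
  using mult_kern_ft[of h] rep_carrier[OF rep, of h] by (simp add: kern_ft)

lemma kern_inv: "h \<in> carrier G \<Longrightarrow> kern (inv h) = (\<Sum>\<chi>\<in>I. of_nat (deg \<chi>) * \<chi> h) / of_nat N"
  by (simp add: kern_def eps_def sum_divide_distrib)

text \<open>Each character at \<open>inv g \<otimes> h\<close> is the trace of a product of two
  matrices, so its expansion separates the variables at the price of one term per index pair:
  \<open>(deg \<chi>)\<close> squared terms for \<chi>, hence \<open>D\<close> in all.\<close>

lemma kern_factor:
  "\<exists>(J :: (('a \<Rightarrow> complex) \<times> nat \<times> nat) set) c b. finite J \<and> card J = D \<and>
    (\<forall>g \<in> carrier G. \<forall>h \<in> carrier G. kern (inv h \<otimes> g) = (\<Sum>j\<in>J. c j h * b j g))"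
proof -
  have "\<forall>\<chi>\<in>I. \<exists>\<sigma>. irreducible_rep G (deg \<chi>) \<sigma> \<and> character G \<sigma> = \<chi>"
    using irr_charsE by metis
  then obtain s where s: "\<And>\<chi>. \<chi> \<in> I \<Longrightarrow> irreducible_rep G (deg \<chi>) (s \<chi>) \<and> character G (s \<chi>) = \<chi>"
    by metis
  define J where "J = Sigma I (\<lambda>\<chi>. {..<deg \<chi>} \<times> {..<deg \<chi>})"
  define c where "c = (\<lambda>(\<chi>,i,j) h. of_nat (deg \<chi>) / of_nat N * s \<chi> h $$ (j,i))"
  define b where "b = (\<lambda>(\<chi>,i,j) g. s \<chi> (inv g) $$ (i,j))"
  have fin_I: "finite I" by (rule finite_irr_chars)
  have "finite J" unfolding J_def using fin_I by auto
  moreover have "card J = D"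
    unfolding J_def D_def using fin_I by (subst card_SigmaI) (auto simp: power2_eq_square)
  moreover have "kern (inv h \<otimes> g) = (\<Sum>j\<in>J. c j h * b j g)" if g: "g \<in> carrier G" and h: "h \<in> carrier G" for g h
  proof -
    have "eps \<chi> (inv h \<otimes> g) = (\<Sum>(i,j)\<in>{..<deg \<chi>} \<times> {..<deg \<chi>}. c (\<chi>,i,j) h * b (\<chi>,i,j) g)"
      if \<chi>: "\<chi> \<in> I" for \<chi>
    proof -
      have r: "representation G (deg \<chi>) (s \<chi>)" using s[OF \<chi>] irr_rep by blast
      note sc = rep_carrier[OF r]
      have "\<chi> (inv (inv h \<otimes> g)) = mtrace (s \<chi> (inv g) * s \<chi> h)"
        using s[OF \<chi>] g h rep_mult[OF r, of "inv g" h] character_carrier[of "inv g \<otimes> h" "s \<chi>"]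
        by (simp add: inv_mult_group)
      also have "\<dots> = (\<Sum>i<deg \<chi>. \<Sum>j<deg \<chi>. s \<chi> (inv g) $$ (i,j) * s \<chi> h $$ (j,i))"
        using sc[of "inv g"] sc[OF h] g
        by (subst mtrace_carrier[OF mult_carrier_mat[of _ "deg \<chi>" "deg \<chi>"]])
          (auto simp: mult_index[of _ "deg \<chi>" "deg \<chi>" _ "deg \<chi>"] simp del: index_mult_mat(1))
      finally show ?thesis
        by (simp add: eps_def c_def b_def sum_distrib_left mult_ac flip: sum.cartesian_product)
    qed
    then have "kern (inv h \<otimes> g) = (\<Sum>\<chi>\<in>I. \<Sum>p\<in>{..<deg \<chi>} \<times> {..<deg \<chi>}. c (\<chi>,p) h * b (\<chi>,p) g)"
      unfolding kern_def by (intro sum.cong refl) (simp add: split_def)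
    then show ?thesis
      unfolding J_def using fin_I by (subst (asm) sum.Sigma) (auto simp: split_def)
  qed
  ultimately show ?thesis by blast
qed

lemma D_pos: "0 < D"
proof -
  obtain n \<sigma> A where A: "irreducible_rep G n \<sigma>" "A \<in> carrier_mat m n" "adj A * A = 1\<^sub>m n"
    "\<forall>g \<in> carrier G. W g * A = A * \<sigma> g"
    using exists_irreducible_subrep[OF W m_pos] by blast
  have "A \<noteq> 0\<^sub>m m n"
  proof
    assume "A = 0\<^sub>m m n"
    then have "adj A * A = 0\<^sub>m n n" using adj_carrier[OF A(2)] by simp
    then have "(0\<^sub>m n n :: complex mat) $$ (0,0) = 1\<^sub>m n $$ (0,0)" using A(3) by simp
    then show False using irr_pos[OF A(1)] by simp
  qed
  then have "character G \<sigma> \<in> I"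
    using A unfolding irr_chars_def appears_in_def by blast
  then have "(deg (character G \<sigma>))\<^sup>2 \<le> D"
    unfolding D_def using finite_irr_chars by (intro member_le_sum) auto
  then show ?thesis
    using zero_less_power[OF deg_pos[OF \<open>character G \<sigma> \<in> I\<close>], of 2] by linarith
qed

lemma ft_adj_sum_eps:
  "adj (ft m W (\<lambda>g. \<Sum>\<chi>\<in>I. complex_of_real (a \<chi>) * eps \<chi> g)) = ft m W (\<lambda>g. \<Sum>\<chi>\<in>I. complex_of_real (a \<chi>) * eps \<chi> g)"
  unfolding adj_ft[OF W] by (intro ft_cong) (auto simp: eps_inv intro!: sum.cong)

text \<open>The squared Frobenius norm, chosen over the trace because it is visibly real and
  nonnegative; the two agree since \<open>proj \<chi>\<close> is an orthogonal projection.\<close>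

definition proj_trace :: "('a \<Rightarrow> complex) \<Rightarrow> real" where
  "proj_trace \<chi> = (\<Sum>i<m. \<Sum>j<m. (cmod (proj \<chi> $$ (i,j)))\<^sup>2)"

text \<open>\<open>proj \<chi>\<close> is hermitian and idempotent, so its trace is that of its
  product with its adjoint. It is nonzero because it fixes the intertwiner that puts \<chi> into
  \<open>I\<close>.\<close>

lemma mtrace_proj:
  assumes "\<chi> \<in> I"
  shows "mtrace (proj \<chi>) = complex_of_real (proj_trace \<chi>)" and "0 < proj_trace \<chi>"
proof -
  have pc: "proj \<chi> \<in> carrier_mat m m" by (simp add: proj_def)
  have "adj (proj \<chi>) = proj \<chi>"
    unfolding proj_def adj_ft[OF W] by (intro ft_cong) (simp add: eps_inv assms)
  moreover have "proj \<chi> * proj \<chi> = proj \<chi>"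
    unfolding proj_def ft_conv[OF rep] by (rule ft_cong) (simp add: eps_conv assms)
  ultimately have "mtrace (proj \<chi>) = mtrace (proj \<chi> * adj (proj \<chi>))" by simp
  also have "\<dots> = (\<Sum>i<m. \<Sum>j<m. complex_of_real ((cmod (proj \<chi> $$ (i,j)))\<^sup>2))"
    unfolding mtrace_mult_adj[OF pc pc] by (simp only: complex_norm_square)
  finally show "mtrace (proj \<chi>) = complex_of_real (proj_trace \<chi>)" by (simp add: proj_trace_def)
  have "proj \<chi> \<noteq> 0\<^sub>m m m"
  proof
    assume z: "proj \<chi> = 0\<^sub>m m m"
    obtain \<sigma> A where A: "irreducible_rep G (deg \<chi>) \<sigma>" "character G \<sigma> = \<chi>" "A \<in> carrier_mat m (deg \<chi>)"
      "A \<noteq> 0\<^sub>m m (deg \<chi>)" "\<And>g. g \<in> carrier G \<Longrightarrow> W g * A = A * \<sigma> g"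
      using irr_charsE[OF assms] by metis
    have "proj \<chi> * A = 1 \<cdot>\<^sub>m A"
      using sum_eps_ft_intertwiner[OF A(1,3,4,5), of "{\<chi>}"] A(2) assms by (simp add: proj_def)
    moreover have "1 \<cdot>\<^sub>m A = A" by auto
    ultimately show False using z A(3,4) by simp
  qed
  then obtain i j where ij: "i < m" "j < m" "proj \<chi> $$ (i,j) \<noteq> 0"
    using pc by (metis carrier_matD eq_matI index_zero_mat)
  have "0 < (cmod (proj \<chi> $$ (i,j)))\<^sup>2" using ij by simp
  also have "\<dots> \<le> (\<Sum>j<m. (cmod (proj \<chi> $$ (i,j)))\<^sup>2)"
    using ij by (intro member_le_sum) auto
  also have "\<dots> \<le> proj_trace \<chi>"
    unfolding proj_trace_def using ij by (intro member_le_sum[of i _ "\<lambda>i. \<Sum>j<m. (cmod (proj \<chi> $$ (i,j)))\<^sup>2"]) (auto intro: sum_nonneg)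
  finally show "0 < proj_trace \<chi>" .
qed

text \<open>Averaging \<open>h\<close> over its conjugacy class turns it into a scalar on the isotypic component.\<close>
lemma mtrace_proj_mult:
  assumes \<chi>: "\<chi> \<in> I" and h: "h \<in> carrier G"
  shows "mtrace (proj \<chi> * W h) = \<chi> h / of_nat (deg \<chi>) * complex_of_real (proj_trace \<chi>)"
proof -
  let ?w = "character G W"
  obtain \<sigma> where s: "irreducible_rep G (deg \<chi>) \<sigma>" "character G \<sigma> = \<chi>" using irr_charsE[OF \<chi>] by metis
  have avg: "(\<Sum>x\<in>carrier G. \<chi> (x \<otimes> h \<otimes> inv x \<otimes> k)) = of_nat N * \<chi> h / of_nat (deg \<chi>) * \<chi> k"
    if "k \<in> carrier G" for k
    using character_average[OF s(1) h that] s(2) by simp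
  \<comment> \<open>The substitution
    \<open>g = inv x \<otimes> k \<otimes> x \<otimes> inv h\<close> moves the conjugation by
    \<open>x\<close> onto \<open>h\<close>, since both \<chi> and the character of \<open>W\<close>
    are class functions.\<close>
  have conj: "(\<Sum>g\<in>carrier G. eps \<chi> g * ?w (g \<otimes> h)) =
      (\<Sum>k\<in>carrier G. of_nat (deg \<chi>) / of_nat N * \<chi> (x \<otimes> h \<otimes> inv x \<otimes> inv k) * ?w k)" if x: "x \<in> carrier G" for x
  proof -
    have "(\<Sum>g\<in>carrier G. eps \<chi> g * ?w (g \<otimes> h)) =
        (\<Sum>g\<in>carrier G. eps \<chi> (inv x \<otimes> g) * ?w (inv x \<otimes> g \<otimes> h))"
      using sum_translate_left[of "inv x" "\<lambda>g. eps \<chi> g * ?w (g \<otimes> h)"] x by simp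
    also have "\<dots> = (\<Sum>k\<in>carrier G. eps \<chi> (inv x \<otimes> (k \<otimes> x \<otimes> inv h)) * ?w (inv x \<otimes> (k \<otimes> x \<otimes> inv h) \<otimes> h))"
      using sum_translate_right[of "x \<otimes> inv h" "\<lambda>g. eps \<chi> (inv x \<otimes> g) * ?w (inv x \<otimes> g \<otimes> h)"] x h
      by (simp add: m_assoc)
    also have "\<dots> = (\<Sum>k\<in>carrier G. of_nat (deg \<chi>) / of_nat N * \<chi> (x \<otimes> h \<otimes> inv x \<otimes> inv k) * ?w k)"
    proof (rule sum.cong[OF refl])
      fix k assume k: "k \<in> carrier G"
      have "?w (inv x \<otimes> (k \<otimes> x \<otimes> inv h) \<otimes> h) = ?w (inv x \<otimes> (k \<otimes> x))"
        using x h k by (simp add: m_assoc)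
      also have "\<dots> = ?w (k \<otimes> x \<otimes> inv x)"
        using x k by (intro character_comm[OF rep]) auto
      finally have 1: "?w (inv x \<otimes> (k \<otimes> x \<otimes> inv h) \<otimes> h) = ?w k"
        using x k by (simp add: m_assoc)
      have "inv (inv x \<otimes> (k \<otimes> x \<otimes> inv h)) = h \<otimes> inv x \<otimes> inv k \<otimes> x"
        using x h k by (simp add: inv_mult_group m_assoc)
      moreover have "\<chi> (h \<otimes> inv x \<otimes> inv k \<otimes> x) = \<chi> (x \<otimes> (h \<otimes> inv x \<otimes> inv k))"
        using x h k by (intro irr_chars_comm[OF \<chi>]) auto
      ultimately have 2: "\<chi> (inv (inv x \<otimes> (k \<otimes> x \<otimes> inv h))) = \<chi> (x \<otimes> h \<otimes> inv x \<otimes> inv k)"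
        using x h k by (simp add: m_assoc)
      show "eps \<chi> (inv x \<otimes> (k \<otimes> x \<otimes> inv h)) * ?w (inv x \<otimes> (k \<otimes> x \<otimes> inv h) \<otimes> h) =
          of_nat (deg \<chi>) / of_nat N * \<chi> (x \<otimes> h \<otimes> inv x \<otimes> inv k) * ?w k"
        unfolding 1 eps_def 2 ..
    qed
    finally show ?thesis .
  qed
  let ?t = "mtrace (proj \<chi> * W h)"
  have t: "?t = (\<Sum>g\<in>carrier G. eps \<chi> g * ?w (g \<otimes> h))"
    unfolding proj_def by (rule mtrace_ft_mult[OF rep h])
  have t1: "mtrace (proj \<chi>) = (\<Sum>g\<in>carrier G. eps \<chi> g * ?w g)"
  proof -
    have "mtrace (proj \<chi> * W \<one>) = (\<Sum>g\<in>carrier G. eps \<chi> g * ?w (g \<otimes> \<one>))"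
      unfolding proj_def by (rule mtrace_ft_mult[OF rep one_closed])
    then show ?thesis by (simp add: rep_one[OF rep] proj_def cong: sum.cong)
  qed
  \<comment> \<open>By \<open>conj\<close> the trace has the same expression for every
    \<open>x\<close>; adding it up over all \<open>x\<close> costs a factor \<open>N\<close> and
    makes \<open>avg\<close> applicable.\<close>
  have "of_nat N * ?t = (\<Sum>x\<in>carrier G. \<Sum>k\<in>carrier G.
      of_nat (deg \<chi>) / of_nat N * \<chi> (x \<otimes> h \<otimes> inv x \<otimes> inv k) * ?w k)"
    unfolding t using sum.cong[OF refl conj, of "carrier G" "\<lambda>x. x"] by simp
  also have "\<dots> = (\<Sum>k\<in>carrier G. of_nat (deg \<chi>) / of_nat N * (\<Sum>x\<in>carrier G. \<chi> (x \<otimes> h \<otimes> inv x \<otimes> inv k)) * ?w k)"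
    by (subst sum.swap) (simp add: sum_distrib_left sum_distrib_right)
  also have "\<dots> = (\<Sum>k\<in>carrier G. of_nat N * (\<chi> h / of_nat (deg \<chi>)) * (eps \<chi> k * ?w k))"
    by (intro sum.cong refl) (simp add: avg eps_def)
  also have "\<dots> = of_nat N * (\<chi> h / of_nat (deg \<chi>) * mtrace (proj \<chi>))"
    unfolding t1 by (simp add: sum_distrib_left mult_ac)
  finally have "?t = \<chi> h / of_nat (deg \<chi>) * mtrace (proj \<chi>)"
    using card_pos by (simp del: times_divide_eq_left times_divide_eq_right)
  then show ?thesis by (simp add: mtrace_proj(1)[OF \<chi>])
qed

text \<open>Weighting each isotypic projection so that every irreducible character \<open>\<chi>\<close> contributes
  \<open>(deg \<chi>)\<^sup>2 / D\<close> to the norm, independently of its multiplicity.\<close>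
lemma tight_frame:
  obtains X where "X \<in> carrier_mat m m"
    "\<And>a. a \<in> carrier G \<Longrightarrow> mtrace ((W a * X) * adj (W a * X)) = 1"
    "\<And>a i j. a \<in> carrier G \<Longrightarrow> i < m \<Longrightarrow> j < m \<Longrightarrow>
      (\<Sum>b\<in>carrier G. mtrace ((W a * X) * adj (W b * X)) * (W b * X) $$ (i,j)) =
      of_nat N / of_nat D * (W a * X) $$ (i,j)"
proof -
  note c = rep_carrier[OF rep]
  \<comment> \<open>The square root is there because only \<open>X * adj X\<close> enters the Gram
    matrix. The trace of the component in direction \<chi> becomes \<open>(deg \<chi>)\<close>
    squared over \<open>D\<close>, and these add up to 1.\<close>
  define w where "w \<chi> = real (deg \<chi>) / sqrt (real D * proj_trace \<chi>)" for \<chi>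
  define X where "X = ft m W (\<lambda>g. \<Sum>\<chi>\<in>I. complex_of_real (w \<chi>) * eps \<chi> g)"
  have Xc: "X \<in> carrier_mat m m" by (simp add: X_def)
  have "X * adj X = ft m W (\<lambda>g. \<Sum>\<chi>\<in>I. complex_of_real (w \<chi>) * complex_of_real (w \<chi>) * eps \<chi> g)"
    unfolding X_def ft_adj_sum_eps unfolding ft_conv[OF rep]
    by (rule ft_cong) (rule eps_sum_conv[OF finite_irr_chars subset_refl])
  also have "\<dots> = ft m W (\<lambda>g. \<Sum>\<chi>\<in>I. complex_of_real ((real (deg \<chi>))\<^sup>2 / (real D * proj_trace \<chi>)) * eps \<chi> g)"
  proof (intro ft_cong sum.cong refl arg_cong2[of _ _ _ _ "(*)"])
    fix \<chi> assume "\<chi> \<in> I"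
    then have "real D * proj_trace \<chi> \<ge> 0" using mtrace_proj(2)[of \<chi>] by simp
    then have "w \<chi> * w \<chi> = (real (deg \<chi>))\<^sup>2 / (real D * proj_trace \<chi>)"
      unfolding w_def by (simp add: power2_eq_square del: real_sqrt_mult real_sqrt_eq_iff)
    then show "complex_of_real (w \<chi>) * complex_of_real (w \<chi>) = complex_of_real ((real (deg \<chi>))\<^sup>2 / (real D * proj_trace \<chi>))"
      by (simp only: of_real_mult[symmetric])
  qed
  finally have XX: "X * adj X = ft m W (\<lambda>g. \<Sum>\<chi>\<in>I. complex_of_real ((real (deg \<chi>))\<^sup>2 / (real D * proj_trace \<chi>)) * eps \<chi> g)" .
  \<comment> \<open>The factor \<open>proj_trace \<chi>\<close> produced by
    \<open>mtrace_proj_mult\<close> cancels against the weight, so all multiplicities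
    disappear.\<close>
  have tr: "mtrace (X * adj X * W h) = of_nat N / of_nat D * kern (inv h)" if h: "h \<in> carrier G" for h
  proof -
    have "mtrace (X * adj X * W h) =
        (\<Sum>\<chi>\<in>I. complex_of_real ((real (deg \<chi>))\<^sup>2 / (real D * proj_trace \<chi>)) * mtrace (proj \<chi> * W h))"
      unfolding XX mtrace_ft_mult[OF rep h] proj_def sum_distrib_left sum_distrib_right
      by (subst sum.swap) (simp add: mult.assoc)
    also have "\<dots> = (\<Sum>\<chi>\<in>I. of_nat (deg \<chi>) * \<chi> h / of_nat D)"
    proof (rule sum.cong[OF refl])
      fix \<chi> assume \<chi>: "\<chi> \<in> I"
      show "complex_of_real ((real (deg \<chi>))\<^sup>2 / (real D * proj_trace \<chi>)) * mtrace (proj \<chi> * W h) = of_nat (deg \<chi>) * \<chi> h / of_nat D"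
        unfolding mtrace_proj_mult[OF \<chi> h]
        using deg_pos[OF \<chi>] mtrace_proj(2)[OF \<chi>] D_pos by (simp add: power2_eq_square field_simps)
    qed
    finally show ?thesis
      using card_pos by (simp add: kern_inv[OF h] flip: sum_divide_distrib)
  qed
  have gram: "mtrace ((W a * X) * adj (W b * X)) = of_nat N / of_nat D * kern (inv a \<otimes> b)"
    if a: "a \<in> carrier G" and b: "b \<in> carrier G" for a b
  proof -
    have "adj (W b * X) = adj X * W (inv b)"
      using adj_mult[OF c[OF b] Xc] unitary_rep_inv[OF W b] by simp
    then have "mtrace ((W a * X) * adj (W b * X)) = mtrace (W a * (X * (adj X * W (inv b))))"
      using assoc_mult_mat[OF c[OF a] Xc mult_carrier_mat[OF adj_carrier[OF Xc] c[OF inv_closed[OF b]]]] by simp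
    also have "\<dots> = mtrace ((X * (adj X * W (inv b))) * W a)"
      using Xc adj_carrier[OF Xc] c[OF a] c[OF inv_closed[OF b]]
      by (intro mtrace_comm[of _ m m] mult_carrier_mat[of _ m m _ m]) auto
    also have "(X * (adj X * W (inv b))) * W a = (X * adj X) * W (inv b) * W a"
      using assoc_mult_mat[OF Xc adj_carrier[OF Xc] c[OF inv_closed[OF b]]] by simp
    also have "\<dots> = (X * adj X) * W (inv b \<otimes> a)"
      using assoc_mult_mat[OF mult_carrier_mat[OF Xc adj_carrier[OF Xc]] c[OF inv_closed[OF b]] c[OF a]] a b
      by (simp add: rep_mult[OF rep])
    finally show ?thesis using tr[of "inv b \<otimes> a"] a b by (simp add: inv_mult_group)
  qed
  show ?thesis
  proof (rule that[OF Xc])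
    fix a assume a: "a \<in> carrier G"
    have "kern \<one> = of_nat D / of_nat N"
      using kern_inv[OF one_closed] by (simp add: irr_chars_one D_def power2_eq_square)
    then show "mtrace ((W a * X) * adj (W a * X)) = 1"
      using gram[OF a a] a card_pos D_pos by simp
    fix i j assume ij: "i < m" "j < m"
    \<comment> \<open>Given the Gram matrix, the frame identity is \<open>rep_expand\<close>
      multiplied by \<open>X\<close> and scaled by \<open>N / D\<close>.\<close>
    have "(W a * X) $$ (i,j) = (msum m m (\<lambda>g. kern (inv a \<otimes> g) \<cdot>\<^sub>m W g) * X) $$ (i,j)"
      using rep_expand[OF a] by simp
    also have "\<dots> = (\<Sum>g\<in>carrier G. ((kern (inv a \<otimes> g) \<cdot>\<^sub>m W g) * X) $$ (i,j))"
      using ij c Xc by (subst msum_mult[of X m m]) (auto simp del: index_mult_mat(1))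
    also have "\<dots> = (\<Sum>g\<in>carrier G. kern (inv a \<otimes> g) * (W g * X) $$ (i,j))"
    proof (rule sum.cong[OF refl])
      fix g assume g: "g \<in> carrier G"
      show "((kern (inv a \<otimes> g) \<cdot>\<^sub>m W g) * X) $$ (i,j) = kern (inv a \<otimes> g) * (W g * X) $$ (i,j)"
        unfolding mult_smult_assoc_mat[OF c[OF g] Xc]
        by (rule smult_index[OF mult_carrier_mat[OF c[OF g] Xc] ij])
    qed
    finally show "(\<Sum>b\<in>carrier G. mtrace ((W a * X) * adj (W b * X)) * (W b * X) $$ (i,j)) =
      of_nat N / of_nat D * (W a * X) $$ (i,j)"
      using a by (simp add: gram sum_distrib_left mult.assoc del: index_mult_mat(1))
  qed
qed

end

section \<open>Measurements: the span bound and tight frames\<close>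

lemma psd_le_trace:
  assumes F: "F \<in> carrier_mat k k" and psd: "\<And>v. v \<in> carrier_vec k \<Longrightarrow> 0 \<le> Re ((F *\<^sub>v v) \<bullet>c v)"
    and y: "y \<in> carrier_vec k" "y \<bullet>c y = 1"
  shows "Re ((F *\<^sub>v y) \<bullet>c y) \<le> Re (mtrace F)"
proof -
  define v where "v j l = vec k (\<lambda>i. (if i = l then cnj (y $ j) else 0) - (if i = j then cnj (y $ l) else 0))" for j l
  have quad: "(F *\<^sub>v x) \<bullet>c x = (\<Sum>i<k. \<Sum>l<k. F $$ (i,l) * x $ l * cnj (x $ i))" if "x \<in> carrier_vec k" for x
    using cscalar_sum[OF mult_mat_vec_carrier[OF F that] that]
    by (simp add: mult_vec_index[OF F that] sum_distrib_right del: index_mult_mat_vec)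
  have qv: "(F *\<^sub>v v j l) \<bullet>c v j l = y $ j * cnj (y $ j) * F $$ (l,l) + y $ l * cnj (y $ l) * F $$ (j,j)
      - F $$ (j,l) * y $ l * cnj (y $ j) - F $$ (l,j) * y $ j * cnj (y $ l)" if "j < k" "l < k" for j l
  proof -
    have vc: "v j l \<in> carrier_vec k" by (simp add: v_def)
    have inner: "(\<Sum>b<k. F $$ (a,b) * v j l $ b) = F $$ (a,l) * cnj (y $ j) - F $$ (a,j) * cnj (y $ l)" for a
      using that by (simp add: v_def right_diff_distrib sum_subtractf if_distrib[of "(*) _"] cong: if_cong)
    have "(F *\<^sub>v v j l) \<bullet>c v j l = (\<Sum>a<k. (F $$ (a,l) * cnj (y $ j) - F $$ (a,j) * cnj (y $ l)) * cnj (v j l $ a))"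
      unfolding quad[OF vc] inner[symmetric] by (simp add: sum_distrib_right)
    also have "\<dots> = (\<Sum>a<k. (F $$ (a,l) * cnj (y $ j) - F $$ (a,j) * cnj (y $ l)) * (if a = l then y $ j else 0))
        - (\<Sum>a<k. (F $$ (a,l) * cnj (y $ j) - F $$ (a,j) * cnj (y $ l)) * (if a = j then y $ l else 0))"
      unfolding sum_subtractf[symmetric] by (intro sum.cong refl) (simp add: v_def right_diff_distrib if_distrib[of cnj])
    also have "\<dots> = (F $$ (l,l) * cnj (y $ j) - F $$ (l,j) * cnj (y $ l)) * y $ j
        - (F $$ (j,l) * cnj (y $ j) - F $$ (j,j) * cnj (y $ l)) * y $ l"
      using that by (simp add: if_distrib[of "(*) _"] cong: if_cong)
    finally show ?thesis by (simp add: algebra_simps)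
  qed
  have yy: "(\<Sum>j<k. y $ j * cnj (y $ j)) = 1" using cscalar_sum[OF y(1) y(1)] y(2) by simp
  have "(\<Sum>j<k. \<Sum>l<k. (F *\<^sub>v v j l) \<bullet>c v j l) =
      (\<Sum>j<k. \<Sum>l<k. y $ j * cnj (y $ j) * F $$ (l,l)) + (\<Sum>j<k. \<Sum>l<k. y $ l * cnj (y $ l) * F $$ (j,j))
      - (\<Sum>j<k. \<Sum>l<k. F $$ (j,l) * y $ l * cnj (y $ j)) - (\<Sum>j<k. \<Sum>l<k. F $$ (l,j) * y $ j * cnj (y $ l))"
    by (simp add: qv sum.distrib sum_subtractf)
  also have "(\<Sum>j<k. \<Sum>l<k. y $ j * cnj (y $ j) * F $$ (l,l)) = mtrace F"
    unfolding sum_product[symmetric] yy using F by (simp add: mtrace_carrier)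
  also have "(\<Sum>j<k. \<Sum>l<k. y $ l * cnj (y $ l) * F $$ (j,j)) = mtrace F"
    by (subst sum.swap) (simp add: sum_product[symmetric] yy mtrace_carrier[OF F])
  also have "(\<Sum>j<k. \<Sum>l<k. F $$ (l,j) * y $ j * cnj (y $ l)) = (F *\<^sub>v y) \<bullet>c y"
    by (subst sum.swap) (rule quad[OF y(1), symmetric])
  also have "(\<Sum>j<k. \<Sum>l<k. F $$ (j,l) * y $ l * cnj (y $ j)) = (F *\<^sub>v y) \<bullet>c y"
    by (rule quad[OF y(1), symmetric])
  finally have "Re (\<Sum>j<k. \<Sum>l<k. (F *\<^sub>v v j l) \<bullet>c v j l) = 2 * Re (mtrace F) - 2 * Re ((F *\<^sub>v y) \<bullet>c y)"
    by simp
  moreover have "0 \<le> Re (\<Sum>j<k. \<Sum>l<k. (F *\<^sub>v v j l) \<bullet>c v j l)"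
    unfolding Re_sum by (intro sum_nonneg psd) (simp add: v_def)
  ultimately show ?thesis by linarith
qed

text \<open>With \<open>B\<close> an orthonormal basis of the span, each term is the form of the
  compressed operator \<open>F a\<close> at a unit vector, hence at most its trace. As the POVM
  elements sum to the identity, these traces add up to the dimension of the span.\<close>

lemma povm_span_bound:
  fixes \<psi> :: "'a \<Rightarrow> complex vec" and w :: "'j \<Rightarrow> nat \<Rightarrow> complex"
  assumes A: "finite A" and J: "finite J"
    and psd: "\<And>x. x \<in> A \<Longrightarrow> psd_mat M (E x)"
    and sum: "\<And>i j. i < M \<Longrightarrow> j < M \<Longrightarrow> (\<Sum>x\<in>A. E x $$ (i,j)) = 1\<^sub>m M $$ (i,j)"
    and \<psi>: "\<And>a. a \<in> A \<Longrightarrow> \<psi> a \<in> carrier_vec M" "\<And>a. a \<in> A \<Longrightarrow> \<psi> a \<bullet>c \<psi> a = 1"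
    and span: "\<And>a i. a \<in> A \<Longrightarrow> i < M \<Longrightarrow> \<psi> a $ i = (\<Sum>j\<in>J. c j a * w j i)"
  shows "(\<Sum>a\<in>A. Re ((E a *\<^sub>v \<psi> a) \<bullet>c \<psi> a)) \<le> card J"
proof -
  obtain h where h: "bij_betw h {..<card J} J"
    using ex_bij_betw_nat_finite[OF J] by (auto simp: lessThan_atLeast0)
  define Wm where "Wm = mat M (card J) (\<lambda>(i,l). w (h l) i)"
  have Wc: "Wm \<in> carrier_mat M (card J)" by (simp add: Wm_def)
  let ?S = "(\<lambda>v. Wm *\<^sub>v v) ` carrier_vec (card J)"
  obtain k B where B: "B \<in> carrier_mat M k" and iso: "adj B * B = 1\<^sub>m k"
    and BS: "\<And>w. w \<in> carrier_vec k \<Longrightarrow> B *\<^sub>v w \<in> ?S" and SB: "\<And>v. v \<in> ?S \<Longrightarrow> B *\<^sub>v (adj B *\<^sub>v v) = v"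
    using subspace_isometry[OF subspace_of_range[OF Wc]] by metis
  note Ba = adj_carrier[OF B]
  \<comment> \<open>The columns of \<open>B\<close> lie in the range of \<open>Wm\<close>, so
    \<open>B = Wm * C\<close>; then \<open>C\<close> has the left inverse \<open>adj B * Wm\<close>,
    which compares the dimensions.\<close>
  have "k \<le> card J"
  proof -
    have "\<forall>l. \<exists>x \<in> carrier_vec (card J). B *\<^sub>v unit_vec k l = Wm *\<^sub>v x"
      using BS[OF unit_vec_carrier] by blast
    then obtain x where x: "\<And>l. x l \<in> carrier_vec (card J)" "\<And>l. B *\<^sub>v unit_vec k l = Wm *\<^sub>v x l" by metis
    define C where "C = mat (card J) k (\<lambda>(i,l). x l $ i)"
    have Cc: "C \<in> carrier_mat (card J) k" by (simp add: C_def)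
    have "Wm * C = B"
    proof (rule mat_col_eqI)
      fix l assume "l < dim_col B"
      then have l: "l < k" using B by simp
      have "col C l = x l" using l x(1)[of l] by (intro eq_vecI) (auto simp: C_def)
      then show "col (Wm * C) l = col B l"
        using col_mult2[OF Wc Cc l] x(2)[of l] mult_unit_vec[OF B l] by simp
    qed (use Wc Cc B in auto)
    then have "(adj B * Wm) * C = 1\<^sub>m k"
      using assoc_mult_mat[OF Ba Wc Cc] iso by simp
    then show ?thesis
      using left_inverse_dim_le[OF mult_carrier_mat[OF Ba Wc] Cc] by simp
  qed
  define F where "F a = adj B * E a * B" for a
  have Ec: "E a \<in> carrier_mat M M" if "a \<in> A" for a using psd[OF that] by (simp add: psd_mat_def)
  have Fc: "F a \<in> carrier_mat k k" if "a \<in> A" for a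
    unfolding F_def by (rule mult3_carrier[OF Ba Ec[OF that] B])
  have FE: "(F a *\<^sub>v v) \<bullet>c v = (E a *\<^sub>v (B *\<^sub>v v)) \<bullet>c (B *\<^sub>v v)" if a: "a \<in> A" and v: "v \<in> carrier_vec k" for a v
  proof -
    have Bv: "B *\<^sub>v v \<in> carrier_vec M" by (rule mult_mat_vec_carrier[OF B v])
    have "F a *\<^sub>v v = adj B *\<^sub>v (E a *\<^sub>v (B *\<^sub>v v))"
      unfolding F_def using assoc_mult_mat_vec[OF mult_carrier_mat[OF Ba Ec[OF a]] B v]
        assoc_mult_mat_vec[OF Ba Ec[OF a] Bv] by simp
    then show ?thesis
      using cscalar_adj[OF Ba mult_mat_vec_carrier[OF Ec[OF a] Bv] v] by simp
  qed
  have le: "Re ((E a *\<^sub>v \<psi> a) \<bullet>c \<psi> a) \<le> Re (mtrace (F a))" if a: "a \<in> A" for a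
  proof -
    have "\<psi> a = Wm *\<^sub>v vec (card J) (\<lambda>l. c (h l) a)"
    proof (rule eq_vecI)
      fix i assume "i < dim_vec (Wm *\<^sub>v vec (card J) (\<lambda>l. c (h l) a))"
      then have i: "i < M" using Wc by simp
      have "(Wm *\<^sub>v vec (card J) (\<lambda>l. c (h l) a)) $ i = (\<Sum>l<card J. c (h l) a * w (h l) i)"
        using i by (subst mult_vec_index[OF Wc _ i]) (auto simp: Wm_def mult.commute)
      also have "\<dots> = (\<Sum>j\<in>J. c j a * w j i)" by (rule sum.reindex_bij_betw[OF h])
      finally show "\<psi> a $ i = (Wm *\<^sub>v vec (card J) (\<lambda>l. c (h l) a)) $ i" using span[OF a i] by simp
    qed (use Wc \<psi>(1)[OF a] in auto)
    then have "\<psi> a \<in> ?S" by auto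
    then have By: "B *\<^sub>v (adj B *\<^sub>v \<psi> a) = \<psi> a" by (rule SB)
    have yc: "adj B *\<^sub>v \<psi> a \<in> carrier_vec k" by (rule mult_mat_vec_carrier[OF Ba \<psi>(1)[OF a]])
    have "Re ((F a *\<^sub>v (adj B *\<^sub>v \<psi> a)) \<bullet>c (adj B *\<^sub>v \<psi> a)) \<le> Re (mtrace (F a))"
    proof (rule psd_le_trace[OF Fc[OF a] _ yc])
      show "0 \<le> Re ((F a *\<^sub>v v) \<bullet>c v)" if "v \<in> carrier_vec k" for v
        unfolding FE[OF a that] using psd[OF a] mult_mat_vec_carrier[OF B that] by (simp add: psd_mat_def)
      show "(adj B *\<^sub>v \<psi> a) \<bullet>c (adj B *\<^sub>v \<psi> a) = 1"
        using isometry_cscalar[OF B iso yc] By \<psi>(2)[OF a] by simp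
    qed
    then show ?thesis unfolding FE[OF a yc] By .
  qed
  have "(\<Sum>a\<in>A. mtrace (F a)) = of_nat k"
  proof -
    \<comment> \<open>The orthogonal projection onto the span. Cyclicity of the trace lets the
      entrywise sum of the POVM elements act on it.\<close>
    let ?Q = "B * adj B"
    have Qc: "?Q \<in> carrier_mat M M" by (rule mult_carrier_mat[OF B Ba])
    have "mtrace (F a) = (\<Sum>i<M. \<Sum>j<M. E a $$ (i,j) * ?Q $$ (j,i))" if a: "a \<in> A" for a
    proof -
      have "mtrace (F a) = mtrace (adj B * (E a * B))"
        unfolding F_def using assoc_mult_mat[OF Ba Ec[OF a] B] by simp
      also have "\<dots> = mtrace (E a * B * adj B)"
        by (rule mtrace_comm[OF Ba mult_carrier_mat[OF Ec[OF a] B]])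
      also have "\<dots> = mtrace (E a * ?Q)"
        using assoc_mult_mat[OF Ec[OF a] B Ba] by simp
      finally show ?thesis
        unfolding mtrace_carrier[OF mult_carrier_mat[OF Ec[OF a] Qc]]
        by (simp add: mult_index[OF Ec[OF a] Qc] del: index_mult_mat(1))
    qed
    then have "(\<Sum>a\<in>A. mtrace (F a)) = (\<Sum>a\<in>A. \<Sum>i<M. \<Sum>j<M. E a $$ (i,j) * ?Q $$ (j,i))" by simp
    also have "\<dots> = (\<Sum>i<M. \<Sum>j<M. (\<Sum>a\<in>A. E a $$ (i,j)) * ?Q $$ (j,i))"
      unfolding sum_distrib_right by (subst sum.swap, rule sum.cong[OF refl], rule sum.swap)
    also have "\<dots> = (\<Sum>i<M. \<Sum>j<M. if j = i then ?Q $$ (j,i) else 0)"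
      by (intro sum.cong refl) (auto simp: sum simp del: index_mult_mat(1))
    also have "\<dots> = mtrace ?Q" using mtrace_carrier[OF Qc] by simp
    also have "\<dots> = of_nat k" unfolding mtrace_comm[OF B Ba] iso by simp
    finally show ?thesis .
  qed
  then have "(\<Sum>a\<in>A. Re (mtrace (F a))) = k" by (simp flip: Re_sum)
  then have "(\<Sum>a\<in>A. Re ((E a *\<^sub>v \<psi> a) \<bullet>c \<psi> a)) \<le> k"
    using sum_mono[of A "\<lambda>a. Re ((E a *\<^sub>v \<psi> a) \<bullet>c \<psi> a)" "\<lambda>a. Re (mtrace (F a))"] le by simp
  then show ?thesis using \<open>k \<le> card J\<close> by simp
qed

text \<open>For a tight frame the frame operator divided by \<open>c\<close> is a projection, so spreading its
  complement evenly over all outcomes completes the rescaled rank-one operators to a POVM.\<close>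
lemma tight_frame_povm:
  fixes v :: "'a \<Rightarrow> complex vec" and c :: real
  assumes A: "finite A" "A \<noteq> {}" and c: "0 < c"
    and v: "\<And>a. a \<in> A \<Longrightarrow> v a \<in> carrier_vec M" "\<And>a. a \<in> A \<Longrightarrow> v a \<bullet>c v a = 1"
    and frame: "\<And>a i. a \<in> A \<Longrightarrow> i < M \<Longrightarrow> (\<Sum>b\<in>A. (v a \<bullet>c v b) * v b $ i) = c * v a $ i"
  obtains E where "\<And>x. x \<in> A \<Longrightarrow> psd_mat M (E x)"
    "\<And>i j. i < M \<Longrightarrow> j < M \<Longrightarrow> (\<Sum>x\<in>A. E x $$ (i,j)) = 1\<^sub>m M $$ (i,j)"
    "\<And>a. a \<in> A \<Longrightarrow> (E a *\<^sub>v v a) \<bullet>c v a = 1 / c"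
proof -
  define E where "E a = mat M M (\<lambda>(i,j). v a $ i * cnj (v a $ j) / c +
    ((if i = j then 1 else 0) - (\<Sum>b\<in>A. v b $ i * cnj (v b $ j)) / c) / of_nat (card A))" for a
  have Ec: "E a \<in> carrier_mat M M" for a by (simp add: E_def)
  have Ev: "(E a *\<^sub>v x) $ i = (x \<bullet>c v a) * v a $ i / c + (x $ i - (\<Sum>b\<in>A. (x \<bullet>c v b) * v b $ i) / c) / of_nat (card A)"
    if a: "a \<in> A" and x: "x \<in> carrier_vec M" and i: "i < M" for a x i
  proof -
    have 1: "(\<Sum>j<M. v b $ i * cnj (v b $ j) * x $ j) = (x \<bullet>c v b) * v b $ i" if "b \<in> A" for b
      unfolding cscalar_sum[OF x v(1)[OF that]] by (simp add: sum_distrib_left sum_distrib_right mult_ac)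
    have 2: "(\<Sum>j<M. (\<Sum>b\<in>A. v b $ i * cnj (v b $ j)) * x $ j) = (\<Sum>b\<in>A. (x \<bullet>c v b) * v b $ i)"
      unfolding sum_distrib_right by (subst sum.swap) (simp add: 1)
    have "(E a *\<^sub>v x) $ i = (\<Sum>j<M. v a $ i * cnj (v a $ j) * x $ j / c +
        ((if j = i then x $ j else 0) - (\<Sum>b\<in>A. v b $ i * cnj (v b $ j)) * x $ j / c) / of_nat (card A))"
      unfolding mult_vec_index[OF Ec x i]
      using i by (intro sum.cong refl) (simp add: E_def distrib_right diff_divide_distrib left_diff_distrib)
    also have "\<dots> = (\<Sum>j<M. v a $ i * cnj (v a $ j) * x $ j) / c +
        ((\<Sum>j<M. if j = i then x $ j else 0) - (\<Sum>j<M. (\<Sum>b\<in>A. v b $ i * cnj (v b $ j)) * x $ j) / c) / of_nat (card A)"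
      by (simp only: sum.distrib sum_subtractf sum_divide_distrib[symmetric])
    finally show ?thesis using i by (simp add: 1[OF a] 2)
  qed
  have vv: "cnj (x \<bullet>c y) = y \<bullet>c x" if "x \<in> carrier_vec M" "y \<in> carrier_vec M" for x y :: "complex vec"
    unfolding cscalar_sum[OF that] cscalar_sum[OF that(2,1)] by (simp add: mult.commute)
  have quad: "\<exists>r\<ge>0. (E a *\<^sub>v x) \<bullet>c x = complex_of_real r" if a: "a \<in> A" and x: "x \<in> carrier_vec M" for a x
  proof -
    \<comment> \<open>The frame operator applied to \<open>x\<close>. Both its inner product with
      \<open>x\<close> and its squared norm reduce to \<open>s\<close>, the latter with a factor
      \<open>c\<close> from the frame identity.\<close>
    define T where "T = vec M (\<lambda>i. \<Sum>b\<in>A. (x \<bullet>c v b) * v b $ i)"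
    have Tc: "T \<in> carrier_vec M" by (simp add: T_def)
    have Ty: "T \<bullet>c y = (\<Sum>b\<in>A. (x \<bullet>c v b) * (v b \<bullet>c y))" if y: "y \<in> carrier_vec M" for y
    proof -
      have "T \<bullet>c y = (\<Sum>i<M. \<Sum>b\<in>A. (x \<bullet>c v b) * v b $ i * cnj (y $ i))"
        unfolding cscalar_sum[OF Tc y] by (intro sum.cong refl) (simp add: T_def sum_distrib_right)
      also have "\<dots> = (\<Sum>b\<in>A. (x \<bullet>c v b) * (v b \<bullet>c y))"
        by (subst sum.swap) (auto simp: cscalar_sum[OF v(1) y] sum_distrib_left mult.assoc intro!: sum.cong)
      finally show ?thesis .
    qed
    define s where "s = (\<Sum>b\<in>A. (cmod (x \<bullet>c v b))\<^sup>2)"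
    have Tx: "T \<bullet>c x = complex_of_real s"
      unfolding Ty[OF x] s_def of_real_sum
      by (intro sum.cong refl) (simp only: complex_norm_square vv[OF x v(1)])
    have xT: "x \<bullet>c T = complex_of_real s"
      using vv[OF Tc x] Tx by simp
    have Tv: "T \<bullet>c v b = c * (x \<bullet>c v b)" if b: "b \<in> A" for b
    proof -
      have "T \<bullet>c v b = (\<Sum>b'\<in>A. cnj (v b \<bullet>c v b') * (x \<bullet>c v b'))"
        unfolding Ty[OF v(1)[OF b]] by (intro sum.cong refl) (simp add: vv v b)
      also have "\<dots> = (\<Sum>b'\<in>A. \<Sum>i<M. x $ i * cnj ((v b \<bullet>c v b') * v b' $ i))"
        by (intro sum.cong refl) (simp add: cscalar_sum[OF x v(1)] sum_distrib_left mult_ac)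
      also have "\<dots> = (\<Sum>i<M. x $ i * cnj (\<Sum>b'\<in>A. (v b \<bullet>c v b') * v b' $ i))"
        by (subst sum.swap) (simp add: sum_distrib_left)
      also have "\<dots> = (\<Sum>i<M. x $ i * cnj (c * v b $ i))"
        by (intro sum.cong refl) (simp only: frame[OF b] lessThan_iff)
      also have "\<dots> = c * (x \<bullet>c v b)"
        unfolding cscalar_sum[OF x v(1)[OF b]] by (simp add: sum_distrib_left mult_ac)
      finally show ?thesis .
    qed
    have TT: "T \<bullet>c T = c * s"
    proof -
      have "T \<bullet>c T = (\<Sum>b\<in>A. (x \<bullet>c v b) * cnj (T \<bullet>c v b))"
        unfolding Ty[OF Tc] by (intro sum.cong refl) (simp add: vv Tc v)
      also have "\<dots> = c * (\<Sum>b\<in>A. (x \<bullet>c v b) * cnj (x \<bullet>c v b))"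
        by (simp add: Tv sum_distrib_left mult_ac)
      also have "(\<Sum>b\<in>A. (x \<bullet>c v b) * cnj (x \<bullet>c v b)) = complex_of_real s"
        unfolding s_def of_real_sum by (simp only: complex_norm_square)
      finally show ?thesis by simp
    qed
    \<comment> \<open>The complement of the frame operator over \<open>c\<close> is a projection, so
      its quadratic form at \<open>x\<close> is the squared norm of \<open>x - T / c\<close>; this
      is where positivity comes from.\<close>
    define z where "z = (\<Sum>i<M. (cmod (x $ i - T $ i / c))\<^sup>2)"
    have "complex_of_real z = (\<Sum>i<M. (x $ i - T $ i / c) * cnj (x $ i - T $ i / c))"
      unfolding z_def of_real_sum by (simp only: complex_norm_square)
    also have "\<dots> = (\<Sum>i<M. x $ i * cnj (x $ i)) - (\<Sum>i<M. T $ i * cnj (x $ i)) / c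
        - (\<Sum>i<M. x $ i * cnj (T $ i)) / c + (\<Sum>i<M. T $ i * cnj (T $ i)) / (c * c)"
      unfolding sum_divide_distrib sum_subtractf[symmetric] sum.distrib[symmetric]
      by (intro sum.cong refl) (simp add: algebra_simps)
    also have "\<dots> = x \<bullet>c x - s / c"
      using Tx xT TT c by (simp add: cscalar_sum[OF x x] cscalar_sum[OF Tc x] cscalar_sum[OF x Tc] cscalar_sum[OF Tc Tc])
    finally have z: "x \<bullet>c x - s / c = complex_of_real z" ..
    have "(E a *\<^sub>v x) \<bullet>c x = (\<Sum>i<M. ((x \<bullet>c v a) * v a $ i / c + (x $ i - T $ i / c) / of_nat (card A)) * cnj (x $ i))"
      unfolding cscalar_sum[OF mult_mat_vec_carrier[OF Ec x] x]
      by (intro sum.cong refl) (simp add: Ev[OF a x] T_def del: index_mult_mat_vec)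
    also have "\<dots> = (\<Sum>i<M. (x \<bullet>c v a) / c * (v a $ i * cnj (x $ i)) +
        (x $ i * cnj (x $ i) - T $ i * cnj (x $ i) / c) / of_nat (card A))"
      by (intro sum.cong refl) (simp add: distrib_right left_diff_distrib diff_divide_distrib)
    also have "\<dots> = (x \<bullet>c v a) / c * (v a \<bullet>c x) + (x \<bullet>c x - (T \<bullet>c x) / c) / of_nat (card A)"
      unfolding cscalar_sum[OF v(1)[OF a] x] cscalar_sum[OF x x] cscalar_sum[OF Tc x]
      by (simp only: sum.distrib sum_subtractf sum_divide_distrib[symmetric] sum_distrib_left[symmetric])
    also have "\<dots> = complex_of_real ((cmod (x \<bullet>c v a))\<^sup>2 / c + z / card A)"
      unfolding Tx vv[OF x v(1)[OF a], symmetric] of_real_add of_real_divide complex_norm_square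
        z[unfolded of_real_divide] by simp
    finally have "(E a *\<^sub>v x) \<bullet>c x = complex_of_real ((cmod (x \<bullet>c v a))\<^sup>2 / c + z / card A)" .
    moreover have "0 \<le> (cmod (x \<bullet>c v a))\<^sup>2 / c + z / card A"
      using c by (simp add: z_def sum_nonneg)
    ultimately show ?thesis by blast
  qed
  show ?thesis
  proof (rule that[of E])
    fix x assume x: "x \<in> A"
    have "adj (E x) = E x"
      by (rule eq_matI) (auto simp: E_def adj_def mult.commute)
    then show "psd_mat M (E x)"
      unfolding psd_mat_def using Ec quad[OF x] by (metis Im_complex_of_real Re_complex_of_real)
  next
    fix i j assume ij: "i < M" "j < M"
    have "(\<Sum>x\<in>A. E x $$ (i,j)) = (\<Sum>x\<in>A. v x $ i * cnj (v x $ j)) / c +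
        of_nat (card A) * (((if i = j then 1 else 0) - (\<Sum>b\<in>A. v b $ i * cnj (v b $ j)) / c) / of_nat (card A))"
      using ij by (simp add: E_def sum.distrib sum_divide_distrib)
    then show "(\<Sum>x\<in>A. E x $$ (i,j)) = 1\<^sub>m M $$ (i,j)" using ij A by simp
  next
    fix a assume a: "a \<in> A"
    \<comment> \<open>By the frame identity the complement annihilates \<open>v a\<close>, leaving
      only the rank-one part.\<close>
    have "(E a *\<^sub>v v a) \<bullet>c v a = (\<Sum>i<M. v a $ i / c * cnj (v a $ i))"
      unfolding cscalar_sum[OF mult_mat_vec_carrier[OF Ec v(1)[OF a]] v(1)[OF a]]
      using c by (intro sum.cong refl) (simp add: Ev[OF a v(1)[OF a]] frame[OF a] v(2)[OF a] del: index_mult_mat_vec)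
    also have "\<dots> = (v a \<bullet>c v a) / c"
      unfolding cscalar_sum[OF v(1)[OF a] v(1)[OF a]] by (simp add: sum_divide_distrib)
    finally show "(E a *\<^sub>v v a) \<bullet>c v a = 1 / c" by (simp add: v(2)[OF a])
  qed
qed

section \<open>Kronecker products and tensor powers\<close>

lemma div_mod_less:
  fixes i :: nat
  assumes "i < a * b"
  shows "i div b < a" "i mod b < b"
  using assms by (cases "b = 0"; simp add: less_mult_imp_div_less)+

lemma mult_add_less:
  fixes i :: nat
  assumes "i < a" "j < b"
  shows "i * b + j < a * b"
proof -
  have "i * b + j < Suc i * b" using assms by simp
  also have "\<dots> \<le> a * b" using assms by (intro mult_le_mono1) simp
  finally show ?thesis .
qed

lemma sum_div_mod:
  fixes f :: "nat \<Rightarrow> nat \<Rightarrow> 'b::comm_monoid_add"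
  shows "(\<Sum>k<a * b. f (k div b) (k mod b)) = (\<Sum>i<a. \<Sum>j<b. f i j)"
proof -
  have "(\<Sum>k<a * b. f (k div b) (k mod b)) = (\<Sum>(i,j)\<in>{..<a} \<times> {..<b}. f i j)"
  proof (rule sum.reindex_bij_witness[of _ "\<lambda>(i,j). i * b + j" "\<lambda>k. (k div b, k mod b)"])
    fix k assume "k \<in> {..<a * b}"
    then have "k < a * b" "0 < b" by (auto intro: Nat.gr0I)
    then show "(k div b, k mod b) \<in> {..<a} \<times> {..<b}" by (auto simp: less_mult_imp_div_less)
  next
    fix p assume "p \<in> {..<a} \<times> {..<b}"
    then obtain i j where p: "p = (i,j)" "i < a" "j < b" by auto
    then show "(case p of (i,j) \<Rightarrow> i * b + j) \<in> {..<a * b}" by (simp add: mult_add_less)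
  qed auto
  then show ?thesis by (simp add: sum.cartesian_product)
qed

lemma kron_carrier [simp]:
  "A \<in> carrier_mat m n \<Longrightarrow> B \<in> carrier_mat k l \<Longrightarrow> kron A B \<in> carrier_mat (m * k) (n * l)"
  by (auto simp: kron_def)

lemma kron_index:
  assumes "A \<in> carrier_mat m n" "B \<in> carrier_mat k l" "i < m * k" "j < n * l"
  shows "kron A B $$ (i,j) = A $$ (i div k, j div l) * B $$ (i mod k, j mod l)"
  using assms by (auto simp: kron_def)

lemma kron_mult:
  assumes A: "A \<in> carrier_mat m n" and C: "C \<in> carrier_mat n p"
    and B: "B \<in> carrier_mat k l" and D: "D \<in> carrier_mat l q"
  shows "kron A B * kron C D = kron (A * C) (B * D)"
proof (rule eq_matI)
  note AC = mult_carrier_mat[OF A C] and BD = mult_carrier_mat[OF B D]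
  fix i j assume "i < dim_row (kron (A * C) (B * D))" "j < dim_col (kron (A * C) (B * D))"
  then have ij: "i < m * k" "j < p * q" using kron_carrier[OF AC BD] by auto
  note i = div_mod_less[OF ij(1)] and j = div_mod_less[OF ij(2)]
  have "(kron A B * kron C D) $$ (i,j) = (\<Sum>r<n * l. kron A B $$ (i,r) * kron C D $$ (r,j))"
    by (rule mult_index[OF kron_carrier[OF A B] kron_carrier[OF C D] ij])
  also have "\<dots> = (\<Sum>r<n * l. (\<lambda>x y. A $$ (i div k, x) * B $$ (i mod k, y) * (C $$ (x, j div q) * D $$ (y, j mod q))) (r div l) (r mod l))"
    using ij by (intro sum.cong refl) (simp add: kron_index[OF A B] kron_index[OF C D])
  also have "\<dots> = (\<Sum>x<n. \<Sum>y<l. A $$ (i div k, x) * B $$ (i mod k, y) * (C $$ (x, j div q) * D $$ (y, j mod q)))"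
    by (rule sum_div_mod)
  also have "\<dots> = (A * C) $$ (i div k, j div q) * (B * D) $$ (i mod k, j mod q)"
    unfolding mult_index[OF A C i(1) j(1)] mult_index[OF B D i(2) j(2)] sum_product
    by (intro sum.cong refl) (simp add: mult_ac)
  finally show "(kron A B * kron C D) $$ (i,j) = kron (A * C) (B * D) $$ (i,j)"
    using kron_index[OF AC BD ij] by simp
qed (use assms in \<open>auto simp: kron_def\<close>)

lemma adj_kron:
  assumes A: "A \<in> carrier_mat m n" and B: "B \<in> carrier_mat k l"
  shows "adj (kron A B) = kron (adj A) (adj B)"
proof (rule eq_matI)
  fix i j assume "i < dim_row (kron (adj A) (adj B))" "j < dim_col (kron (adj A) (adj B))"
  then have ij: "i < n * l" "j < m * k" using assms by (auto simp: kron_def)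
  then show "adj (kron A B) $$ (i,j) = kron (adj A) (adj B) $$ (i,j)"
    using assms div_mod_less[OF ij(1)] div_mod_less[OF ij(2)]
    by (simp add: adj_index[OF kron_carrier[OF A B]] kron_index[OF A B] kron_index[OF adj_carrier adj_carrier, OF A B])
qed (use assms in \<open>auto simp: kron_def\<close>)

lemma kron_one: "kron (1\<^sub>m m) (1\<^sub>m n) = 1\<^sub>m (m * n)"
proof (rule eq_matI)
  fix i j assume "i < dim_row (1\<^sub>m (m * n) :: complex mat)" "j < dim_col (1\<^sub>m (m * n) :: complex mat)"
  then have ij: "i < m * n" "j < m * n" by auto
  have "i = j \<longleftrightarrow> i div n = j div n \<and> i mod n = j mod n"
    by (metis div_mult_mod_eq)
  then show "kron (1\<^sub>m m) (1\<^sub>m n) $$ (i,j) = 1\<^sub>m (m * n) $$ (i,j)"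
    using ij div_mod_less[OF ij(1)] div_mod_less[OF ij(2)]
    by (auto simp: kron_index[OF one_carrier_mat one_carrier_mat])
qed (auto simp: kron_def)

text \<open>Row-major indexing makes this an equality of matrices, not just an isomorphism: both
  bracketings read the same three digits of an index in mixed radix.\<close>

lemma kron_assoc: "kron (kron A B) C = kron A (kron B C)"
proof (rule eq_matI)
  let ?a = "dim_row A" and ?b = "dim_row B" and ?c = "dim_row C"
  let ?a' = "dim_col A" and ?b' = "dim_col B" and ?c' = "dim_col C"
  fix i j assume "i < dim_row (kron A (kron B C))" "j < dim_col (kron A (kron B C))"
  then have ij: "i < (?a * ?b) * ?c" "j < (?a' * ?b') * ?c'" by (auto simp: kron_def mult.assoc)
  note i = div_mod_less[OF ij(1)] and j = div_mod_less[OF ij(2)]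
  have ij': "i < ?a * (?b * ?c)" "j < ?a' * (?b' * ?c')" using ij by (auto simp: mult.assoc)
  note i' = div_mod_less[OF ij'(1)] and j' = div_mod_less[OF ij'(2)]
  have e: "x div z div y = x div (y * z)" "x div z mod y = x mod (y * z) div z" "x mod z = x mod (y * z) mod z" for x y z :: nat
    by (cases "z = 0"; simp add: div_mult2_eq mult.commute[of y z] mod_mult2_eq)+
  show "kron (kron A B) C $$ (i,j) = kron A (kron B C) $$ (i,j)"
    using ij ij' i j i' j' unfolding kron_def
    by (simp add: mult.assoc) (simp add: e(1,2) e(3)[of i ?c ?b] e(3)[of j ?c' ?b'])
qed (auto simp: kron_def mult.assoc)

lemma kron_one_left: "kron (1\<^sub>m 1) A = A"
  by (rule eq_matI) (auto simp: kron_def)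

lemma kron_unitary:
  assumes "unitary_mat m U" "unitary_mat n V"
  shows "unitary_mat (m * n) (kron U V)"
proof -
  have c: "U \<in> carrier_mat m m" "V \<in> carrier_mat n n" "adj U * U = 1\<^sub>m m" "adj V * V = 1\<^sub>m n"
    using assms by (auto simp: unitary_mat_def)
  show ?thesis
    unfolding unitary_mat_def adj_kron[OF c(1,2)]
      kron_mult[OF adj_carrier[OF c(1)] c(1) adj_carrier[OF c(2)] c(2)] c(3,4)
    using c(1,2) by (simp add: kron_one)
qed

lemma unitary_one: "unitary_mat n (1\<^sub>m n)"
  by (simp add: unitary_mat_def)

lemma tpow_carrier: "A \<in> carrier_mat d d \<Longrightarrow> tpow t A \<in> carrier_mat (d ^ t) (d ^ t)"
  by (induction t) (auto simp: mult.commute[of d] intro: kron_carrier)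

lemma tpow_mult:
  assumes "A \<in> carrier_mat d d" "B \<in> carrier_mat d d"
  shows "tpow t (A * B) = tpow t A * tpow t B"
proof (induction t)
  case (Suc t)
  show ?case
    using kron_mult[OF tpow_carrier[OF assms(1), of t] tpow_carrier[OF assms(2), of t] assms] Suc by simp
qed simp

lemma tpow_one: "tpow t (1\<^sub>m d) = 1\<^sub>m (d ^ t)"
  by (induction t) (simp_all add: kron_one mult.commute)

lemma tpow_unitary: "unitary_mat d U \<Longrightarrow> unitary_mat (d ^ t) (tpow t U)"
  by (induction t) (auto simp: mult.commute[of d] intro: kron_unitary unitary_one)

lemma tpow_unitary_rep:
  assumes "unitary_rep G d \<pi>"
  shows "unitary_rep G (d ^ t) (\<lambda>g. tpow t (\<pi> g))"
  using assms unfolding unitary_rep_def representation_def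
  by (auto intro: tpow_carrier tpow_unitary simp: tpow_mult[of _ d] tpow_one)

text \<open>In row-major order \<open>v\<close> is a matrix with \<open>k\<close> rows and
  \<open>m\<close> columns, and the Kronecker product with the identity multiplies it by
  \<open>A\<close> from the left. Oracle queries act on the algorithm's state in this way.\<close>

lemma kron_one_mult_vec:
  assumes A: "A \<in> carrier_mat n k" and v: "v \<in> carrier_vec (k * m)" and i: "i < n * m"
  shows "(kron A (1\<^sub>m m) *\<^sub>v v) $ i = (\<Sum>l<k. A $$ (i div m, l) * v $ (l * m + i mod m))"
proof -
  note im = div_mod_less[OF i]
  have "(kron A (1\<^sub>m m) *\<^sub>v v) $ i =
      (\<Sum>r<k * m. (\<lambda>x y. A $$ (i div m, x) * (1\<^sub>m m $$ (i mod m, y)) * v $ (x * m + y)) (r div m) (r mod m))"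
    unfolding mult_vec_index[OF kron_carrier[OF A one_carrier_mat] v i]
    using i by (intro sum.cong refl) (simp add: kron_index[OF A one_carrier_mat])
  also have "\<dots> = (\<Sum>l<k. \<Sum>y<m. A $$ (i div m, l) * (1\<^sub>m m $$ (i mod m, y)) * v $ (l * m + y))"
    by (rule sum_div_mod)
  also have "\<dots> = (\<Sum>l<k. \<Sum>y<m. if y = i mod m then A $$ (i div m, l) * v $ (l * m + y) else 0)"
    using im by (intro sum.cong refl) auto
  finally show ?thesis using im by simp
qed

subsection \<open>Running the queries in parallel\<close>

text \<open>The permutation matrix that swaps the tensor factors of dimensions \<open>a\<close> and
  \<open>b\<close>. With \<open>a = d\<close> and \<open>b = d ^ s\<close> it moves the first
  register behind the other \<open>s\<close>.\<close>

definition rot :: "nat \<Rightarrow> nat \<Rightarrow> complex mat" where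
  "rot a b = mat (a * b) (a * b) (\<lambda>(p,q). if p div a = q mod b \<and> p mod a = q div b then 1 else 0)"

lemma rot_carrier: "rot a b \<in> carrier_mat (a * b) (a * b)"
  by (simp add: rot_def)

lemma rot_unitary: "unitary_mat (a * b) (rot a b)"
proof -
  have "adj (rot a b) * rot a b = 1\<^sub>m (a * b)"
  proof (rule eq_matI)
    fix q r assume "q < dim_row (1\<^sub>m (a * b) :: complex mat)" "r < dim_col (1\<^sub>m (a * b) :: complex mat)"
    then have qr: "q < a * b" "r < a * b" by auto
    note q = div_mod_less[OF qr(1)]
    have "(adj (rot a b) * rot a b) $$ (q,r) =
        (\<Sum>p<a * b. cnj (rot a b $$ (p,q)) * rot a b $$ (p,r))"
      unfolding mult_index[OF adj_carrier[OF rot_carrier] rot_carrier qr]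
      using qr by (intro sum.cong refl) (simp add: adj_index[OF rot_carrier])
    also have "\<dots> = (\<Sum>p<b * a. (\<lambda>x y. if x = q mod b \<and> y = q div b then
        (if q mod b = r mod b \<and> q div b = r div b then 1 else 0) else 0) (p div a) (p mod a))"
      using qr by (intro sum.cong) (auto simp: rot_def mult.commute)
    also have "\<dots> = (\<Sum>x<b. \<Sum>y<a. if x = q mod b \<and> y = q div b then
        (if q mod b = r mod b \<and> q div b = r div b then 1 else 0) else 0)"
      by (rule sum_div_mod)
    also have "\<dots> = (\<Sum>x<b. if x = q mod b then \<Sum>y<a. if y = q div b then
        (if q mod b = r mod b \<and> q div b = r div b then 1 else 0) else 0 else 0)"
      by (intro sum.cong refl) auto
    also have "\<dots> = (if q mod b = r mod b \<and> q div b = r div b then 1 else 0)"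
      using q by simp
    also have "\<dots> = 1\<^sub>m (a * b) $$ (q,r)"
      using qr by (auto, metis div_mult_mod_eq)
    finally show "(adj (rot a b) * rot a b) $$ (q,r) = 1\<^sub>m (a * b) $$ (q,r)" .
  qed (use rot_carrier in auto)
  then show ?thesis by (simp add: unitary_mat_def rot_carrier)
qed

lemma rot_kron:
  assumes A: "A \<in> carrier_mat a a" and B: "B \<in> carrier_mat b b"
  shows "rot a b * kron A B = kron B A * rot a b"
proof (rule eq_matI)
  have Rc': "rot a b \<in> carrier_mat (b * a) (a * b)" using rot_carrier by (simp add: mult.commute)
  fix p q assume "p < dim_row (kron B A * rot a b)" "q < dim_col (kron B A * rot a b)"
  then have pq: "p < b * a" "q < a * b" using A B by (auto simp: kron_def rot_def)
  then have p': "p < a * b" by (simp add: mult.commute)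
  note p = div_mod_less[OF pq(1)] and q = div_mod_less[OF pq(2)]
  have "(rot a b * kron A B) $$ (p,q) =
      (\<Sum>r<a * b. (\<lambda>x y. if y = p div a then if x = p mod a then A $$ (x, q div b) * B $$ (y, q mod b) else 0 else 0)
        (r div b) (r mod b))"
    unfolding mult_index[OF rot_carrier kron_carrier[OF A B] p' pq(2)]
    using pq p' by (intro sum.cong refl) (auto simp: kron_index[OF A B] rot_def)
  also have "\<dots> = (\<Sum>x<a. \<Sum>y<b. if y = p div a then if x = p mod a then A $$ (x, q div b) * B $$ (y, q mod b) else 0 else 0)"
    by (rule sum_div_mod)
  also have "\<dots> = A $$ (p mod a, q div b) * B $$ (p div a, q mod b)"
    using p by simp
  finally have 1: "(rot a b * kron A B) $$ (p,q) = A $$ (p mod a, q div b) * B $$ (p div a, q mod b)" .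
  have "(kron B A * rot a b) $$ (p,q) =
      (\<Sum>r<b * a. (\<lambda>x y. if y = q div b then if x = q mod b then B $$ (p div a, x) * A $$ (p mod a, y) else 0 else 0)
        (r div a) (r mod a))"
    unfolding mult_index[OF kron_carrier[OF B A] Rc' pq]
    using pq by (intro sum.cong refl) (auto simp: kron_index[OF B A] rot_def mult.commute[of b a])
  also have "\<dots> = (\<Sum>x<b. \<Sum>y<a. if y = q div b then if x = q mod b then B $$ (p div a, x) * A $$ (p mod a, y) else 0 else 0)"
    by (rule sum_div_mod)
  also have "\<dots> = B $$ (p div a, q mod b) * A $$ (p mod a, q div b)"
    using q by simp
  finally show "(rot a b * kron A B) $$ (p,q) = (kron B A * rot a b) $$ (p,q)"
    using 1 by (simp add: mult.commute)
qed (use A B in \<open>auto simp: kron_def rot_def mult.commute\<close>)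

lemma foldl_replicate: "foldl f x (replicate k u) = ((\<lambda>\<phi>. f \<phi> u) ^^ k) x"
  by (induction k arbitrary: x) (simp_all add: funpow_Suc_right del: funpow.simps(2))

text \<open>The registers keep rotating while the queries are made, so the initial state must be
  chosen such that the rotations alone lead to the wanted vector.\<close>

lemma unitary_funpow_preimage:
  assumes U: "unitary_mat n U" and \<xi>: "\<xi> \<in> carrier_vec n"
  shows "\<exists>\<phi> \<in> carrier_vec n. ((\<lambda>v. U *\<^sub>v v) ^^ k) \<phi> = \<xi> \<and> \<phi> \<bullet>c \<phi> = \<xi> \<bullet>c \<xi>"
proof (induction k)
  case (Suc k)
  then obtain \<phi> where \<phi>: "\<phi> \<in> carrier_vec n" "((\<lambda>v. U *\<^sub>v v) ^^ k) \<phi> = \<xi>" "\<phi> \<bullet>c \<phi> = \<xi> \<bullet>c \<xi>" by blast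
  have c: "U \<in> carrier_mat n n" "adj U \<in> carrier_mat n n" using U by (auto simp: unitary_mat_def)
  let ?\<psi> = "adj U *\<^sub>v \<phi>"
  have "U *\<^sub>v ?\<psi> = \<phi>"
    using assoc_mult_mat_vec[OF c \<phi>(1)] unitary_adj_right[OF U] \<phi>(1) by simp
  moreover have "?\<psi> \<bullet>c ?\<psi> = \<phi> \<bullet>c \<phi>"
    using unitary_adj_right[OF U] \<phi>(1) by (intro isometry_cscalar[OF c(2)]) simp_all
  ultimately show ?case
    using \<phi> mult_mat_vec_carrier[OF c(2) \<phi>(1)] by (intro bexI[of _ ?\<psi>]) (simp_all add: funpow_swap1)
qed (use \<xi> in auto)

text \<open>Rotating the \<open>Suc s\<close> registers cyclically after every query lets each of them be hit once.\<close>
lemma rotated_queries: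
  assumes P: "P \<in> carrier_mat d d" and \<phi>: "\<phi> \<in> carrier_vec (d * d ^ s * m)" and k: "k \<le> Suc s"
  defines "U \<equiv> kron (rot d (d ^ s)) (1\<^sub>m m)"
  shows "((\<lambda>v. U *\<^sub>v (kron P (1\<^sub>m (d ^ s * m)) *\<^sub>v v)) ^^ k) \<phi> =
    kron (kron (1\<^sub>m (d ^ (Suc s - k))) (tpow k P)) (1\<^sub>m m) *\<^sub>v (((\<lambda>v. U *\<^sub>v v) ^^ k) \<phi>)"
    and "((\<lambda>v. U *\<^sub>v v) ^^ k) \<phi> \<in> carrier_vec (d * d ^ s * m)"
proof -
  let ?n = "d * d ^ s"
  have Uc: "U \<in> carrier_mat (?n * m) (?n * m)"
    unfolding U_def by (intro kron_carrier rot_carrier one_carrier_mat)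
  have fc: "((\<lambda>v. U *\<^sub>v v) ^^ k) \<phi> \<in> carrier_vec (?n * m)" for k
    by (induction k) (use \<phi> Uc in \<open>auto intro: mult_mat_vec_carrier\<close>)
  show "((\<lambda>v. U *\<^sub>v v) ^^ k) \<phi> \<in> carrier_vec (?n * m)" by (rule fc)
  have dims: "d ^ (Suc s - k) * d ^ k = ?n" if "k \<le> Suc s" for k
    using that by (metis le_add_diff_inverse2 power_Suc power_add)
  have Kc: "kron (1\<^sub>m (d ^ (Suc s - k))) (tpow k P) \<in> carrier_mat ?n ?n" if "k \<le> Suc s" for k
    using kron_carrier[OF one_carrier_mat tpow_carrier[OF P]] dims[OF that] by metis
  have P1: "kron P (1\<^sub>m (d ^ s * m)) = kron (kron P (1\<^sub>m (d ^ s))) (1\<^sub>m m)"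
    by (simp add: kron_assoc kron_one)
  \<comment> \<open>The query hits the first register, still untouched as long as
    \<open>k \<le> s\<close>; the swap then puts it at the end, next to the \<open>k\<close>
    registers already hit.\<close>
  have step: "rot d (d ^ s) * kron P (1\<^sub>m (d ^ s)) * kron (1\<^sub>m (d ^ (Suc s - k))) (tpow k P) =
      kron (1\<^sub>m (d ^ (Suc s - Suc k))) (tpow (Suc k) P) * rot d (d ^ s)" if k: "k \<le> s" for k
  proof -
    let ?T = "kron (1\<^sub>m (d ^ (s - k))) (tpow k P)"
    have "d ^ (s - k) * d ^ k = d ^ s" using k by (metis le_add_diff_inverse2 power_add)
    then have Tc: "?T \<in> carrier_mat (d ^ s) (d ^ s)"
      using kron_carrier[OF one_carrier_mat[of "d ^ (s - k)"] tpow_carrier[OF P, of k]] by simp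
    have "kron (1\<^sub>m (d ^ (Suc s - k))) (tpow k P) = kron (1\<^sub>m d) ?T"
      using k by (simp add: Suc_diff_le flip: kron_one kron_assoc)
    then have "kron P (1\<^sub>m (d ^ s)) * kron (1\<^sub>m (d ^ (Suc s - k))) (tpow k P) = kron P ?T"
      using kron_mult[OF P one_carrier_mat one_carrier_mat Tc] P Tc by simp
    then have "rot d (d ^ s) * kron P (1\<^sub>m (d ^ s)) * kron (1\<^sub>m (d ^ (Suc s - k))) (tpow k P) = rot d (d ^ s) * kron P ?T"
      using assoc_mult_mat[OF rot_carrier kron_carrier[OF P one_carrier_mat] Kc[of k]] k by simp
    also have "\<dots> = kron ?T P * rot d (d ^ s)"
      by (rule rot_kron[OF P Tc])
    finally show ?thesis by (simp add: kron_assoc)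
  qed
  show "((\<lambda>v. U *\<^sub>v (kron P (1\<^sub>m (d ^ s * m)) *\<^sub>v v)) ^^ k) \<phi> =
    kron (kron (1\<^sub>m (d ^ (Suc s - k))) (tpow k P)) (1\<^sub>m m) *\<^sub>v (((\<lambda>v. U *\<^sub>v v) ^^ k) \<phi>)"
    using k
  proof (induction k)
    case 0
    have "kron (kron (1\<^sub>m (d ^ Suc s)) (tpow 0 P)) (1\<^sub>m m) = 1\<^sub>m (?n * m)"
      by (simp add: kron_one)
    then show ?case using \<phi> by simp
  next
    case (Suc k)
    then have ks: "k \<le> s" by simp
    let ?v = "((\<lambda>v. U *\<^sub>v v) ^^ k) \<phi>"
    let ?L = "kron (1\<^sub>m (d ^ (Suc s - k))) (tpow k P)" and ?L' = "kron (1\<^sub>m (d ^ (Suc s - Suc k))) (tpow (Suc k) P)"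
    let ?P = "kron P (1\<^sub>m (d ^ s))"
    have Lc: "?L \<in> carrier_mat ?n ?n" "?L' \<in> carrier_mat ?n ?n" using Kc[of k] Kc[of "Suc k"] ks by auto
    have Pc: "?P \<in> carrier_mat ?n ?n" by (rule kron_carrier[OF P one_carrier_mat])
    note K = kron_carrier[OF _ one_carrier_mat]
    have "U * kron ?P (1\<^sub>m m) = kron (rot d (d ^ s) * ?P) (1\<^sub>m m)"
      unfolding U_def using kron_mult[OF rot_carrier Pc one_carrier_mat one_carrier_mat] by simp
    moreover have "kron (rot d (d ^ s) * ?P) (1\<^sub>m m) * kron ?L (1\<^sub>m m) = kron (?L' * rot d (d ^ s)) (1\<^sub>m m)"
      using kron_mult[OF mult_carrier_mat[OF rot_carrier Pc] Lc(1) one_carrier_mat one_carrier_mat] step[OF ks] by simp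
    moreover have "\<dots> = kron ?L' (1\<^sub>m m) * U"
      unfolding U_def using kron_mult[OF Lc(2) rot_carrier one_carrier_mat one_carrier_mat] by simp
    ultimately have eq: "U * kron ?P (1\<^sub>m m) * kron ?L (1\<^sub>m m) = kron ?L' (1\<^sub>m m) * U" by metis
    have "U *\<^sub>v (kron ?P (1\<^sub>m m) *\<^sub>v (kron ?L (1\<^sub>m m) *\<^sub>v ?v)) = (U * kron ?P (1\<^sub>m m) * kron ?L (1\<^sub>m m)) *\<^sub>v ?v"
      using assoc_mult_mat_vec[OF mult_carrier_mat[OF Uc K[OF Pc]] K[OF Lc(1)] fc]
        assoc_mult_mat_vec[OF Uc K[OF Pc] mult_mat_vec_carrier[OF K[OF Lc(1)] fc]] by metis
    also have "\<dots> = kron ?L' (1\<^sub>m m) *\<^sub>v (U *\<^sub>v ?v)"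
      unfolding eq by (rule assoc_mult_mat_vec[OF K[OF Lc(2)] Uc fc])
    finally show ?case using Suc ks unfolding P1 by simp
  qed
qed

section \<open>States of query algorithms\<close>

lemma alg_state_snoc:
  "alg_state \<pi> N \<psi> (Us @ [U]) a = U *\<^sub>v (kron (\<pi> a) (1\<^sub>m N) *\<^sub>v alg_state \<pi> N \<psi> Us a)"
  by (simp add: alg_state_def)

lemma alg_state_carrier:
  assumes "\<pi> a \<in> carrier_mat d d" "\<psi> \<in> carrier_vec (d * N)" "\<forall>U \<in> set Us. U \<in> carrier_mat (d * N) (d * N)"
  shows "alg_state \<pi> N \<psi> Us a \<in> carrier_vec (d * N)"
  using assms(3)
proof (induction Us rule: rev_induct)
  case (snoc U Us)
  then show ?case
    unfolding alg_state_snoc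
    by (intro mult_mat_vec_carrier[OF _ mult_mat_vec_carrier[OF kron_carrier[OF assms(1) one_carrier_mat]]]) auto
qed (use assms in \<open>simp add: alg_state_def\<close>)

lemma alg_state_norm:
  assumes u: "unitary_mat d (\<pi> a)" and \<psi>: "\<psi> \<in> carrier_vec (d * N)" and Us: "\<forall>U \<in> set Us. unitary_mat (d * N) U"
  shows "alg_state \<pi> N \<psi> Us a \<bullet>c alg_state \<pi> N \<psi> Us a = \<psi> \<bullet>c \<psi>"
  using Us
proof (induction Us rule: rev_induct)
  case (snoc U Us)
  have pc: "\<pi> a \<in> carrier_mat d d" using u by (simp add: unitary_mat_def)
  have Kc: "kron (\<pi> a) (1\<^sub>m N) \<in> carrier_mat (d * N) (d * N)" "adj (kron (\<pi> a) (1\<^sub>m N)) * kron (\<pi> a) (1\<^sub>m N) = 1\<^sub>m (d * N)"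
    using kron_unitary[OF u unitary_one[of N]] by (auto simp: unitary_mat_def)
  have U: "U \<in> carrier_mat (d * N) (d * N)" "adj U * U = 1\<^sub>m (d * N)" using snoc by (auto simp: unitary_mat_def)
  have sc: "alg_state \<pi> N \<psi> Us a \<in> carrier_vec (d * N)"
    using snoc by (intro alg_state_carrier pc \<psi>) (auto simp: unitary_mat_def)
  show ?case
    unfolding alg_state_snoc isometry_cscalar[OF U mult_mat_vec_carrier[OF Kc(1) sc]] isometry_cscalar[OF Kc sc]
    using snoc by simp
qed (simp add: alg_state_def)

text \<open>The amplitudes of the final state are linear in the entries of \<open>tpow t (\<pi> a)\<close>, phrased dually:
  every linear relation between these entries carries over to the states.\<close>
lemma alg_state_relation:
  assumes \<pi>: "\<And>a. a \<in> A \<Longrightarrow> \<pi> a \<in> carrier_mat d d" and \<psi>: "\<psi> \<in> carrier_vec (d * N)"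
    and Us: "\<forall>U \<in> set Us. U \<in> carrier_mat (d * N) (d * N)"
    and rel: "\<And>p q. p < d ^ length Us \<Longrightarrow> q < d ^ length Us \<Longrightarrow> (\<Sum>a\<in>A. c a * tpow (length Us) (\<pi> a) $$ (p,q)) = 0"
    and i: "i < d * N"
  shows "(\<Sum>a\<in>A. c a * alg_state \<pi> N \<psi> Us a $ i) = 0"
  using Us rel i
proof (induction Us arbitrary: c i rule: rev_induct)
  case Nil
  \<comment> \<open>The power with exponent 0 is the 1 by 1 identity, so its single entry yields the
    relation between the bare coefficients.\<close>
  have "(\<Sum>a\<in>A. c a) = 0" using Nil(2)[of 0 0] by simp
  then show ?case by (simp add: alg_state_def flip: sum_distrib_right)
next
  case (snoc U Us)
  let ?st = "\<lambda>a. alg_state \<pi> N \<psi> Us a" and ?k = "length Us"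
  let ?K = "\<lambda>a. kron (\<pi> a) (1\<^sub>m N)"
  have Uc: "U \<in> carrier_mat (d * N) (d * N)" using snoc by simp
  have Kc: "?K a \<in> carrier_mat (d * N) (d * N)" if "a \<in> A" for a
    by (rule kron_carrier[OF \<pi>[OF that] one_carrier_mat])
  have sc: "?st a \<in> carrier_vec (d * N)" if "a \<in> A" for a
    using snoc by (intro alg_state_carrier \<pi> that \<psi>) auto
  \<comment> \<open>An entry of the last query is absorbed into the coefficients, which is why
    \<open>c\<close> is generalised in the induction. The entry at
    \<open>(p * d + x, q * d + y)\<close> of the larger tensor power supplies the relation.\<close>
  have IH: "(\<Sum>a\<in>A. (c a * \<pi> a $$ (x,y)) * ?st a $ r) = 0" if xy: "x < d" "y < d" and r: "r < d * N" for x y r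
  proof (rule snoc.IH[OF _ _ r])
    fix p q assume pq: "p < d ^ ?k" "q < d ^ ?k"
    have b: "p * d + x < d ^ ?k * d" "q * d + y < d ^ ?k * d" using pq xy by (auto intro: mult_add_less)
    have "(\<Sum>a\<in>A. c a * tpow (Suc ?k) (\<pi> a) $$ (p * d + x, q * d + y)) = 0"
      using snoc.prems(2)[of "p * d + x" "q * d + y"] b by (simp add: mult.commute)
    moreover have "tpow (Suc ?k) (\<pi> a) $$ (p * d + x, q * d + y) = tpow ?k (\<pi> a) $$ (p,q) * \<pi> a $$ (x,y)"
      if "a \<in> A" for a
      using kron_index[OF tpow_carrier[OF \<pi>[OF that]] \<pi>[OF that] b] xy by simp
    ultimately show "(\<Sum>a\<in>A. (c a * \<pi> a $$ (x,y)) * tpow ?k (\<pi> a) $$ (p,q)) = 0"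
      by (simp add: mult_ac cong: sum.cong)
  qed (use snoc in auto)
  have K0: "(\<Sum>a\<in>A. c a * (?K a *\<^sub>v ?st a) $ l) = 0" if l: "l < d * N" for l
  proof -
    have "(\<Sum>a\<in>A. c a * (?K a *\<^sub>v ?st a) $ l) =
        (\<Sum>a\<in>A. \<Sum>x<d. (c a * \<pi> a $$ (l div N, x)) * ?st a $ (x * N + l mod N))"
      by (intro sum.cong refl) (simp add: kron_one_mult_vec[OF \<pi> sc l] sum_distrib_left mult_ac)
    also have "\<dots> = (\<Sum>x<d. \<Sum>a\<in>A. (c a * \<pi> a $$ (l div N, x)) * ?st a $ (x * N + l mod N))"
      by (rule sum.swap)
    also have "\<dots> = 0"
      using div_mod_less[OF l] by (intro sum.neutral ballI IH) (auto intro: mult_add_less)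
    finally show ?thesis .
  qed
  have "(\<Sum>a\<in>A. c a * alg_state \<pi> N \<psi> (Us @ [U]) a $ i) =
      (\<Sum>a\<in>A. \<Sum>l<d * N. U $$ (i,l) * (c a * (?K a *\<^sub>v ?st a) $ l))"
    unfolding alg_state_snoc
    by (intro sum.cong refl)
      (simp add: mult_vec_index[OF Uc mult_mat_vec_carrier[OF Kc sc] snoc.prems(3)] sum_distrib_left mult_ac
        del: index_mult_mat_vec)
  also have "\<dots> = (\<Sum>l<d * N. U $$ (i,l) * (\<Sum>a\<in>A. c a * (?K a *\<^sub>v ?st a) $ l))"
    unfolding sum_distrib_left by (rule sum.swap)
  also have "\<dots> = 0" by (simp add: K0 del: index_mult_mat_vec)
  finally show ?case .
qed

section \<open>Optimality: the upper bound and an algorithm attaining it\<close>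

theorem theorem8:
  fixes G :: "('a, 'b) monoid_scheme" and \<pi> :: "'a \<Rightarrow> complex mat" and d t :: nat
  assumes "group G" and "finite (carrier G)"
    and "d > 0" and "unitary_rep G d \<pi>"
    and "t \<ge> 1"
  shows "\<exists>p. p \<in> success_probs G \<pi> d t \<and> (\<forall>q \<in> success_probs G \<pi> d t. q \<le> p) \<and>
           complex_of_real p = (1 / of_nat (card (carrier G))) *
             (\<Sum>\<chi> \<in> irr_chars G (d ^ t) (\<lambda>g. tpow t (\<pi> g)). (\<chi> \<one>\<^bsub>G\<^esub>) ^ 2)"
proof -
  define m where "m = d ^ t"
  define W where "W = (\<lambda>g. tpow t (\<pi> g))"
  interpret finite_group G using assms by (simp add: finite_group_def finite_group_axioms_def)
  interpret unitary_representation G m W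
    using tpow_unitary_rep[OF assms(4)] assms(3) by unfold_locales (simp_all add: m_def W_def)
  let ?p = "real D / real N"
  have \<pi>u: "unitary_mat d (\<pi> g)" if "g \<in> carrier G" for g using assms(4) that by (simp add: unitary_rep_def)
  have \<pi>c: "\<pi> g \<in> carrier_mat d d" if "g \<in> carrier G" for g using \<pi>u[OF that] by (simp add: unitary_mat_def)
  note Wc = rep_carrier[OF rep]
  have val: "complex_of_real ?p = (1 / of_nat N) * (\<Sum>\<chi>\<in>I. (\<chi> \<one>\<^bsub>G\<^esub>) ^ 2)"
    by (simp add: D_def irr_chars_one)
  have upper: "q \<le> ?p" if q: "q \<in> success_probs G \<pi> d t" for q
  proof -
    obtain n \<psi> Us E where q: "q = success_prob G \<pi> n \<psi> Us E" and v: "valid_alg G d t n \<psi> Us E"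
      using q by (auto simp: success_probs_def)
    let ?st = "alg_state \<pi> n \<psi> Us"
    have v: "\<psi> \<in> carrier_vec (d * n)" "\<psi> \<bullet>c \<psi> = 1" "length Us = t" "\<forall>U \<in> set Us. unitary_mat (d * n) U"
      "\<And>x. x \<in> carrier G \<Longrightarrow> psd_mat (d * n) (E x)"
      "\<And>i j. i < d * n \<Longrightarrow> j < d * n \<Longrightarrow> (\<Sum>x \<in> carrier G. E x $$ (i,j)) = (1\<^sub>m (d * n)) $$ (i,j)"
      using v by (auto simp: valid_alg_def)
    have Uc: "\<forall>U \<in> set Us. U \<in> carrier_mat (d * n) (d * n)" using v(4) by (simp add: unitary_mat_def)
    obtain J :: "(('a \<Rightarrow> complex) \<times> nat \<times> nat) set" and c b where J: "finite J" "card J = D"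
      "\<And>g h. g \<in> carrier G \<Longrightarrow> h \<in> carrier G \<Longrightarrow> kern (inv\<^bsub>G\<^esub> h \<otimes>\<^bsub>G\<^esub> g) = (\<Sum>j\<in>J. c j h * b j g)"
      using kern_factor by blast
    have "(\<Sum>a\<in>carrier G. Re ((E a *\<^sub>v ?st a) \<bullet>c ?st a)) \<le> card J"
    proof (rule povm_span_bound[OF fin J(1) v(5,6), where c = c and w = "\<lambda>j i. \<Sum>g\<in>carrier G. b j g * ?st g $ i"])
      show "?st a \<in> carrier_vec (d * n)" if "a \<in> carrier G" for a
        by (rule alg_state_carrier[of \<pi>, OF \<pi>c[OF that] v(1) Uc])
      show "?st a \<bullet>c ?st a = 1" if "a \<in> carrier G" for a
        using alg_state_norm[of d \<pi>, OF \<pi>u[OF that] v(1,4)] v(2) by simp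
      fix h i assume h: "h \<in> carrier G" and i: "i < d * n"
      \<comment> \<open>The coefficients say that the state at \<open>h\<close> is its own kernel
        expansion. The same relation holds between the entries of \<open>W\<close> by
        \<open>rep_expand\<close>, so it passes to the states.\<close>
      have "(\<Sum>g\<in>carrier G. (kern (inv\<^bsub>G\<^esub> h \<otimes>\<^bsub>G\<^esub> g) - (if g = h then 1 else 0)) * ?st g $ i) = 0"
      proof (rule alg_state_relation[of _ \<pi>, OF \<pi>c v(1) Uc _ i])
        fix x y assume "x < d ^ length Us" "y < d ^ length Us"
        then have xy: "x < m" "y < m" by (auto simp: v m_def)
        have "W h $$ (x,y) = (\<Sum>g\<in>carrier G. kern (inv\<^bsub>G\<^esub> h \<otimes>\<^bsub>G\<^esub> g) * W g $$ (x,y))"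
          using arg_cong[OF rep_expand[OF h], of "\<lambda>M. M $$ (x,y)"] xy
          by (simp add: smult_index[OF Wc] cong: sum.cong)
        then show "(\<Sum>g\<in>carrier G. (kern (inv\<^bsub>G\<^esub> h \<otimes>\<^bsub>G\<^esub> g) - (if g = h then 1 else 0)) * tpow (length Us) (\<pi> g) $$ (x,y)) = 0"
          using h fin unfolding v(3) by (simp add: W_def left_diff_distrib sum_subtractf if_distrib[of "\<lambda>z. z * _"] cong: if_cong)
      qed
      then have "?st h $ i = (\<Sum>g\<in>carrier G. kern (inv\<^bsub>G\<^esub> h \<otimes>\<^bsub>G\<^esub> g) * ?st g $ i)"
        using h fin by (simp add: left_diff_distrib sum_subtractf if_distrib[of "\<lambda>z. z * _"] cong: if_cong)
      also have "\<dots> = (\<Sum>g\<in>carrier G. \<Sum>j\<in>J. c j h * (b j g * ?st g $ i))"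
        by (intro sum.cong refl) (simp add: J(3) h sum_distrib_right mult.assoc)
      also have "\<dots> = (\<Sum>j\<in>J. c j h * (\<Sum>g\<in>carrier G. b j g * ?st g $ i))"
        unfolding sum_distrib_left by (rule sum.swap)
      finally show "?st h $ i = (\<Sum>j\<in>J. c j h * (\<Sum>g\<in>carrier G. b j g * ?st g $ i))" .
    qed
    then show ?thesis
      unfolding q success_prob_def using J(2) card_pos by (simp add: divide_right_mono)
  qed
  obtain s where s: "t = Suc s" using assms(5) by (cases t) auto
  have dm: "d * d ^ s = m" by (simp add: m_def s)
  obtain X where X: "X \<in> carrier_mat m m"
    "\<And>a. a \<in> carrier G \<Longrightarrow> mtrace ((W a * X) * adj (W a * X)) = 1"
    "\<And>a i j. a \<in> carrier G \<Longrightarrow> i < m \<Longrightarrow> j < m \<Longrightarrow>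
      (\<Sum>b\<in>carrier G. mtrace ((W a * X) * adj (W b * X)) * (W b * X) $$ (i,j)) =
      of_nat N / of_nat D * (W a * X) $$ (i,j)"
    by (rule tight_frame) (rule that, assumption, simp_all)
  define vec_of where "vec_of Y = vec (m * m) (\<lambda>i. Y $$ (i div m, i mod m))" for Y :: "complex mat"
  have vc: "vec_of Y \<in> carrier_vec (m * m)" for Y by (simp add: vec_of_def)
  have vip: "vec_of Y \<bullet>c vec_of Z = mtrace (Y * adj Z)" if "Y \<in> carrier_mat m m" "Z \<in> carrier_mat m m" for Y Z
  proof -
    have "vec_of Y \<bullet>c vec_of Z = (\<Sum>k<m * m. (\<lambda>i j. Y $$ (i,j) * cnj (Z $$ (i,j))) (k div m) (k mod m))"
      unfolding cscalar_sum[OF vc vc] by (intro sum.cong refl) (simp add: vec_of_def)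
    also have "\<dots> = mtrace (Y * adj Z)"
      unfolding mtrace_mult_adj[OF that] by (rule sum_div_mod)
    finally show ?thesis .
  qed
  define v where "v a = vec_of (W a * X)" for a
  have WX: "W a * X \<in> carrier_mat m m" if "a \<in> carrier G" for a by (rule mult_carrier_mat[OF Wc[OF that] X(1)])
  have vv: "v a \<bullet>c v b = mtrace ((W a * X) * adj (W b * X))" if "a \<in> carrier G" "b \<in> carrier G" for a b
    unfolding v_def by (rule vip[OF WX[OF that(1)] WX[OF that(2)]])
  have Wv: "kron (W a) (1\<^sub>m m) *\<^sub>v vec_of X = v a" if a: "a \<in> carrier G" for a
  proof (rule eq_vecI)
    fix i assume "i < dim_vec (v a)"
    then have i: "i < m * m" by (simp add: v_def vec_of_def)
    note im = div_mod_less[OF i]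
    have "(kron (W a) (1\<^sub>m m) *\<^sub>v vec_of X) $ i = (\<Sum>l<m. W a $$ (i div m, l) * X $$ (l, i mod m))"
      unfolding kron_one_mult_vec[OF Wc[OF a] vc i]
      using im by (intro sum.cong refl) (simp add: vec_of_def mult_add_less)
    then show "(kron (W a) (1\<^sub>m m) *\<^sub>v vec_of X) $ i = v a $ i"
      using i mult_index[OF Wc[OF a] X(1) im] by (simp add: v_def vec_of_def)
  qed (use Wc[OF a] in \<open>simp add: kron_def v_def vec_of_def\<close>)
  obtain E where E: "\<And>x. x \<in> carrier G \<Longrightarrow> psd_mat (m * m) (E x)"
    "\<And>i j. i < m * m \<Longrightarrow> j < m * m \<Longrightarrow> (\<Sum>x\<in>carrier G. E x $$ (i,j)) = 1\<^sub>m (m * m) $$ (i,j)"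
    "\<And>a. a \<in> carrier G \<Longrightarrow> (E a *\<^sub>v v a) \<bullet>c v a = 1 / complex_of_real (real N / real D)"
  proof (rule tight_frame_povm[of "carrier G" "real N / real D" v "m * m"])
    show "0 < real N / real D" using card_pos D_pos by simp
    show "v a \<in> carrier_vec (m * m)" for a by (simp add: v_def vec_of_def)
    show "v a \<bullet>c v a = 1" if "a \<in> carrier G" for a using vv[OF that that] X(2)[OF that] by simp
    fix a i assume a: "a \<in> carrier G" and i: "i < m * m"
    have "(\<Sum>b\<in>carrier G. (v a \<bullet>c v b) * v b $ i) =
        (\<Sum>b\<in>carrier G. mtrace ((W a * X) * adj (W b * X)) * (W b * X) $$ (i div m, i mod m))"
      using i by (intro sum.cong refl) (simp add: vv[OF a], simp add: v_def vec_of_def)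
    then show "(\<Sum>b\<in>carrier G. (v a \<bullet>c v b) * v b $ i) = complex_of_real (real N / real D) * v a $ i"
      using X(3)[OF a div_mod_less[OF i]] i by (simp add: v_def vec_of_def)
  qed (use fin one_closed in auto)
  let ?U = "kron (rot d (d ^ s)) (1\<^sub>m m)" and ?n = "d ^ s * m"
  have dn: "d * ?n = m * m" by (simp add: dm flip: mult.assoc)
  have U: "unitary_mat (m * m) ?U"
    using kron_unitary[OF rot_unitary[of d "d ^ s"] unitary_one[of m]] by (simp add: dm)
  obtain \<psi> where \<psi>: "\<psi> \<in> carrier_vec (m * m)" "((\<lambda>v. ?U *\<^sub>v v) ^^ t) \<psi> = vec_of X" "\<psi> \<bullet>c \<psi> = vec_of X \<bullet>c vec_of X"
    using unitary_funpow_preimage[OF U vc] by blast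
  \<comment> \<open>After \<open>t\<close> rounds every register has been hit once. The rotations
    alone carry \<psi> to \<open>vec_of X\<close>, so the net effect is one application of
    \<open>W a\<close> to it.\<close>
  have st: "alg_state \<pi> ?n \<psi> (replicate t ?U) a = v a" if a: "a \<in> carrier G" for a
  proof -
    have "\<psi> \<in> carrier_vec (d * d ^ s * m)" using \<psi>(1) by (simp add: dm)
    from rotated_queries(1)[OF \<pi>c[OF a] this, of t]
    have "alg_state \<pi> ?n \<psi> (replicate t ?U) a = kron (kron (1\<^sub>m 1) (W a)) (1\<^sub>m m) *\<^sub>v vec_of X"
      unfolding alg_state_def foldl_replicate using \<psi>(2) by (simp add: s W_def)
    then show ?thesis using Wv[OF a] unfolding kron_one_left by simp
  qed
  have "vec_of X \<bullet>c vec_of X = v \<one>\<^bsub>G\<^esub> \<bullet>c v \<one>\<^bsub>G\<^esub>"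
    unfolding v_def rep_one[OF rep] using X(1) by simp
  then have "\<psi> \<bullet>c \<psi> = 1" using \<psi>(3) vv[OF one_closed one_closed] X(2)[OF one_closed] by simp
  then have valid: "valid_alg G d t ?n \<psi> (replicate t ?U) E"
    unfolding valid_alg_def dn using \<psi>(1) U E(1,2) assms(3) m_pos by (auto simp: Suc_le_eq)
  have "success_prob G \<pi> ?n \<psi> (replicate t ?U) E \<in> success_probs G \<pi> d t"
    unfolding success_probs_def using valid by blast
  moreover have "success_prob G \<pi> ?n \<psi> (replicate t ?U) E = ?p"
    using card_pos by (simp add: success_prob_def st E(3) Re_divide_of_real flip: of_real_divide)
  ultimately have "?p \<in> success_probs G \<pi> d t" by simp
  then show ?thesis using upper val unfolding m_def W_def by blast
qed

end
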